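(* Let $\lambda\in\{1,-1\}$ and let $q(x,t)=\epsilon q_1(x,t)+\epsilon^2q_2(x,t)+\cdots$ be the perturbative solution (in the small parameter $\epsilon>0$) of the NLS equation $iq_t+q_{xx}-2\lambda|q|^2q=0$ on the half-line $x>0$ satisfying $q(x,0)=0$ for $x>0$ and $q(0,t)=\epsilon g_{01}(t)+\epsilon^2g_{02}(t)+\cdots$, where the $g_{0n}$ are sufficiently smooth with $g_{0n}(0)=\dot g_{0n}(0)=\ddot g_{0n}(0)=\cdots=0$ for all $n\ge1$. Write $q_x(0,t)=\epsilon g_{11}(t)+\epsilon^2g_{12}(t)+\epsilon^3g_{13}(t)+\cdots$. Then, with $c=\frac{\sqrt\pi}{2}e^{-i\pi/4}$, $$g_{11}(t)=-\frac{e^{-i\pi/4}}{\sqrt\pi}\int_0^t\frac{\dot g_{01}(t')}{\sqrt{t-t'}}dt',\qquad g_{12}(t)=-\frac{e^{-i\pi/4}}{\sqrt\pi}\int_0^t\frac{\dot g_{02}(t')}{\sqrt{t-t'}}dt',$$ and $$\begin{aligned}g_{13}(t)=\;&\frac{2\lambda c}{\pi i}\int_0^t\frac{|g_{01}(t')|^2g_{01}(t')}{\sqrt{t-t'}}dt'-\frac{2\lambda c}{\pi i}\int_0^t|g_{01}(t')|^2\int_0^{t'}\frac{\dot g_{01}(t'')}{\sqrt{t-t''}}dt''dt'-\frac{2c}{\pi}\int_0^t\frac{\dot g_{03}(t')}{\sqrt{t-t'}}dt'\\&-\frac{\lambda c}{\pi i}\int_0^tg_{01}(t')\int_0^{t'}\bar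 g_{01}(t'')\int_0^{t''}\frac{\dot g_{01}(t''')}{(t-t'+t''-t''')^{3/2}}dt'''dt''dt'\\&+\frac{\lambda c}{\pi}\int_0^tg_{01}(t')\int_0^{t'}\bar g_{11}(t'')\int_0^{t''}\frac{g_{11}(t''')}{(t-t'+t''-t''')^{3/2}}dt'''dt''dt'\\&-\frac{\lambda c}{\pi}\int_0^tg_{11}(t')\int_0^{t'}\bar g_{01}(t'')\int_0^{t''}\frac{g_{11}(t''')}{(t-t'+t''-t''')^{3/2}}dt'''dt''dt'\\&+\frac{\lambda c}{\pi}\int_0^tg_{11}(t')\int_0^{t'}\bar g_{11}(t'')\int_0^{t''}\frac{g_{01}(t''')}{(t-t'+t''-t''')^{3/2}}dt'''dt''dt'\\&+i\lambda g_{01}(t)\int_0^t\big[\bar g_{01}(t')g_{11}(t')-\bar g_{11}(t')g_{01}(t')\big]dt'.\end{aligned}$$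
   Context: Dots denote derivatives with respect to $t$ and bars denote complex conjugation. The perturbative solution means the formal expansion in powers of $\epsilon$ obtained by substituting the series into the equation and the initial and boundary conditions and equating powers of $\epsilon$. *)

theory Defs
  imports "HOL-Analysis.Analysis"
begin

definition px :: "(real \<Rightarrow> real \<Rightarrow> complex) \<Rightarrow> real \<Rightarrow> real \<Rightarrow> complex" where
  "px q x t = vector_derivative (\<lambda>y. q y t) (at x within {0..})"

definition pt :: "(real \<Rightarrow> real \<Rightarrow> complex) \<Rightarrow> real \<Rightarrow> real \<Rightarrow> complex" where
  "pt q x t = vector_derivative (\<lambda>s. q x s) (at t within {0..})"

definition vd :: "nat \<Rightarrow> (real \<Rightarrow> complex) \<Rightarrow> real \<Rightarrow> complex" where
  "vd k g = ((\<lambda>f t. vector_derivative f (at t within {0..})) ^^ k) g"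

definition flat_smooth :: "(real \<Rightarrow> complex) \<Rightarrow> bool" where
  "flat_smooth g \<longleftrightarrow>
     (\<forall>k. \<forall>t\<ge>0. (vd k g has_vector_derivative vd (Suc k) g t) (at t within {0..}))
   \<and> (\<forall>k. vd k g 0 = 0)"

definition halfline_class :: "(real \<Rightarrow> real \<Rightarrow> complex) \<Rightarrow> bool" where
  "halfline_class q \<longleftrightarrow>
     (\<forall>x\<ge>0. \<forall>t\<ge>0.
        ((\<lambda>y. q y t) has_vector_derivative px q x t) (at x within {0..})
      \<and> ((\<lambda>y. px q y t) has_vector_derivative px (px q) x t) (at x within {0..})
      \<and> ((\<lambda>s. q x s) has_vector_derivative pt q x t) (at t within {0..}))
   \<and> continuous_on ({0..} \<times> {0..}) (\<lambda>(x,t). q x t)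
   \<and> continuous_on ({0..} \<times> {0..}) (\<lambda>(x,t). px q x t)
   \<and> continuous_on ({0..} \<times> {0..}) (\<lambda>(x,t). px (px q) x t)
   \<and> continuous_on ({0..} \<times> {0..}) (\<lambda>(x,t). pt q x t)
   \<and> (\<forall>T. \<exists>C. \<forall>x\<ge>0. \<forall>t\<in>{0..T}.
        (1 + x)^2 * (norm (q x t) + norm (px q x t) + norm (px (px q) x t) + norm (pt q x t)) \<le> C)"

definition lin_schr_bvp ::
  "(real \<Rightarrow> real \<Rightarrow> complex) \<Rightarrow> (real \<Rightarrow> real \<Rightarrow> complex) \<Rightarrow> (real \<Rightarrow> complex) \<Rightarrow> bool" where
  "lin_schr_bvp q F h \<longleftrightarrow>
     halfline_class q
   \<and> (\<forall>x>0. \<forall>t>0. \<i> * pt q x t + px (px q) x t = F x t)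
   \<and> (\<forall>x>0. q x 0 = 0)
   \<and> (\<forall>t>0. q 0 t = h t)"

end

theory Submission
  imports Defs "HOL-Probability.Probability" "HOL-Real_Asymp.Real_Asymp"
begin

text \<open>
  Write \<open>q = q1\<close>, \<open>p = q3\<close> and fix a real frequency \<open>k\<close>. The Lax pair of NLS, expanded to third order,
  provides potentials of closed one-forms on the quadrant. Integrating the third one over \<open>x > 0\<close> at time \<open>t\<close>
  and over \<open>0 < s < t\<close> at \<open>x = 0\<close> gives a global relation in which the cubic forcing no longer occurs: an oscillatory
  integral of \<open>p\<^sub>x\<close> and an iterated integral of \<open>q\<close>, \<open>cnj q\<close>, \<open>q\<close> at time \<open>t\<close> equal iterated integrals of the boundary values.
  The unknown boundary value of \<open>p\<^sub>x\<close> enters the time side only through terms odd in \<open>k\<close>. Multiplying by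
  \<open>exp (- \<i> k\<^sup>2 t - d\<^sup>2 k\<^sup>2) / (2 pi)\<close>, integrating over \<open>k\<close> and letting \<open>d \<rightarrow> 0\<close> kills these terms, turns the exponentials on the
  time side into the kernels \<open>\<sigma>\<close> to the power \<open>-1/2\<close> and \<open>-3/2\<close>, and concentrates the spatial side at \<open>x = 0\<close>, where it yields
  half of \<open>p\<^sub>x(0,t)\<close> and \<open>lam/2\<close> times \<open>q(0,t)\<close> times the mass of \<open>q\<close>, the latter being a flux integral.
  The linear formulas are the case \<open>lam = 0\<close>.
\<close>

subsection \<open>Calculus on the half-line\<close>

text \<open>\<open>halfline_class\<close> gives two derivatives in \<open>x\<close>, one in
  \<open>t\<close>, and control at infinity through the weight \<open>(1 + x)^2\<close>. The
  potentials are therefore integrals over compact time intervals, whose \<open>x\<close>-derivatives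
  come from conservation laws without mixed derivatives; integrals over the half-line enter only at
  fixed time, through decay. The factor \<open>k\<close> in the global relation does two jobs: it
  makes the unknown contribution of \<open>px p\<close> odd, and in space it permits one integration
  by parts from \<open>p\<close> to \<open>px p\<close>. The price is growth in \<open>k\<close> on
  both sides, which the Gaussian absorbs; \<open>k\<close> stays real and no contour is deformed.
  Two facts keep the limit finite. In time, the power -3/2 of the lag \<open>t - s + r - v\<close>
  becomes \<open>(t - s)\<close> to the power -1/2 after the innermost integration. In space, with
  \<open>q\<close>, \<open>cnj q\<close>, \<open>q\<close> at positions \<open>u\<close>,
  \<open>u + p\<close>, \<open>u + p + v\<close>, the phases combine to \<open>k * (u + v)\<close>:
  the Gaussian transform has size \<open>1 / d^2\<close> and forces \<open>u\<close> and
  \<open>v\<close> to be of size \<open>d\<close>, while the gap \<open>p\<close> carries no phase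
  and its integral is left over as the mass.\<close>

lemma continuous_on_integral_upto:
  fixes f :: "'a::topological_space \<Rightarrow> real \<Rightarrow> complex"
  assumes "continuous_on (X \<times> {0..}) (\<lambda>(x,s). f x s)"
  shows "continuous_on (X \<times> {0..}) (\<lambda>(x,t). integral {0..t} (f x))"
proof -
  \<comment> \<open>Rescaling by \<open>t\<close> moves the variable endpoint into the integrand, so
    that continuity in parameters over the fixed interval \<open>{0..1}\<close> applies.\<close>
  have eq: "integral {0..t} (f x) = t *\<^sub>R integral {0..1} (\<lambda>u. f x (t * u))"
    if "x \<in> X" "t \<ge> 0" for x t
  proof (cases "t = 0")
    case False
    with that have t: "t > 0" by simp
    have "continuous_on {0..t} (f x)"
      by (rule continuous_on_compose2[OF assms, of _ "\<lambda>s. (x, s)", simplified])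
        (use that in \<open>auto intro!: continuous_intros\<close>)
    then have "(f x has_integral integral {0..t} (f x)) {0..t}"
      by (intro integrable_integral integrable_continuous_real)
    from has_integral_stretch_real[OF this, of t] t
    have "((\<lambda>u. f x (t * u)) has_integral (1 / t) *\<^sub>R integral {0..t} (f x)) ((\<lambda>x. x / t) ` {0..t})"
      by simp
    moreover have "(\<lambda>x. x / t) ` {0..t} = {0..1}"
      using t by (auto simp: image_iff field_simps intro!: bexI[of _ "_ * t"])
    ultimately have "integral {0..1} (\<lambda>u. f x (t * u)) = (1 / t) *\<^sub>R integral {0..t} (f x)"
      by (simp add: integral_unique)
    then show ?thesis using t by simp
  qed simp
  have "continuous_on (X \<times> {0..}) (\<lambda>z. integral (cbox 0 1) (\<lambda>u. f (fst z) (snd z * u)))"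
    by (rule integral_continuous_on_param, unfold split_beta)
      (rule continuous_on_compose2[OF assms, of _ "\<lambda>w. (fst (fst w), snd (fst w) * snd w)", simplified],
        auto intro!: continuous_intros)
  then have "continuous_on (X \<times> {0..})
      (\<lambda>z. snd z *\<^sub>R integral {0..1} (\<lambda>u. f (fst z) (snd z * u)))"
    by (intro continuous_intros) (auto)
  then show ?thesis
    by (rule continuous_on_eq) (auto simp: eq)
qed

lemma continuous_on_integral_upto':
  fixes f :: "real \<Rightarrow> real \<Rightarrow> complex"
  assumes "continuous_on (X \<times> {0..}) (\<lambda>z. f (fst z) (snd z))"
  shows "continuous_on (X \<times> {0..}) (\<lambda>z. integral {0..snd z} (f (fst z)))"
  using continuous_on_integral_upto[of X f] assms by (simp add: split_beta)

lemma continuous_on_slice: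
  assumes "continuous_on (X \<times> Y) (\<lambda>(x,s). f x s)" "x \<in> X"
  shows "continuous_on Y (f x)"
  by (rule continuous_on_compose2[OF assms(1), of _ "\<lambda>s. (x, s)", simplified])
    (use assms in \<open>auto intro!: continuous_intros\<close>)

lemma continuous_on_slice2:
  assumes "continuous_on (X \<times> Y) (\<lambda>(x,s). f x s)" "s \<in> Y"
  shows "continuous_on X (\<lambda>x. f x s)"
  by (rule continuous_on_compose2[OF assms(1), of _ "\<lambda>x. (x, s)", simplified])
    (use assms in \<open>auto intro!: continuous_intros\<close>)

lemma continuous_on_time_slice:
  assumes "continuous_on ({0..} \<times> {0..}) (\<lambda>z. f (fst z) (snd z))" "x \<ge> 0"
  shows "continuous_on {0..} (f x)"
  using continuous_on_slice[of "{0..}" "{0..}" f x] assms by (simp add: split_beta)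

lemma continuous_on_space_slice:
  assumes "continuous_on ({0..} \<times> {0..}) (\<lambda>z. f (fst z) (snd z))" "t \<ge> 0"
  shows "continuous_on {0..} (\<lambda>x. f x t)"
  using continuous_on_slice2[of "{0..}" "{0..}" f t] assms by (simp add: split_beta)

lemma integral_upto_has_vector_derivative:
  fixes f :: "real \<Rightarrow> complex"
  assumes "continuous_on {0..} f" "t \<ge> 0"
  shows "((\<lambda>s. integral {0..s} f) has_vector_derivative f t) (at t within {0..})"
proof -
  have "((\<lambda>s. integral {0..s} f) has_vector_derivative f t) (at t within {0..t+1})"
    by (rule integral_has_vector_derivative)
      (use assms in \<open>auto intro: continuous_on_subset\<close>)
  moreover have "at t within {0..t+1} = at t within {0..}"
    by (rule at_within_nhd[of _ "{..<t+1}"]) (auto)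
  ultimately show ?thesis by simp
qed

text \<open>A conservation law in integrated form: \<open>\<phi>\<close> is at once the
  \<open>x\<close>-derivative of the flux \<open>f\<close> and the \<open>t\<close>-derivative of
  the density \<open>G\<close>. Differentiation under the compact time integral yields the integral
  of \<open>\<phi>\<close>, which is a total time derivative, and the density starts from zero.
  Every spatial equation for a potential is obtained this way.\<close>

lemma flux_integral_has_vector_derivative:
  fixes f G :: "real \<Rightarrow> real \<Rightarrow> complex"
  assumes f: "\<And>x s. x \<ge> 0 \<Longrightarrow> s \<ge> 0 \<Longrightarrow>
      ((\<lambda>y. f y s) has_vector_derivative \<phi> x s) (at x within {0..})"
    and G: "\<And>x s. x \<ge> 0 \<Longrightarrow> s \<ge> 0 \<Longrightarrow>
      ((\<lambda>r. G x r) has_vector_derivative \<phi> x s) (at s within {0..})"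
    and cf: "continuous_on ({0..} \<times> {0..}) (\<lambda>(x,s). f x s)"
    and c\<phi>: "continuous_on ({0..} \<times> {0..}) (\<lambda>(x,s). \<phi> x s)"
    and G0: "\<And>x. x \<ge> 0 \<Longrightarrow> G x 0 = 0"
    and xt: "x \<ge> 0" "t \<ge> 0"
  shows "((\<lambda>y. integral {0..t} (f y)) has_vector_derivative G x t) (at x within {0..})"
proof -
  have "((\<lambda>y. integral (cbox 0 t) (f y)) has_vector_derivative integral (cbox 0 t) (\<phi> x)) (at x within {0..})"
  proof (rule leibniz_rule_vector_derivative)
    show "continuous_on ({0..} \<times> cbox 0 t) (\<lambda>(x, t). \<phi> x t)"
      by (rule continuous_on_subset[OF c\<phi>]) auto
    show "f x integrable_on cbox 0 t" if "x \<in> {0..}" for x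
      using continuous_on_subset[OF continuous_on_slice[OF cf that], of "cbox 0 t"]
      by (auto intro!: integrable_continuous_real)
  qed (use f xt in auto)
  moreover have "(\<phi> x has_integral G x t - G x 0) {0..t}"
    by (rule fundamental_theorem_of_calculus[OF xt(2)])
      (auto intro!: has_vector_derivative_within_subset[OF G[OF xt(1)]])
  ultimately show ?thesis
    using G0[OF xt(1)] by (simp add: integral_unique)
qed

section \<open>Integrals over a half-line, and Fubini under product bounds\<close>

lemma integrable_inverse_square_tail:
  "integrable lborel (\<lambda>x::real. indicator {0..} x * (1 / (1 + x)^2))"
proof (rule integrableI_nn_integral_finite)
  have "(\<integral>\<^sup>+x. ennreal (1 / (1 + x)^2) * indicator {0..} x \<partial>lborel) = ennreal (0 - (- 1 / (1 + 0)))"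
  proof (rule nn_integral_FTC_atLeast)
    show "((\<lambda>x::real. - 1 / (1 + x)) has_real_derivative 1 / (1 + x)^2) (at x)" if "0 \<le> x" for x :: real
      using that by (auto intro!: derivative_eq_intros simp: power2_eq_square field_simps)
    show "((\<lambda>x::real. - 1 / (1 + x)) \<longlongrightarrow> 0) at_top"
      by real_asymp
  qed auto
  then show "(\<integral>\<^sup>+x. ennreal (indicator {0..} x * (1 / (1 + x)^2)) \<partial>lborel) = ennreal 1"
    by (subst nn_integral_cong[where v="\<lambda>x. ennreal (1 / (1 + x)^2) * indicator {0..} x"])
      (auto simp: indicator_def)
qed auto

lemma at_within_atLeast_interior: "x > a \<Longrightarrow> at x within {a..} = at (x::real)"
  by (rule at_within_interior) (simp add: interior_real_atLeast)

text \<open>The tail beyond \<open>x\<close> is written in the shifted variable \<open>v\<close>, so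
  that tails with different starting points are integrals over one and the same half-line; iterated
  tails can then be exchanged with other integrals.\<close>

lemma integral_halfline_FTC:
  fixes F f :: "real \<Rightarrow> complex"
  assumes F: "\<And>x. x \<ge> 0 \<Longrightarrow> (F has_vector_derivative - f x) (at x within {0..})"
    and f: "continuous_on {0..} f"
    and C: "\<And>x. x \<ge> 0 \<Longrightarrow> norm (f x) \<le> C / (1 + x)^2"
    and lim: "(F \<longlongrightarrow> 0) at_top"
    and x: "x \<ge> 0"
  shows "(LINT v|lborel. indicator {0..} v *\<^sub>R f (x + v)) = F x"
proof -
  have C0: "C \<ge> 0" using norm_ge_zero C[of 0] by (metis order_trans div_by_1 add_0_right one_power2 order_refl)
  have meas: "(\<lambda>v. indicator {0..} v *\<^sub>R f (x + v)) \<in> borel_measurable borel"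
    using x by (intro borel_measurable_continuous_on_indicator continuous_on_compose2[OF f])
      (auto intro!: continuous_intros)
  have int: "integrable lborel (\<lambda>v. indicator {0..} v *\<^sub>R f (x + v))"
  proof (rule Bochner_Integration.integrable_bound)
    show "integrable lborel (\<lambda>v. C * (indicator {0..} v * (1 / (1 + v)^2)))"
      by (intro integrable_mult_right integrable_inverse_square_tail)
    have "C / (1 + (x + v))^2 \<le> C / (1 + v)^2" if "v \<ge> 0" for v
      using that x C0 by (intro divide_left_mono power_mono) auto
    then show "AE v in lborel. norm (indicator {0..} v *\<^sub>R f (x + v))
        \<le> norm (C * (indicator {0..} v * (1 / (1 + v)^2)))"
      using C0 by (auto simp: indicator_def x intro!: AE_I2 order_trans[OF C])
  qed (use meas in simp)
  have f0: "(LBINT v=0..\<infinity>. f (x + v)) = 0 - (- F x)"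
  proof (rule interval_integral_FTC_integrable[where F="\<lambda>v. - F (x + v)"])
    show "((\<lambda>v. - F (x + v)) has_vector_derivative f (x + v)) (at v)" if "0 < ereal v" for v
    proof -
      have "(F has_vector_derivative - f (x + v)) (at (x + v))"
        using F[of "x + v"] x that by (simp add: at_within_atLeast_interior)
      then have "((\<lambda>v. F (x + v)) has_vector_derivative - f (x + v)) (at v)"
        using vector_diff_chain_at[of "\<lambda>v. x + v" 1 v F "- f (x + v)"]
          has_vector_derivative_add[OF has_vector_derivative_const[of x] has_vector_derivative_id[of "at v"]]
        by (simp add: o_def)
      then show ?thesis
        by (auto intro!: derivative_eq_intros)
    qed
    show "isCont (\<lambda>v. f (x + v)) v" if "0 < ereal v" for v
    proof -
      have "isCont f (x + v)"
        using continuous_on_interior[OF f, of "x + v"] x that by (simp add: interior_real_atLeast)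
      then show ?thesis
        by (intro isCont_o2[where f="\<lambda>v. x + v" and g=f] continuous_intros)
    qed
    have "set_integrable lborel {0..} (\<lambda>v. f (x + v))"
      using int by (simp add: set_integrable_def)
    then show "set_integrable lborel (einterval 0 \<infinity>) (\<lambda>v. f (x + v))"
      by (rule set_integrable_subset) (auto simp: einterval_def)
    have "continuous (at x within {0..}) F"
      using F[OF x] by (rule has_vector_derivative_continuous)
    then have "(F \<longlongrightarrow> F x) (at x within {0..})" by (simp add: continuous_within)
    moreover have "filterlim (\<lambda>v. x + v) (at x within {0..}) (at_right 0)"
      unfolding filterlim_at
      using x by (auto intro!: tendsto_eq_intros eventually_at_right_less[of 0, THEN eventually_mono])
    ultimately have "((\<lambda>v. F (x + v)) \<longlongrightarrow> F x) (at_right 0)"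
      by (rule filterlim_compose)
    then show "(((\<lambda>v. - F (x + v)) \<circ> real_of_ereal) \<longlongrightarrow> - F x) (at_right 0)"
      by (auto simp: ereal_tendsto_simps1 zero_ereal_def intro!: tendsto_intros)
    have "((\<lambda>v. F (x + v)) \<longlongrightarrow> 0) at_top"
      by (rule filterlim_compose[OF lim]) real_asymp
    then show "(((\<lambda>v. - F (x + v)) \<circ> real_of_ereal) \<longlongrightarrow> 0) (at_left \<infinity>)"
      by (auto simp: ereal_tendsto_simps1 intro!: tendsto_eq_intros)
  qed auto
  have "(LINT v|lborel. indicator {0..} v *\<^sub>R f (x + v)) = (LINT v|lborel. indicator {0<..} v *\<^sub>R f (x + v))"
  proof (rule integral_cong_AE)
    have "(\<lambda>v. indicator {0<..} v *\<^sub>R f (x + v)) \<in> borel_measurable borel"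
      using x by (intro borel_measurable_continuous_on_indicator continuous_on_compose2[OF f])
        (auto intro!: continuous_intros)
    then show "(\<lambda>v. indicator {0<..} v *\<^sub>R f (x + v)) \<in> borel_measurable lborel"
      by simp
  qed (use meas in \<open>auto intro!: eventually_mono[OF AE_lborel_singleton[of 0]] simp: indicator_def\<close>)
  also have "\<dots> = (LBINT v=0..\<infinity>. f (x + v))"
    by (simp add: interval_integral_to_infinity_eq zero_ereal_def set_lebesgue_integral_def)
  finally show ?thesis using f0 by simp
qed

lemma lborel_swap_dominated:
  fixes f :: "real \<Rightarrow> real \<Rightarrow> complex"
  assumes [measurable]: "(\<lambda>(x,y). f x y) \<in> borel_measurable (borel \<Otimes>\<^sub>M borel)"
    and m: "integrable lborel m" and w: "integrable lborel w"
    and b: "\<And>x y. norm (f x y) \<le> m x * w y"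
  shows "(LINT x|lborel. LINT y|lborel. f x y) = (LINT y|lborel. LINT x|lborel. f x y)"
    and "integrable lborel (\<lambda>x. LINT y|lborel. f x y)"
proof -
  have "integrable (lborel \<Otimes>\<^sub>M lborel) (\<lambda>z. m (fst z) * w (snd z))"
  proof (rule lborel_pair.Fubini_integrable)
    show "(\<lambda>z. m (fst z) * w (snd z)) \<in> borel_measurable (lborel \<Otimes>\<^sub>M lborel)"
      using borel_measurable_integrable[OF m] borel_measurable_integrable[OF w] by measurable
    show "integrable lborel (\<lambda>x. LINT y|lborel. norm (m (fst (x, y)) * w (snd (x, y))))"
      using m w by (simp add: abs_mult)
  qed (use w in auto)
  then have I: "integrable (lborel \<Otimes>\<^sub>M lborel) (\<lambda>(x,y). f x y)"
    by (rule Bochner_Integration.integrable_bound)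
      (auto simp: measurable_split_conv split_beta intro!: AE_I2 order_trans[OF b])
  show "(LINT x|lborel. LINT y|lborel. f x y) = (LINT y|lborel. LINT x|lborel. f x y)"
    using lborel_pair.Fubini_integral[OF I] by simp
  show "integrable lborel (\<lambda>x. LINT y|lborel. f x y)"
    using lborel_pair.integrable_fst'[OF I] by simp
qed

subsection \<open>Gaussian integrals\<close>

text \<open>Fubini between the frequency line and a compact time interval: continuity gives joint
  measurability, and \<open>w k * indicator {0..T} s\<close> is a product majorant. The same
  majorant gives continuity of the inner \<open>k\<close>-integral in time, which links the Lebesgue
  integral to the gauge integral.\<close>

lemma lborel_time_integral_swap:
  fixes f :: "real \<Rightarrow> real \<Rightarrow> complex"
  assumes f: "continuous_on (UNIV \<times> {0..}) (\<lambda>(k,s). f k s)"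
    and w: "integrable lborel w" and T: "T \<ge> 0"
    and b: "\<And>k s. s \<in> {0..T} \<Longrightarrow> norm (f k s) \<le> w k"
  shows "(LINT k|lborel. integral {0..T} (f k)) = integral {0..T} (\<lambda>s. LINT k|lborel. f k s)"
    and "continuous_on {0..T} (\<lambda>s. LINT k|lborel. f k s)"
    and "integrable lborel (\<lambda>k. integral {0..T} (f k))"
proof -
  define h where "h k s = indicator {0..T} s *\<^sub>R f k s" for k s
  have cs: "continuous_on {0..T} (f k)" for k
    by (rule continuous_on_subset[OF continuous_on_slice[OF f]]) auto
  have meas: "(\<lambda>k. f k s) \<in> borel_measurable borel" if "s \<ge> 0" for s
    by (intro borel_measurable_continuous_onI continuous_on_slice2[OF f]) (use that in auto)
  have I: "integral {0..T} (f k) = (LINT s|lborel. h k s)" for k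
    using set_borel_integral_eq_integral(2)[OF borel_integrable_atLeastAtMost'[OF cs[of k]]]
    by (simp add: h_def set_lebesgue_integral_def)
  have hm: "(\<lambda>(k,s). h k s) \<in> borel_measurable (borel \<Otimes>\<^sub>M borel)"
  proof -
    have "(\<lambda>z. indicator (UNIV \<times> {0..T}) z *\<^sub>R (case z of (k,s) \<Rightarrow> f k s)) \<in> borel_measurable borel"
      by (intro borel_measurable_continuous_on_indicator borel_closed closed_Times continuous_on_subset[OF f]) auto
    moreover have "(\<lambda>z. indicator (UNIV \<times> {0..T}) z *\<^sub>R (case z of (k,s) \<Rightarrow> f k s)) = (\<lambda>(k,s). h k s)"
      by (auto simp: fun_eq_iff h_def indicator_def)
    ultimately show ?thesis
      by (simp add: borel_prod)
  qed
  have hb: "norm (h k s) \<le> w k * indicator {0..T} s" for k s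
    using b[of s k] by (auto simp: h_def indicator_def)
  have int1: "integrable lborel (indicator {0..T} :: real \<Rightarrow> real)"
    by (rule integrable_real_indicator) (auto simp: emeasure_lborel_Icc_eq)
  show int: "integrable lborel (\<lambda>k. integral {0..T} (f k))"
    unfolding I by (rule lborel_swap_dominated(2)[OF hm w int1 hb])
  show cont: "continuous_on {0..T} (\<lambda>s. LINT k|lborel. f k s)"
    unfolding continuous_on_sequentially
  proof (safe, unfold o_def)
    fix xs s assume xs: "\<forall>n. xs n \<in> {0..T}" "s \<in> {0..T}" "xs \<longlonglongrightarrow> s"
    show "(\<lambda>n. LINT k|lborel. f k (xs n)) \<longlonglongrightarrow> (LINT k|lborel. f k s)"
    proof (rule integral_dominated_convergence[OF _ _ w])
      show "AE k in lborel. (\<lambda>n. f k (xs n)) \<longlonglongrightarrow> f k s"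
        using xs cs by (auto simp: continuous_on_sequentially o_def)
    qed (use xs b meas in auto)
  qed
  have "(LINT k|lborel. integral {0..T} (f k)) = (LINT s|lborel. LINT k|lborel. h k s)"
    unfolding I by (rule lborel_swap_dominated(1)[OF hm w int1 hb])
  also have "\<dots> = (LINT s:{0..T}|lborel. LINT k|lborel. f k s)"
    by (simp add: h_def set_lebesgue_integral_def)
  also have "\<dots> = integral {0..T} (\<lambda>s. LINT k|lborel. f k s)"
    by (rule set_borel_integral_eq_integral(2)[OF borel_integrable_atLeastAtMost'[OF cont]])
  finally show "(LINT k|lborel. integral {0..T} (f k)) = integral {0..T} (\<lambda>s. LINT k|lborel. f k s)" .
qed

section \<open>Gaussian moments as integrals of total derivatives\<close>

lemma integral_real_line_FTC_zero:
  fixes F f :: "real \<Rightarrow> complex"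
  assumes F: "\<And>x. (F has_vector_derivative f x) (at x)"
    and f: "continuous_on UNIV f" "integrable lborel f"
    and lim: "(F \<longlongrightarrow> 0) at_top" "(F \<longlongrightarrow> 0) at_bot"
  shows "(LINT x|lborel. f x) = 0"
proof -
  have "(LBINT x=-\<infinity>..\<infinity>. f x) = 0 - 0"
  proof (rule interval_integral_FTC_integrable[where F=F])
    show "isCont f x" for x using f(1) by (simp add: continuous_on_eq_continuous_at)
    show "set_integrable lborel (einterval (-\<infinity>) \<infinity>) f"
      using f(2) by (simp add: set_integrable_def)
  qed (use F lim in \<open>auto simp: ereal_tendsto_simps1\<close>)
  then show ?thesis by (simp add: interval_lebesgue_integral_def set_lebesgue_integral_def)
qed

lemma integrable_gauss_moment:
  fixes d :: real
  assumes "d > 0"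
  shows "integrable lborel (\<lambda>k. \<bar>k\<bar>^n * exp (- d * k^2))"
proof -
  \<comment> \<open>Chosen so that \<open>(c * k)^2 / 2 = d * k^2\<close>: the rescaled standard
    normal density is a multiple of the required Gaussian.\<close>
  define c where "c = sqrt (2 * d)"
  have c: "c > 0" "c^2 = 2 * d" using assms by (auto simp: c_def)
  have "integrable lborel (\<lambda>x. std_normal_density x * \<bar>x\<bar>^n)"
    by (rule integrable_std_normal_moment_abs)
  from lborel_integrable_real_affine[OF this, of c 0]
  have "integrable lborel (\<lambda>k. std_normal_density (c * k) * \<bar>c * k\<bar>^n)" using c by simp
  then have "integrable lborel (\<lambda>k. (sqrt (2 * pi) / c^n) * (std_normal_density (c * k) * \<bar>c * k\<bar>^n))"
    by (rule integrable_mult_right)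
  moreover have "(sqrt (2 * pi) / c^n) * (std_normal_density (c * k) * \<bar>c * k\<bar>^n) = \<bar>k\<bar>^n * exp (- d * k^2)" for k
    using c by (simp add: normal_density_def abs_mult power_mult_distrib field_simps)
  ultimately show ?thesis by simp
qed

lemma norm_gauss: "norm (exp (- (z * (of_real k)^2))) = exp (- Re z * k^2)"
  by (simp add: norm_exp_eq_Re flip: of_real_power)

lemma integrable_complex_gauss_moment:
  fixes \<xi> :: real
  assumes "Re z > 0"
  shows "integrable lborel (\<lambda>k. of_real k ^ n * exp (\<i> * of_real (k * \<xi>) - z * (of_real k)^2))"
  by (rule Bochner_Integration.integrable_bound[OF integrable_gauss_moment[OF assms, of n]])
    (auto simp: norm_mult norm_power norm_exp_eq_Re power_abs simp flip: of_real_power)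

text \<open>The substitution \<open>x = c * k\<close> with \<open>c = sqrt 2 * d\<close> turns the
  integral into the characteristic function of the standard normal distribution at
  \<open>\<xi> / c\<close>.\<close>

lemma gauss_fourier:
  fixes d \<xi> :: real
  assumes "d > 0"
  shows "(LINT k|lborel. exp (\<i> * of_real (k * \<xi>) - of_real (d^2) * (of_real k)^2)) =
    of_real (sqrt pi / d * exp (- ((\<xi> / d)^2) / 4))"
proof -
  define c where "c = sqrt 2 * d"
  have c: "c > 0" "c^2 = 2 * d^2" using assms by (auto simp: c_def power_mult_distrib)
  have "complex_of_real (exp (- ((\<xi> / c)^2) / 2)) = char std_normal_distribution (\<xi> / c)"
    by (simp add: char_std_normal_distribution)
  also have "\<dots> = (LINT x|lborel. std_normal_density x *\<^sub>R iexp (\<xi> / c * x))"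
    unfolding char_def by (subst integral_density) auto
  also have "\<dots> = \<bar>c\<bar> *\<^sub>R (LINT k|lborel. std_normal_density (0 + c * k) *\<^sub>R iexp (\<xi> / c * (0 + c * k)))"
    by (rule lborel_integral_real_affine) (use c in auto)
  also have "(\<lambda>k. std_normal_density (0 + c * k) *\<^sub>R iexp (\<xi> / c * (0 + c * k))) =
      (\<lambda>k. of_real (1 / sqrt (2 * pi)) * exp (\<i> * of_real (k * \<xi>) - of_real (d^2) * (of_real k)^2))"
  proof
    fix k
    have "std_normal_density (c * k) = 1 / sqrt (2 * pi) * exp (- (d^2 * k^2))"
      using c by (simp add: normal_density_def power_mult_distrib)
    moreover have "complex_of_real (exp (- (d^2 * k^2))) * exp (\<i> * of_real (k * \<xi>)) =
        exp (\<i> * of_real (k * \<xi>) - of_real (d^2) * (of_real k)^2)"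
      by (simp add: exp_diff exp_minus exp_of_real[symmetric] divide_simps)
    moreover have "\<xi> / c * (c * k) = k * \<xi>" using c by simp
    ultimately show "std_normal_density (0 + c * k) *\<^sub>R iexp (\<xi> / c * (0 + c * k)) =
      of_real (1 / sqrt (2 * pi)) * exp (\<i> * of_real (k * \<xi>) - of_real (d^2) * (of_real k)^2)"
      unfolding add_0 scaleR_conv_of_real by (simp only: of_real_mult mult.assoc)
  qed
  finally have *: "complex_of_real (exp (- ((\<xi> / c)^2) / 2)) = of_real (c / sqrt (2 * pi)) *
      (LINT k|lborel. exp (\<i> * of_real (k * \<xi>) - of_real (d^2) * (of_real k)^2))"
    using c by (simp add: scaleR_conv_of_real)
  have "c / sqrt (2 * pi) = d / sqrt pi" by (simp add: c_def real_sqrt_mult)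
  moreover have "- ((\<xi> / c)^2) / 2 = - ((\<xi> / d)^2) / 4" using c by (simp add: power_divide)
  ultimately have "of_real (exp (- ((\<xi> / d)^2) / 4)) = of_real (d / sqrt pi) *
      (LINT k|lborel. exp (\<i> * of_real (k * \<xi>) - of_real (d^2) * (of_real k)^2))"
    using * by (simp only:)
  then have "of_real (sqrt pi / d) * of_real (exp (- ((\<xi> / d)^2) / 4)) = of_real (sqrt pi / d * (d / sqrt pi)) *
      (LINT k|lborel. exp (\<i> * of_real (k * \<xi>) - of_real (d^2) * (of_real k)^2))"
    by (simp only: of_real_mult mult.assoc)
  moreover have "sqrt pi / d * (d / sqrt pi) = 1" using assms by simp
  ultimately show ?thesis by (simp only: of_real_mult of_real_1 mult_1)
qed

text \<open>The derivative of the integrand \<open>E\<close> without the factor \<open>k\<close> is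
  \<open>\<i> * \<xi> * E - 2 * z * k * E\<close>, and its integral over the line vanishes.\<close>

lemma gauss_first_moment:
  fixes \<xi> :: real
  assumes "Re z > 0"
  shows "(LINT k|lborel. of_real k * exp (\<i> * of_real (k * \<xi>) - z * (of_real k)^2)) =
    \<i> * of_real \<xi> / (2 * z) * (LINT k|lborel. exp (\<i> * of_real (k * \<xi>) - z * (of_real k)^2))"
proof -
  define E where "E k = exp (\<i> * of_real (k * \<xi>) - z * (of_real k)^2)" for k :: real
  have i0: "integrable lborel E" and i1: "integrable lborel (\<lambda>k. of_real k * E k)"
    using integrable_complex_gauss_moment[OF assms, of 0 \<xi>] integrable_complex_gauss_moment[OF assms, of 1 \<xi>]
    by (simp_all add: E_def[abs_def])
  have "(LINT k|lborel. \<i> * of_real \<xi> * E k - 2 * z * (of_real k * E k)) = 0"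
  proof (rule integral_real_line_FTC_zero[where F=E])
    show "(E has_vector_derivative \<i> * of_real \<xi> * E k - 2 * z * (of_real k * E k)) (at k)" for k
      unfolding E_def
      unfolding of_real_mult
      by (rule has_vector_derivative_real_field[of "\<lambda>k. exp (\<i> * (k * of_real \<xi>) - z * k^2)"])
        (auto intro!: derivative_eq_intros simp: algebra_simps)
    show "integrable lborel (\<lambda>k. \<i> * of_real \<xi> * E k - 2 * z * (of_real k * E k))"
      by (intro Bochner_Integration.integrable_diff integrable_mult_right i0 i1)
    show "(E \<longlongrightarrow> 0) at_top"
      by (rule tendsto_norm_zero_cancel)
        (simp add: E_def norm_exp_eq_Re flip: of_real_power, use assms in real_asymp)
    show "(E \<longlongrightarrow> 0) at_bot"
      by (rule tendsto_norm_zero_cancel)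
        (simp add: E_def norm_exp_eq_Re flip: of_real_power, use assms in real_asymp)
  qed (auto simp: E_def intro!: continuous_intros)
  then have "\<i> * of_real \<xi> * (LINT k|lborel. E k) - 2 * z * (LINT k|lborel. of_real k * E k) = 0"
    using i0 i1 by simp
  then show ?thesis using assms by (fold E_def) (auto simp: field_simps)
qed

text \<open>Same argument applied to the derivative of \<open>k * E\<close>.\<close>

lemma gauss_second_moment:
  assumes "Re z > 0"
  shows "(LINT k|lborel. (of_real k)^2 * exp (- (z * (of_real k)^2))) =
    (LINT k|lborel. exp (- (z * (of_real k)^2))) / (2 * z)"
proof -
  define E where "E k = exp (- (z * (of_real k)^2))" for k :: real
  have i0: "integrable lborel E" and i2: "integrable lborel (\<lambda>k. (of_real k)^2 * E k)"
    using integrable_complex_gauss_moment[OF assms, of 0 0] integrable_complex_gauss_moment[OF assms, of 2 0]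
    by (simp_all add: E_def[abs_def])
  have "(LINT k|lborel. E k - 2 * z * ((of_real k)^2 * E k)) = 0"
  proof (rule integral_real_line_FTC_zero[where F="\<lambda>k. of_real k * E k"])
    show "((\<lambda>k. of_real k * E k) has_vector_derivative E k - 2 * z * ((of_real k)^2 * E k)) (at k)" for k
      unfolding E_def
      by (rule has_vector_derivative_real_field[of "\<lambda>k. k * exp (- (z * k^2))"])
        (auto intro!: derivative_eq_intros simp: algebra_simps power2_eq_square)
    show "integrable lborel (\<lambda>k. E k - 2 * z * ((of_real k)^2 * E k))"
      by (intro Bochner_Integration.integrable_diff integrable_mult_right i0 i2)
    show "((\<lambda>k. of_real k * E k) \<longlongrightarrow> 0) at_top"
      by (rule tendsto_norm_zero_cancel)
        (simp add: E_def norm_mult norm_gauss, use assms in real_asymp)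
    show "((\<lambda>k. of_real k * E k) \<longlongrightarrow> 0) at_bot"
      by (rule tendsto_norm_zero_cancel)
        (simp add: E_def norm_mult norm_gauss, use assms in real_asymp)
  qed (auto simp: E_def intro!: continuous_intros)
  then have "(LINT k|lborel. E k) - 2 * z * (LINT k|lborel. (of_real k)^2 * E k) = 0"
    using i0 i2 by simp
  then show ?thesis using assms by (fold E_def) (auto simp: field_simps)
qed

text \<open>As a function \<open>j\<close> of \<open>s\<close> the integral satisfies
  \<open>j' = - \<i> * j / (2 * z)\<close> by the second moment, so \<open>j * csqrt z\<close> is
  constant. The principal root is differentiable along the path because the real part of
  \<open>z\<close> stays equal to \<open>d > 0\<close>, and the constant is read off from the real
  Gaussian at \<open>s = 0\<close>.\<close>

lemma gauss_integral_complex: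
  fixes d s :: real
  assumes d: "d > 0" and s: "s \<ge> 0"
  defines "z \<equiv> (\<lambda>s. of_real d + \<i> * of_real s)"
  shows "(LINT k|lborel. exp (- (z s * (of_real k)^2))) = of_real (sqrt pi) / csqrt (z s)"
proof -
  define j where "j r = (LINT k|lborel. exp (- (z r * (of_real k)^2)))" for r
  have Re: "Re (z r) = d" for r by (simp add: z_def)
  have zn: "z r \<notin> \<real>\<^sub>\<le>\<^sub>0" "z r \<noteq> 0" for r
    using Re[of r] d by (auto simp: complex_nonpos_Reals_iff)
  define f where "f k r = - \<i> * (of_real k)^2 * exp (- (z r * (of_real k)^2))" for k r :: real
  have f: "continuous_on (UNIV \<times> {0..}) (\<lambda>(k,s). f k s)"
    by (auto simp: f_def z_def split_beta intro!: continuous_intros)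
  have w: "integrable lborel (\<lambda>k. \<bar>k\<bar>^2 * exp (- d * k^2))" by (rule integrable_gauss_moment[OF d])
  have b: "norm (f k r) \<le> \<bar>k\<bar>^2 * exp (- d * k^2)" for k r
    by (simp add: f_def norm_mult norm_gauss Re norm_power)
  have fj: "(LINT k|lborel. f k r) = - \<i> * j r / (2 * z r)" for r
    using gauss_second_moment[of "z r"] d by (simp add: f_def j_def Re mult.assoc)
  \<comment> \<open>The differential equation is first obtained in integrated form, by exchanging
    the time integral of the integrand's derivative with the \<open>k\<close>-integral.\<close>
  have jr: "j r - j 0 = integral {0..r} (\<lambda>r. - \<i> * j r / (2 * z r))" if "r \<ge> 0" for r
  proof -
    have "integral {0..r} (f k) = exp (- (z r * (of_real k)^2)) - exp (- (z 0 * (of_real k)^2))" for k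
      by (rule integral_unique, rule fundamental_theorem_of_calculus[OF that])
        (auto simp: f_def z_def intro!: derivative_eq_intros has_vector_derivative_real_field simp: algebra_simps)
    then have "(LINT k|lborel. integral {0..r} (f k)) = j r - j 0"
      using integrable_complex_gauss_moment[of "z r" 0 0] integrable_complex_gauss_moment[of "z 0" 0 0] d
      by (simp add: j_def Re)
    moreover have "(LINT k|lborel. integral {0..r} (f k)) = integral {0..r} (\<lambda>s. LINT k|lborel. f k s)"
      by (rule lborel_time_integral_swap(1)[OF f w that b])
    ultimately show ?thesis by (simp add: fj)
  qed
  have cj: "continuous_on {0..s} (\<lambda>r. - \<i> * j r / (2 * z r))"
    using lborel_time_integral_swap(2)[OF f w s b] by (simp add: fj)
  have dj: "(j has_vector_derivative - \<i> * j r / (2 * z r)) (at r within {0..s})" if "r \<in> {0..s}" for r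
  proof -
    have "((\<lambda>r. j 0 + integral {0..r} (\<lambda>r. - \<i> * j r / (2 * z r))) has_vector_derivative
        - \<i> * j r / (2 * z r)) (at r within {0..s})"
      using has_vector_derivative_add[OF has_vector_derivative_const[of "j 0"] integral_has_vector_derivative[OF cj that]]
      by simp
    then show ?thesis
      by (rule has_vector_derivative_transform[rotated 2]) (use that jr in \<open>auto simp: algebra_simps\<close>)
  qed
  have "((\<lambda>r. j r * csqrt (z r)) has_vector_derivative 0) (at r within {0..s})" if "r \<in> {0..s}" for r
  proof -
    have c: "(csqrt has_field_derivative inverse (2 * csqrt (z r))) (at (z r))"
      by (rule has_field_derivative_csqrt) (use zn in auto)
    have "(z has_vector_derivative \<i>) (at r within {0..s})"
      unfolding z_def by (auto intro!: derivative_eq_intros has_vector_derivative_real_field)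
    from field_vector_diff_chain_within[OF this has_field_derivative_at_within[OF c]]
    have "((\<lambda>r. csqrt (z r)) has_vector_derivative \<i> * inverse (2 * csqrt (z r))) (at r within {0..s})"
      by (simp add: o_def)
    from has_vector_derivative_mult[OF dj[OF that] this]
    have D: "((\<lambda>r. j r * csqrt (z r)) has_vector_derivative
        j r * (\<i> * inverse (2 * csqrt (z r))) + (- \<i> * j r / (2 * z r)) * csqrt (z r)) (at r within {0..s})" .
    have "csqrt (z r) \<noteq> 0" using zn by simp
    moreover have "csqrt (z r) * csqrt (z r) = z r" by (simp flip: power2_eq_square)
    ultimately have "csqrt (z r) / z r = 1 / csqrt (z r)" using zn by (simp add: field_simps)
    moreover have "(- \<i> * j r / (2 * z r)) * csqrt (z r) = - \<i> * j r / 2 * (csqrt (z r) / z r)"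
      by simp
    ultimately have "j r * (\<i> * inverse (2 * csqrt (z r))) + (- \<i> * j r / (2 * z r)) * csqrt (z r) = 0"
      by (simp add: inverse_eq_divide)
    with D show ?thesis by simp
  qed
  then obtain c where c: "\<And>r. r \<in> {0..s} \<Longrightarrow> j r * csqrt (z r) = c"
    using has_vector_derivative_zero_constant[of "{0..s}" "\<lambda>r. j r * csqrt (z r)"] by auto
  have "j s * csqrt (z s) = j 0 * csqrt (z 0)" using c[of s] c[of 0] s by simp
  also have "j 0 = of_real (LINT k|lborel. exp (- d * k^2))"
    by (simp add: j_def z_def exp_of_real flip: of_real_power of_real_mult of_real_minus integral_of_real)
  also have "(LINT k|lborel. exp (- d * k^2)) = sqrt (pi / d)"
  proof -
    have "complex_of_real (LINT k|lborel. exp (- d * k^2)) =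
        (LINT k|lborel. exp (\<i> * of_real (k * 0) - of_real ((sqrt d)^2) * (of_real k)^2))"
      using d by (simp add: exp_of_real flip: of_real_power of_real_mult of_real_minus integral_of_real)
    also have "\<dots> = of_real (sqrt pi / sqrt d * exp (- ((0 / sqrt d)^2) / 4))"
      by (rule gauss_fourier) (use d in auto)
    finally show ?thesis by (simp only: of_real_eq_iff) (simp add: real_sqrt_divide)
  qed
  also have "csqrt (z 0) = of_real (sqrt d)" using d by (simp add: z_def)
  also have "complex_of_real (sqrt (pi / d)) * of_real (sqrt d) = of_real (sqrt (pi / d) * sqrt d)"
    by simp
  also have "sqrt (pi / d) * sqrt d = sqrt pi"
    using d by (simp add: real_sqrt_divide)
  finally show ?thesis using zn[of s] by (fold j_def) (simp add: field_simps)
qed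

subsection \<open>Decaying solutions\<close>

text \<open>The weight is integrable on the half-line, and the bound is uniform in time up to
  \<open>T\<close> so that the property passes to time integrals as well as to sums and products.
  Decay of the potentials then follows from the shape of their definitions.\<close>

definition decaying :: "real \<Rightarrow> (real \<Rightarrow> real \<Rightarrow> complex) \<Rightarrow> bool" where
  "decaying T f \<longleftrightarrow> (\<exists>M. \<forall>x\<ge>0. \<forall>s\<in>{0..T}. norm (f x s) \<le> M / (1 + x)^2)"

lemma decayingE:
  assumes "decaying T f" "T \<ge> 0"
  obtains M where "M \<ge> 0" "\<And>x s. x \<ge> 0 \<Longrightarrow> s \<in> {0..T} \<Longrightarrow> norm (f x s) \<le> M / (1 + x)^2"
proof -
  obtain M where M: "\<forall>x\<ge>0. \<forall>s\<in>{0..T}. norm (f x s) \<le> M / (1 + x)^2"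
    using assms by (auto simp: decaying_def)
  then have "norm (f 0 0) \<le> M" using assms(2) by force
  then have "M \<ge> 0" using norm_ge_zero order_trans by blast
  with M that show ?thesis by blast
qed

lemma decaying_add:
  assumes "decaying T f" "decaying T g" shows "decaying T (\<lambda>x s. f x s + g x s)"
proof -
  obtain M N where "\<forall>x\<ge>0. \<forall>s\<in>{0..T}. norm (f x s) \<le> M / (1 + x)^2"
    "\<forall>x\<ge>0. \<forall>s\<in>{0..T}. norm (g x s) \<le> N / (1 + x)^2"
    using assms by (auto simp: decaying_def)
  then have "\<forall>x\<ge>0. \<forall>s\<in>{0..T}. norm (f x s + g x s) \<le> (M + N) / (1 + x)^2"
    by (auto simp: add_divide_distrib intro!: norm_triangle_le add_mono)
  then show ?thesis unfolding decaying_def by blast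
qed

lemma decaying_mult_bounded:
  assumes "decaying T f" "\<And>x s. x \<ge> 0 \<Longrightarrow> s \<in> {0..T} \<Longrightarrow> norm (g x s) \<le> K"
  shows "decaying T (\<lambda>x s. f x s * g x s)" "decaying T (\<lambda>x s. g x s * f x s)"
proof -
  obtain M where M: "\<forall>x\<ge>0. \<forall>s\<in>{0..T}. norm (f x s) \<le> M / (1 + x)^2"
    using assms by (auto simp: decaying_def)
  have "norm (f x s) * norm (g x s) \<le> M * K / (1 + x)^2" if "x \<ge> 0" "s \<in> {0..T}" for x s
  proof -
    have "norm (f x s) \<le> M / (1 + x)^2" using M that by auto
    with norm_ge_zero have "0 \<le> M / (1 + x)^2" by (rule order_trans)
    then have "norm (f x s) * norm (g x s) \<le> M / (1 + x)^2 * K"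
      using M that by (intro mult_mono assms) auto
    then show ?thesis by simp
  qed
  then show "decaying T (\<lambda>x s. f x s * g x s)" "decaying T (\<lambda>x s. g x s * f x s)"
    unfolding decaying_def by (auto simp: norm_mult mult.commute intro!: exI[of _ "M * K"])
qed

lemma decaying_cmult: "decaying T f \<Longrightarrow> decaying T (\<lambda>x s. c * f x s)"
  by (rule decaying_mult_bounded(2)[where K="norm c"]) auto

lemma decaying_minus: "decaying T f \<Longrightarrow> decaying T (\<lambda>x s. - f x s)"
  using decaying_cmult[of T f "-1"] by simp

lemma decaying_diff: "decaying T f \<Longrightarrow> decaying T g \<Longrightarrow> decaying T (\<lambda>x s. f x s - g x s)"
  using decaying_add[of T f "\<lambda>x s. - g x s"] decaying_minus[of T g] by simp

lemma decaying_cnj: "decaying T f \<Longrightarrow> decaying T (\<lambda>x s. cnj (f x s))"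
  by (simp add: decaying_def)

lemma decaying_bounded:
  assumes "decaying T f" "T \<ge> 0"
  obtains K where "\<And>x s. x \<ge> 0 \<Longrightarrow> s \<in> {0..T} \<Longrightarrow> norm (f x s) \<le> K"
proof -
  from assms obtain M where M: "M \<ge> 0" "\<And>x s. x \<ge> 0 \<Longrightarrow> s \<in> {0..T} \<Longrightarrow> norm (f x s) \<le> M / (1 + x)^2"
    by (rule decayingE) blast
  have "M / (1 + x)^2 \<le> M" if "x \<ge> 0" for x
    using that M(1) by (simp add: divide_le_eq mult_le_cancel_left1)
  then show ?thesis using M that[of M] order_trans by blast
qed

lemma decaying_mult:
  assumes "decaying T f" "decaying T g" "T \<ge> 0" shows "decaying T (\<lambda>x s. f x s * g x s)"
  using decaying_bounded[OF assms(2,3)] decaying_mult_bounded(1)[OF assms(1)] by metis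

lemma decaying_integral:
  assumes f: "decaying T f" and c: "continuous_on ({0..} \<times> {0..}) (\<lambda>(x,s). f x s)" and T: "T \<ge> 0"
  shows "decaying T (\<lambda>x s. integral {0..s} (f x))"
proof -
  from f T obtain M where M: "M \<ge> 0" "\<And>x s. x \<ge> 0 \<Longrightarrow> s \<in> {0..T} \<Longrightarrow> norm (f x s) \<le> M / (1 + x)^2"
    by (rule decayingE) blast
  have "norm (integral {0..s} (f x)) \<le> (M * T) / (1 + x)^2" if "x \<ge> 0" "s \<in> {0..T}" for x s
  proof -
    have "norm (integral {0..s} (f x)) \<le> (M / (1 + x)^2) * (s - 0)"
      using that by (intro integral_bound continuous_on_subset[OF continuous_on_slice[OF c]]) (auto intro!: M)
    also have "\<dots> \<le> (M / (1 + x)^2) * T"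
      using that M(1) by (intro mult_left_mono) auto
    finally show ?thesis by simp
  qed
  then show ?thesis unfolding decaying_def by blast
qed

lemma decaying_tendsto:
  assumes "decaying T f" "s \<in> {0..T}" shows "((\<lambda>x. f x s) \<longlongrightarrow> 0) at_top"
proof -
  obtain M where M: "\<forall>x\<ge>0. \<forall>s\<in>{0..T}. norm (f x s) \<le> M / (1 + x)^2"
    using assms by (auto simp: decaying_def)
  show ?thesis
  proof (rule Lim_null_comparison)
    show "\<forall>\<^sub>F x in at_top. norm (f x s) \<le> M / (1 + x)^2"
      using eventually_ge_at_top[of 0] by eventually_elim (use M assms in auto)
    show "((\<lambda>x. M / (1 + x)^2) \<longlongrightarrow> 0) at_top" by real_asymp
  qed
qed

section \<open>Extension of the equations and data to the closed quadrant\<close>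

lemma continuous_agree_quadrant:
  fixes f h :: "real \<times> real \<Rightarrow> complex"
  assumes "continuous_on ({0..} \<times> {0..}) f" "continuous_on ({0..} \<times> {0..}) h"
    and eq: "\<And>x s. x > 0 \<Longrightarrow> s > 0 \<Longrightarrow> f (x,s) = h (x,s)"
    and xs: "x \<ge> 0" "s \<ge> 0"
  shows "f (x,s) = h (x,s)"
proof -
  have cl: "closure ({0<..} \<times> {0<..}) = {0::real..} \<times> {0::real..}"
    by (simp add: closure_Times)
  have "f (x,s) - h (x,s) = 0"
    by (rule continuous_constant_on_closure[of "{0<..} \<times> {0<..}" "\<lambda>z. f z - h z"])
      (use assms in \<open>auto simp: cl intro!: continuous_intros\<close>)
  then show ?thesis by simp
qed

lemma halfline_classD:
  assumes "halfline_class q"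
  shows "x \<ge> 0 \<Longrightarrow> s \<ge> 0 \<Longrightarrow> ((\<lambda>y. q y s) has_vector_derivative px q x s) (at x within {0..})"
    and "x \<ge> 0 \<Longrightarrow> s \<ge> 0 \<Longrightarrow> ((\<lambda>y. px q y s) has_vector_derivative px (px q) x s) (at x within {0..})"
    and "x \<ge> 0 \<Longrightarrow> s \<ge> 0 \<Longrightarrow> ((\<lambda>r. q x r) has_vector_derivative pt q x s) (at s within {0..})"
    and "continuous_on ({0..} \<times> {0..}) (\<lambda>(x,t). q x t)"
    and "continuous_on ({0..} \<times> {0..}) (\<lambda>(x,t). px q x t)"
    and "continuous_on ({0..} \<times> {0..}) (\<lambda>(x,t). px (px q) x t)"
    and "continuous_on ({0..} \<times> {0..}) (\<lambda>(x,t). pt q x t)"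
    and "decaying T q" "decaying T (px q)"
proof -
  from assms obtain C where C: "\<And>x t. x \<ge> 0 \<Longrightarrow> t \<in> {0..T} \<Longrightarrow>
        (1 + x)^2 * (norm (q x t) + norm (px q x t) + norm (px (px q) x t) + norm (pt q x t)) \<le> C"
    unfolding halfline_class_def by meson
  have "norm (q x s) \<le> C / (1 + x)^2" "norm (px q x s) \<le> C / (1 + x)^2" if "x \<ge> 0" "s \<in> {0..T}" for x s
  proof -
    have *: "norm (q x s) + norm (px q x s) + norm (px (px q) x s) + norm (pt q x s) \<le> C / (1 + x)^2"
      using C[OF that] that by (subst le_divide_eq) (auto simp: mult.commute)
    show "norm (q x s) \<le> C / (1 + x)^2"
      by (rule order_trans[OF _ *]) simp
    show "norm (px q x s) \<le> C / (1 + x)^2"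
      by (rule order_trans[OF _ *]) simp
  qed
  then show "decaying T q" "decaying T (px q)" unfolding decaying_def by blast+
qed (use assms in \<open>auto simp: halfline_class_def\<close>)

lemma flat_smoothD:
  assumes "flat_smooth g"
  shows "t \<ge> 0 \<Longrightarrow> (g has_vector_derivative vd 1 g t) (at t within {0..})"
    and "continuous_on {0..} g" "continuous_on {0..} (vd 1 g)" "g 0 = 0"
proof -
  have d: "(vd k g has_vector_derivative vd (Suc k) g t) (at t within {0..})" if "t \<ge> 0" for k t
    using assms that by (auto simp: flat_smooth_def)
  have v0: "vd 0 g = g" by (simp add: vd_def)
  have c: "continuous_on {0..} (vd k g)" for k
    by (rule continuous_on_vector_derivative) (use d in auto)
  show "t \<ge> 0 \<Longrightarrow> (g has_vector_derivative vd 1 g t) (at t within {0..})"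
    using d[of t 0] by (simp add: v0)
  show "continuous_on {0..} g" "continuous_on {0..} (vd 1 g)"
    using c[of 0] c[of 1] by (simp_all add: v0)
  show "g 0 = 0" using assms v0 unfolding flat_smooth_def by metis
qed

text \<open>The problem prescribes its equation and data only for positive \<open>x\<close> and
  \<open>t\<close>. Continuity up to the boundary carries them to the axes and the corner, where the
  fluxes are evaluated and the densities have to start from zero.\<close>

lemma lin_schr_bvpD:
  assumes "lin_schr_bvp q F h" and h: "flat_smooth h"
    and F: "continuous_on ({0..} \<times> {0..}) (\<lambda>(x,s). F x s)"
  shows "x \<ge> 0 \<Longrightarrow> s \<ge> 0 \<Longrightarrow> pt q x s = \<i> * px (px q) x s - \<i> * F x s"
    and "x \<ge> 0 \<Longrightarrow> q x 0 = 0"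
    and "s \<ge> 0 \<Longrightarrow> q 0 s = h s"
proof -
  have q: "halfline_class q" and pde: "\<And>x t. x > 0 \<Longrightarrow> t > 0 \<Longrightarrow> \<i> * pt q x t + px (px q) x t = F x t"
    and i: "\<And>x. x > 0 \<Longrightarrow> q x 0 = 0" and b: "\<And>t. t > 0 \<Longrightarrow> q 0 t = h t"
    using assms(1) by (auto simp: lin_schr_bvp_def)
  note c = halfline_classD(4-7)[OF q]
  show "pt q x s = \<i> * px (px q) x s - \<i> * F x s" if "x \<ge> 0" "s \<ge> 0"
  proof -
    have "(\<lambda>z. \<i> * pt q (fst z) (snd z) + px (px q) (fst z) (snd z)) (x,s) = (\<lambda>z. F (fst z) (snd z)) (x,s)"
      by (rule continuous_agree_quadrant)
        (use c F pde that in \<open>auto simp: split_beta intro!: continuous_intros\<close>)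
    then have "\<i> * (\<i> * pt q x s + px (px q) x s) = \<i> * F x s" by simp
    then show ?thesis by (simp add: algebra_simps)
  qed
  have e: "f x = h' x" if "continuous_on {0..} f" "continuous_on {0..} h'" "\<And>x. x > 0 \<Longrightarrow> f x = h' x" "x \<ge> 0"
    for f h' :: "real \<Rightarrow> complex" and x
  proof -
    have "f x - h' x = 0"
      by (rule continuous_constant_on_closure[of "{0<..}" "\<lambda>z. f z - h' z"])
        (use that in \<open>auto intro!: continuous_intros\<close>)
    then show ?thesis by simp
  qed
  show "q x 0 = 0" if "x \<ge> 0"
    by (rule e[of "\<lambda>x. q x 0" "\<lambda>_. 0"]) (use that i continuous_on_slice2[OF c(1)] in auto)
  show "q 0 s = h s" if "s \<ge> 0"
    by (rule e[of "q 0" h]) (use that b continuous_on_slice[OF c(1)] flat_smoothD[OF h] in auto)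
qed

text \<open>Here \<open>lam\<close> is any real number and \<open>p\<close> has its own datum
  \<open>g3\<close>, so that a free problem with arbitrary datum fits in as
  \<open>lam = 0\<close>.\<close>

locale schroedinger_pair =
  fixes lam :: real and q p :: "real \<Rightarrow> real \<Rightarrow> complex" and g g3 :: "real \<Rightarrow> complex"
  assumes g: "flat_smooth g" and g3: "flat_smooth g3"
    and bvp_q: "lin_schr_bvp q (\<lambda>x s. 0) g"
    and bvp_p: "lin_schr_bvp p (\<lambda>x s. 2 * of_real lam * (of_real ((cmod (q x s))^2) * q x s)) g3"
begin

lemma class_q: "halfline_class q" and class_p: "halfline_class p"
  using bvp_q bvp_p by (auto simp: lin_schr_bvp_def)

lemmas q_cont = halfline_classD(4-5)[OF class_q, unfolded split_beta]
lemmas p_cont = halfline_classD(4-5)[OF class_p, unfolded split_beta]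

lemma pde_q: "x \<ge> 0 \<Longrightarrow> s \<ge> 0 \<Longrightarrow> pt q x s = \<i> * px (px q) x s"
  and q_initial: "x \<ge> 0 \<Longrightarrow> q x 0 = 0"
  and q_boundary: "s \<ge> 0 \<Longrightarrow> q 0 s = g s"
  using lin_schr_bvpD[OF bvp_q g] by auto

lemma pde_p: "x \<ge> 0 \<Longrightarrow> s \<ge> 0 \<Longrightarrow>
    pt p x s = \<i> * px (px p) x s - 2 * \<i> * of_real lam * (q x s * cnj (q x s) * q x s)"
  and p_initial: "x \<ge> 0 \<Longrightarrow> p x 0 = 0"
  and p_boundary: "s \<ge> 0 \<Longrightarrow> p 0 s = g3 s"
proof -
  have F: "continuous_on ({0..} \<times> {0..}) (\<lambda>(x,s). 2 * of_real lam * (of_real ((cmod (q x s))^2) * q x s))"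
    unfolding split_beta by (intro continuous_intros q_cont)
  show "x \<ge> 0 \<Longrightarrow> s \<ge> 0 \<Longrightarrow>
    pt p x s = \<i> * px (px p) x s - 2 * \<i> * of_real lam * (q x s * cnj (q x s) * q x s)"
    using lin_schr_bvpD(1)[OF bvp_p g3 F] by (simp add: complex_norm_square[symmetric])
  show "x \<ge> 0 \<Longrightarrow> p x 0 = 0" "s \<ge> 0 \<Longrightarrow> p 0 s = g3 s"
    using lin_schr_bvpD(2,3)[OF bvp_p g3 F] by auto
qed

end

subsection \<open>Lax pair potentials\<close>

text \<open>A plane wave of the transposed free equation \<open>w_t = - \<i> * w_xx\<close>.
  Multiplying a free solution by it gives, for every real \<open>k\<close>, the density of a
  conservation law.\<close>

definition phase :: "real \<Rightarrow> real \<Rightarrow> real \<Rightarrow> complex" where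
  "phase k x s = exp (\<i> * of_real (k * x + k^2 * s))"

lemma phase_cnj: "phase k x s * cnj (phase k x s) = 1" "cnj (phase k x s) * phase k x s = 1"
  by (simp_all add: phase_def exp_cnj flip: exp_add)

lemma norm_phase [simp]: "norm (phase k x s) = 1"
  by (simp add: phase_def)

lemma continuous_on_phase [continuous_intros]:
  "continuous_on X f \<Longrightarrow> continuous_on X h \<Longrightarrow> continuous_on X r \<Longrightarrow>
    continuous_on X (\<lambda>z. phase (f z) (h z) (r z))"
  by (auto simp: phase_def intro!: continuous_intros)

lemma phase_deriv_x: "((\<lambda>x. phase k x s) has_vector_derivative \<i> * of_real k * phase k x s) (at x within S)"
proof -
  have "((\<lambda>x. exp (\<i> * (of_real k * x + of_real (k^2 * s)))) has_field_derivative
      \<i> * of_real k * phase k x s) (at (of_real x))"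
    by (auto intro!: derivative_eq_intros simp: phase_def)
  from has_vector_derivative_real_field[OF this] show ?thesis
    by (simp add: phase_def)
qed

lemma phase_deriv_t: "((\<lambda>s. phase k x s) has_vector_derivative \<i> * (of_real k)^2 * phase k x s) (at s within S)"
proof -
  have "((\<lambda>s. exp (\<i> * (of_real (k * x) + (of_real k)^2 * s))) has_field_derivative
      \<i> * (of_real k)^2 * phase k x s) (at (of_real s))"
    by (auto intro!: derivative_eq_intros simp: phase_def)
  from has_vector_derivative_real_field[OF this] show ?thesis
    by (simp add: phase_def)
qed

context schroedinger_pair
begin

text \<open>
  \<open>dn\<close>, \<open>fl\<close> are density and flux of the linear conservation law of \<open>q\<close> tested against \<open>phase k\<close>,
  and \<open>dn3\<close>, \<open>fl3\<close> those of \<open>p\<close>. The potentials \<open>A1\<close>, \<open>B1\<close>, \<open>Z1\<close> are the first three orders of the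
  Lax pair solution, defined by time integration; the lemmas \<open>A1_x\<close>, \<open>B1_x\<close>, \<open>Z1_x\<close> recover its spatial part,
  and in \<open>Z1_x\<close> the cubic forcing has dropped out.
\<close>

definition "dn k x s = q x s * phase k x s"
definition "fl k x s = (of_real k * q x s + \<i> * px q x s) * phase k x s"
definition "dn3 k x s = p x s * phase k x s"
definition "fl3 k x s = (of_real k * p x s + \<i> * px p x s) * phase k x s"
definition "md x s = q x s * cnj (q x s)"
definition "md_x x s = px q x s * cnj (q x s) + q x s * cnj (px q x s)"
definition "rate k x s = (\<i> * px (px q) x s + \<i> * (of_real k)^2 * q x s) * phase k x s"
definition "A1 k x s = - integral {0..s} (fl k x)"
definition "flB k x s = \<i> * md x s - cnj (fl k x s) * A1 k x s"
definition "B1 k x s = integral {0..s} (flB k x)"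
definition "flZ k x s = fl3 k x s + of_real lam * (fl k x s * B1 k x s + \<i> * md x s * A1 k x s)"
definition "Z1 k x s = - integral {0..s} (flZ k x)"

text \<open>Compatibility of the two Lax equations at second order. Since the phase has modulus one
  it cancels in both products, and the terms in \<open>k\<close> agree; what differs is
  \<open>\<i>\<close> times the \<open>x\<close>-derivative of \<open>md\<close>. This is why
  \<open>flB\<close> contains \<open>\<i> * md\<close>.\<close>

lemma flux_identity: "cnj (fl k x s) * dn k x s + \<i> * md_x x s = cnj (dn k x s) * fl k x s"
proof -
  have "cnj (fl k x s) * dn k x s =
      (of_real k * cnj (q x s) - \<i> * cnj (px q x s)) * q x s * (phase k x s * cnj (phase k x s))"
    by (simp add: fl_def dn_def algebra_simps)
  moreover have "cnj (dn k x s) * fl k x s =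
      (of_real k * q x s + \<i> * px q x s) * cnj (q x s) * (phase k x s * cnj (phase k x s))"
    by (simp add: fl_def dn_def algebra_simps)
  ultimately show ?thesis by (simp add: phase_cnj md_x_def algebra_simps)
qed

lemmas pq_cont = q_cont p_cont halfline_classD(6)[OF class_q, unfolded split_beta]
  halfline_classD(6)[OF class_p, unfolded split_beta]

lemma densities_cont: "continuous_on ({0..} \<times> {0..}) (\<lambda>z. dn k (fst z) (snd z))"
  "continuous_on ({0..} \<times> {0..}) (\<lambda>z. fl k (fst z) (snd z))"
  "continuous_on ({0..} \<times> {0..}) (\<lambda>z. dn3 k (fst z) (snd z))"
  "continuous_on ({0..} \<times> {0..}) (\<lambda>z. fl3 k (fst z) (snd z))"
  "continuous_on ({0..} \<times> {0..}) (\<lambda>z. md (fst z) (snd z))"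
  "continuous_on ({0..} \<times> {0..}) (\<lambda>z. md_x (fst z) (snd z))"
  "continuous_on ({0..} \<times> {0..}) (\<lambda>z. rate k (fst z) (snd z))"
  unfolding dn_def fl_def dn3_def fl3_def md_def md_x_def rate_def
  by (intro continuous_intros pq_cont)+

lemma A1_cont: "continuous_on ({0..} \<times> {0..}) (\<lambda>z. A1 k (fst z) (snd z))"
  unfolding A1_def by (intro continuous_intros continuous_on_integral_upto' densities_cont)

lemma flB_cont: "continuous_on ({0..} \<times> {0..}) (\<lambda>z. flB k (fst z) (snd z))"
  unfolding flB_def by (intro continuous_intros densities_cont A1_cont)

lemma B1_cont: "continuous_on ({0..} \<times> {0..}) (\<lambda>z. B1 k (fst z) (snd z))"
  unfolding B1_def by (intro continuous_on_integral_upto' flB_cont)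

lemma flZ_cont: "continuous_on ({0..} \<times> {0..}) (\<lambda>z. flZ k (fst z) (snd z))"
  unfolding flZ_def by (intro continuous_intros densities_cont A1_cont B1_cont)

lemma A1_t: "x \<ge> 0 \<Longrightarrow> s \<ge> 0 \<Longrightarrow> ((\<lambda>r. A1 k x r) has_vector_derivative - fl k x s) (at s within {0..})"
  unfolding A1_def
  by (intro has_vector_derivative_minus integral_upto_has_vector_derivative continuous_on_time_slice densities_cont)

lemma B1_t: "x \<ge> 0 \<Longrightarrow> s \<ge> 0 \<Longrightarrow> ((\<lambda>r. B1 k x r) has_vector_derivative flB k x s) (at s within {0..})"
  unfolding B1_def
  by (intro integral_upto_has_vector_derivative continuous_on_time_slice flB_cont)

lemma dn_t: "x \<ge> 0 \<Longrightarrow> s \<ge> 0 \<Longrightarrow> ((\<lambda>r. dn k x r) has_vector_derivative rate k x s) (at s within {0..})"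
  unfolding dn_def
  by (rule has_vector_derivative_eq_rhs[OF has_vector_derivative_mult[OF halfline_classD(3)[OF class_q] phase_deriv_t]])
    (auto simp: rate_def pde_q algebra_simps)

lemma fl_x: "x \<ge> 0 \<Longrightarrow> s \<ge> 0 \<Longrightarrow> ((\<lambda>y. fl k y s) has_vector_derivative rate k x s) (at x within {0..})"
  unfolding fl_def
  by (rule has_vector_derivative_eq_rhs[OF has_vector_derivative_mult[OF has_vector_derivative_add[OF
          has_vector_derivative_mult[OF has_vector_derivative_const halfline_classD(1)[OF class_q]]
          has_vector_derivative_mult[OF has_vector_derivative_const halfline_classD(2)[OF class_q]]] phase_deriv_x]])
    (auto simp: rate_def algebra_simps power2_eq_square)

lemma dn3_t: "x \<ge> 0 \<Longrightarrow> s \<ge> 0 \<Longrightarrow> ((\<lambda>r. dn3 k x r) has_vector_derivative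
    (\<i> * px (px p) x s + \<i> * (of_real k)^2 * p x s) * phase k x s
      - 2 * \<i> * of_real lam * (md x s * dn k x s)) (at s within {0..})"
  unfolding dn3_def
  by (rule has_vector_derivative_eq_rhs[OF has_vector_derivative_mult[OF halfline_classD(3)[OF class_p] phase_deriv_t]])
    (auto simp: md_def dn_def pde_p algebra_simps)

lemma dn3_x: "x \<ge> 0 \<Longrightarrow> s \<ge> 0 \<Longrightarrow>
    ((\<lambda>y. dn3 k y s) has_vector_derivative (px p x s + \<i> * of_real k * p x s) * phase k x s) (at x within {0..})"
  unfolding dn3_def
  by (rule has_vector_derivative_eq_rhs[OF has_vector_derivative_mult[OF halfline_classD(1)[OF class_p] phase_deriv_x]])
    (auto simp: algebra_simps)

lemma fl3_x: "x \<ge> 0 \<Longrightarrow> s \<ge> 0 \<Longrightarrow> ((\<lambda>y. fl3 k y s) has_vector_derivative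
    (\<i> * px (px p) x s + \<i> * (of_real k)^2 * p x s) * phase k x s) (at x within {0..})"
  unfolding fl3_def
  by (rule has_vector_derivative_eq_rhs[OF has_vector_derivative_mult[OF has_vector_derivative_add[OF
          has_vector_derivative_mult[OF has_vector_derivative_const halfline_classD(1)[OF class_p]]
          has_vector_derivative_mult[OF has_vector_derivative_const halfline_classD(2)[OF class_p]]] phase_deriv_x]])
    (auto simp: algebra_simps power2_eq_square)

lemma md_x: "x \<ge> 0 \<Longrightarrow> s \<ge> 0 \<Longrightarrow> ((\<lambda>y. md y s) has_vector_derivative md_x x s) (at x within {0..})"
  unfolding md_def
  by (rule has_vector_derivative_eq_rhs[OF has_vector_derivative_mult[OF halfline_classD(1)[OF class_q]
        has_vector_derivative_cnj[OF halfline_classD(1)[OF class_q]]]])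
    (auto simp: md_x_def)

lemma A1_x: "x \<ge> 0 \<Longrightarrow> s \<ge> 0 \<Longrightarrow> ((\<lambda>y. A1 k y s) has_vector_derivative - dn k x s) (at x within {0..})"
  unfolding A1_def
  by (intro has_vector_derivative_minus flux_integral_has_vector_derivative[where \<phi>="rate k"] fl_x dn_t)
    (auto simp: split_beta dn_def q_initial intro: densities_cont)

lemma B1_x: 
  assumes "x \<ge> 0" "s \<ge> 0"
  shows "((\<lambda>y. B1 k y s) has_vector_derivative - (cnj (dn k x s) * A1 k x s)) (at x within {0..})"
  unfolding B1_def
\<comment> \<open>The chosen \<open>\<phi>\<close> is the common value of the
  \<open>x\<close>-derivative of \<open>flB\<close> and the time derivative of the density; the two
  agree by \<open>flux_identity\<close>.\<close>
proof (rule flux_integral_has_vector_derivative[where G="\<lambda>x s. - (cnj (dn k x s) * A1 k x s)"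
      and \<phi>="\<lambda>x s. cnj (dn k x s) * fl k x s - cnj (rate k x s) * A1 k x s"])
  fix x s :: real assume xs: "x \<ge> 0" "s \<ge> 0"
  show "((\<lambda>y. flB k y s) has_vector_derivative cnj (dn k x s) * fl k x s - cnj (rate k x s) * A1 k x s) (at x within {0..})"
    unfolding flB_def flux_identity[symmetric]
    by (rule has_vector_derivative_eq_rhs[OF has_vector_derivative_diff[OF
          has_vector_derivative_mult[OF has_vector_derivative_const md_x[OF xs]]
          has_vector_derivative_mult[OF has_vector_derivative_cnj[OF fl_x[OF xs]] A1_x[OF xs]]]])
      (simp add: algebra_simps)
  show "((\<lambda>s. - (cnj (dn k x s) * A1 k x s)) has_vector_derivative
      cnj (dn k x s) * fl k x s - cnj (rate k x s) * A1 k x s) (at s within {0..})"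
    by (rule has_vector_derivative_eq_rhs[OF has_vector_derivative_minus[OF
          has_vector_derivative_mult[OF has_vector_derivative_cnj[OF dn_t[OF xs]] A1_t[OF xs]]]])
      (simp add: algebra_simps)
qed (use assms in \<open>auto simp: split_beta dn_def q_initial
    intro!: continuous_intros densities_cont A1_cont flB_cont pq_cont\<close>)

text \<open>The forcing contributes \<open>- 2 * \<i> * lam * md * dn\<close> to the time derivative
  of \<open>dn3\<close>. The summand \<open>\<i> * md\<close> of \<open>flB\<close> cancels half of
  it when \<open>dn * B1\<close> is differentiated in time; the other half equals the term produced
  by \<open>A1_x\<close> in the \<open>x\<close>-derivative of \<open>\<i> * md * A1\<close>.
  Density and flux thus balance with no cubic source left.\<close>

lemma Z1_x:
  assumes "x \<ge> 0" "s \<ge> 0"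
  shows "((\<lambda>y. Z1 k y s) has_vector_derivative - (dn3 k x s + of_real lam * (dn k x s * B1 k x s))) (at x within {0..})"
  unfolding Z1_def
proof (rule has_vector_derivative_minus, rule flux_integral_has_vector_derivative[where
      \<phi>="\<lambda>x s. (\<i> * px (px p) x s + \<i> * (of_real k)^2 * p x s) * phase k x s
        + of_real lam * (rate k x s * B1 k x s - fl k x s * (cnj (dn k x s) * A1 k x s)
           + \<i> * md_x x s * A1 k x s - \<i> * md x s * dn k x s)"])
  fix x s :: real assume xs: "x \<ge> 0" "s \<ge> 0"
  show "((\<lambda>y. flZ k y s) has_vector_derivative
      (\<i> * px (px p) x s + \<i> * (of_real k)^2 * p x s) * phase k x s
        + of_real lam * (rate k x s * B1 k x s - fl k x s * (cnj (dn k x s) * A1 k x s)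
           + \<i> * md_x x s * A1 k x s - \<i> * md x s * dn k x s)) (at x within {0..})"
    unfolding flZ_def
    by (rule has_vector_derivative_eq_rhs[OF has_vector_derivative_add[OF fl3_x[OF xs]
          has_vector_derivative_mult[OF has_vector_derivative_const has_vector_derivative_add[OF
            has_vector_derivative_mult[OF fl_x[OF xs] B1_x[OF xs]]
            has_vector_derivative_mult[OF has_vector_derivative_mult[OF has_vector_derivative_const md_x[OF xs]] A1_x[OF xs]]]]]])
      (simp add: algebra_simps)
  have i: "\<i> * md_x x s * A1 k x s = cnj (dn k x s) * fl k x s * A1 k x s - cnj (fl k x s) * dn k x s * A1 k x s"
  proof -
    have "\<i> * md_x x s = cnj (dn k x s) * fl k x s - cnj (fl k x s) * dn k x s"
      using flux_identity[of k x s] by (simp add: algebra_simps)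
    then show ?thesis by (simp only: left_diff_distrib)
  qed
  show "((\<lambda>s. dn3 k x s + of_real lam * (dn k x s * B1 k x s)) has_vector_derivative
      (\<i> * px (px p) x s + \<i> * (of_real k)^2 * p x s) * phase k x s
        + of_real lam * (rate k x s * B1 k x s - fl k x s * (cnj (dn k x s) * A1 k x s)
           + \<i> * md_x x s * A1 k x s - \<i> * md x s * dn k x s)) (at s within {0..})"
    unfolding i
    by (rule has_vector_derivative_eq_rhs[OF has_vector_derivative_add[OF dn3_t[OF xs]
          has_vector_derivative_mult[OF has_vector_derivative_const
            has_vector_derivative_mult[OF dn_t[OF xs] B1_t[OF xs]]]]])
      (simp add: flB_def algebra_simps)
qed (use assms in \<open>auto simp: split_beta dn_def dn3_def q_initial p_initial
    intro!: continuous_intros densities_cont A1_cont B1_cont flZ_cont pq_cont\<close>)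

end

subsection \<open>The global relation and its even part\<close>

declare One_nat_def [simp del]

abbreviation halfline_integral :: "(real \<Rightarrow> complex) \<Rightarrow> complex" where
  "halfline_integral f \<equiv> LINT v|lborel. indicator {0..} v *\<^sub>R f v"

definition osc_int :: "(real \<Rightarrow> complex) \<Rightarrow> real \<Rightarrow> real \<Rightarrow> complex" where
  "osc_int f k s = integral {0..s} (\<lambda>r. f r * phase k 0 r)"

definition osc_int2 :: "(real \<Rightarrow> complex) \<Rightarrow> (real \<Rightarrow> complex) \<Rightarrow> real \<Rightarrow> real \<Rightarrow> complex" where
  "osc_int2 b c k s = integral {0..s} (\<lambda>r. b r * (cnj (phase k 0 r) * osc_int c k r))"

text \<open>The phases alternate in sign as in \<open>q\<close>, \<open>cnj q\<close>,
  \<open>q\<close>: at times \<open>s\<close>, \<open>r\<close>, \<open>v\<close> the exponent is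
  \<open>k^2 * (s - r + v)\<close>. Multiplication by the conjugate phase at time \<open>t\<close>
  produces the lag \<open>t - s + r - v\<close>.\<close>

definition osc_int3 :: "(real \<Rightarrow> complex) \<Rightarrow> (real \<Rightarrow> complex) \<Rightarrow> (real \<Rightarrow> complex) \<Rightarrow> real \<Rightarrow> real \<Rightarrow> complex" where
  "osc_int3 a b c k s = integral {0..s} (\<lambda>r. a r * (phase k 0 r * osc_int2 b c k r))"

lemma continuous_on_snd_time:
  "continuous_on {0..} f \<Longrightarrow> continuous_on (X \<times> {0..}) (\<lambda>z. f (snd z))"
  by (rule continuous_on_compose2[of "{0..}" f]) (auto intro!: continuous_intros)

lemma continuous_on_osc_int:
  assumes "continuous_on {0..} f"
  shows "continuous_on (UNIV \<times> {0..}) (\<lambda>z. osc_int f (fst z) (snd z))"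
proof -
  have "continuous_on (UNIV \<times> {0..}) (\<lambda>(k,s). f s * phase k 0 s)"
    unfolding split_beta by (intro continuous_intros continuous_on_snd_time assms)
  from continuous_on_integral_upto[OF this] show ?thesis
    by (simp add: osc_int_def split_beta)
qed

lemma continuous_on_osc_int2:
  assumes "continuous_on {0..} b" "continuous_on {0..} c"
  shows "continuous_on (UNIV \<times> {0..}) (\<lambda>z. osc_int2 b c (fst z) (snd z))"
proof -
  have "continuous_on (UNIV \<times> {0..}) (\<lambda>(k,s). b s * (cnj (phase k 0 s) * osc_int c k s))"
    unfolding split_beta by (intro continuous_intros continuous_on_snd_time continuous_on_osc_int assms)
  from continuous_on_integral_upto[OF this] show ?thesis
    by (simp add: osc_int2_def split_beta)
qed

lemma time_slice:
  "continuous_on (UNIV \<times> {0..}) (\<lambda>z. F (fst z) (snd z)) \<Longrightarrow> continuous_on {0..} (F k)"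
  using continuous_on_slice[of UNIV "{0..}" F k] by (simp add: split_beta)

lemmas osc_cont = time_slice[OF continuous_on_osc_int] time_slice[OF continuous_on_osc_int2]

lemma phase_even: "phase (- k) 0 s = phase k 0 s"
  by (simp add: phase_def)

lemma osc_int_even: "osc_int f (- k) s = osc_int f k s"
  and osc_int2_even: "osc_int2 b c (- k) s = osc_int2 b c k s"
  by (simp_all add: osc_int_def osc_int2_def phase_even)

text \<open>A factor \<open>k^2\<close> on the phase is \<open>- \<i>\<close> times its time
  derivative. The term at time zero drops out because \<open>g\<close> vanishes there.\<close>

lemma osc_int_by_parts:
  assumes "flat_smooth g" "s \<ge> 0"
  shows "(of_real k)^2 * osc_int g k s = - \<i> * (g s * phase k 0 s - osc_int (vd 1 g) k s)"
proof -
  note g = flat_smoothD[OF assms(1)]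
  have "((\<lambda>r. g r * (\<i> * (of_real k)^2 * phase k 0 r) + vd 1 g r * phase k 0 r) has_integral
      g s * phase k 0 s - g 0 * phase k 0 0) {0..s}"
    by (rule fundamental_theorem_of_calculus[OF assms(2)],
        rule has_vector_derivative_mult[OF has_vector_derivative_within_subset[OF g(1)] phase_deriv_t]) auto
  then have "integral {0..s} (\<lambda>r. \<i> * (of_real k)^2 * (g r * phase k 0 r) + vd 1 g r * phase k 0 r) = g s * phase k 0 s"
    by (simp add: integral_unique g algebra_simps)
  moreover have "integral {0..s} (\<lambda>r. \<i> * (of_real k)^2 * (g r * phase k 0 r) + vd 1 g r * phase k 0 r) =
      \<i> * (of_real k)^2 * osc_int g k s + osc_int (vd 1 g) k s"
    unfolding osc_int_def
    by (subst integral_add)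
      (auto simp del: One_nat_def intro!: integrable_continuous_real continuous_intros
        continuous_on_subset[OF g(2)] continuous_on_subset[OF g(3)])
  ultimately have "\<i> * (\<i> * (of_real k)^2 * osc_int g k s) = \<i> * (g s * phase k 0 s - osc_int (vd 1 g) k s)"
    by (simp add: algebra_simps)
  then show ?thesis by (simp add: algebra_simps)
qed

lemma decaying_halfline_FTC:
  assumes F: "\<And>x. x \<ge> 0 \<Longrightarrow> ((\<lambda>x. F x t) has_vector_derivative - f x t) (at x within {0..})"
    and f: "continuous_on {0..} (\<lambda>x. f x t)"
    and d: "decaying t f" "decaying t F" and t: "t \<ge> 0" and x: "x \<ge> 0"
  shows "halfline_integral (\<lambda>v. f (x + v) t) = F x t"
proof -
  from d(1) t obtain M where M: "\<And>x s. x \<ge> 0 \<Longrightarrow> s \<in> {0..t} \<Longrightarrow> norm (f x s) \<le> M / (1 + x)^2"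
    by (rule decayingE) blast
  show ?thesis
    by (rule integral_halfline_FTC[where C=M])
      (use F f M x t decaying_tendsto[OF d(2)] in auto)
qed

lemma integrable_time: "continuous_on {0..} f \<Longrightarrow> f integrable_on {0..s::real}"
  for f :: "real \<Rightarrow> complex"
  by (intro integrable_continuous_real) (auto intro: continuous_on_subset)

context schroedinger_pair
begin

lemma potentials_decaying:
  assumes T: "T \<ge> 0"
  shows "decaying T (dn k)" "decaying T (dn3 k)" "decaying T md" "decaying T (A1 k)" "decaying T (B1 k)" "decaying T (Z1 k)"
proof -
  note d = halfline_classD(8-9)[OF class_q, of T] halfline_classD(8-9)[OF class_p, of T]
  note ph = decaying_mult_bounded(1)[where g="\<lambda>x s. phase k x s" and K=1]
  show 1: "decaying T (dn k)" unfolding dn_def by (rule ph) (auto intro!: d)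
  have 2: "decaying T (fl k)" unfolding fl_def by (rule ph) (auto intro!: d decaying_add decaying_cmult)
  show 3: "decaying T (dn3 k)" unfolding dn3_def by (rule ph) (auto intro!: d)
  have 4: "decaying T (fl3 k)" unfolding fl3_def by (rule ph) (auto intro!: d decaying_add decaying_cmult)
  show 5: "decaying T md" unfolding md_def by (intro decaying_mult decaying_cnj d T)
  show 6: "decaying T (A1 k)" unfolding A1_def
    by (intro decaying_minus decaying_integral 2 T) (simp add: split_beta densities_cont)
  have 7: "decaying T (flB k)"
    unfolding flB_def
    by (intro decaying_diff decaying_cmult decaying_mult decaying_cnj 2 5 6 T)
  show 8: "decaying T (B1 k)" unfolding B1_def
    by (intro decaying_integral 7 T) (simp add: split_beta flB_cont)
  have 9: "decaying T (flZ k)"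
    unfolding flZ_def by (intro decaying_add decaying_cmult decaying_mult 2 4 5 6 8 T)
  show "decaying T (Z1 k)" unfolding Z1_def
    by (intro decaying_minus decaying_integral 9 T) (simp add: split_beta flZ_cont)
qed

text \<open>Decay fixes the constant of integration at infinity, so the potential defined by a time
  integral is also a spatial tail integral at time \<open>t\<close>. The proof rests on having both
  representations of the same quantity.\<close>

lemma A1_halfline: "t \<ge> 0 \<Longrightarrow> x \<ge> 0 \<Longrightarrow> A1 k x t = halfline_integral (\<lambda>v. dn k (x + v) t)"
  by (rule decaying_halfline_FTC[symmetric])
    (auto intro!: A1_x potentials_decaying continuous_on_space_slice densities_cont)

lemma B1_halfline: "t \<ge> 0 \<Longrightarrow> x \<ge> 0 \<Longrightarrow>
    B1 k x t = halfline_integral (\<lambda>v. cnj (dn k (x + v) t) * A1 k (x + v) t)"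
  by (rule decaying_halfline_FTC[symmetric, where f="\<lambda>x s. cnj (dn k x s) * A1 k x s"])
    (auto intro!: B1_x potentials_decaying decaying_mult decaying_cnj continuous_on_space_slice continuous_intros densities_cont A1_cont)

text \<open>Conservation of mass for the free equation: \<open>q\<close> vanishes initially, so the
  mass on the half-line is exactly what has entered through \<open>x = 0\<close>. It converts the
  mass, which arises from the spatial limit, into boundary values.\<close>

lemma mass_identity:
  assumes t: "t \<ge> 0"
  shows "halfline_integral (\<lambda>v. md v t) =
    - \<i> * integral {0..t} (\<lambda>s. cnj (g s) * px q 0 s - cnj (px q 0 s) * g s)"
proof -
  define f where "f x s = \<i> * (cnj (q x s) * px q x s - cnj (px q x s) * q x s)" for x s
  have cf: "continuous_on ({0..} \<times> {0..}) (\<lambda>z. f (fst z) (snd z))"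
    unfolding f_def by (intro continuous_intros pq_cont)
  have d: "((\<lambda>y. integral {0..t} (f y)) has_vector_derivative md x t) (at x within {0..})" if "x \<ge> 0" for x
  proof (rule flux_integral_has_vector_derivative[where
        \<phi>="\<lambda>x s. \<i> * (cnj (q x s) * px (px q) x s - cnj (px (px q) x s) * q x s)"])
    fix x s :: real assume xs: "x \<ge> 0" "s \<ge> 0"
    note D = halfline_classD(1-3)[OF class_q xs]
    show "((\<lambda>y. f y s) has_vector_derivative \<i> * (cnj (q x s) * px (px q) x s - cnj (px (px q) x s) * q x s)) (at x within {0..})"
      unfolding f_def
      by (rule has_vector_derivative_eq_rhs[OF has_vector_derivative_mult[OF has_vector_derivative_const
            has_vector_derivative_diff[OF has_vector_derivative_mult[OF has_vector_derivative_cnj[OF D(1)] D(2)]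
              has_vector_derivative_mult[OF has_vector_derivative_cnj[OF D(2)] D(1)]]]])
        (simp add: algebra_simps)
    show "((\<lambda>s. md x s) has_vector_derivative \<i> * (cnj (q x s) * px (px q) x s - cnj (px (px q) x s) * q x s)) (at s within {0..})"
      unfolding md_def
      by (rule has_vector_derivative_eq_rhs[OF has_vector_derivative_mult[OF D(3) has_vector_derivative_cnj[OF D(3)]]])
        (simp add: pde_q xs algebra_simps)
  qed (use that t cf in \<open>auto simp: split_beta md_def q_initial intro!: continuous_intros pq_cont\<close>)
  have "halfline_integral (\<lambda>v. md (0 + v) t) = - integral {0..t} (f 0)"
  proof (rule decaying_halfline_FTC[where F="\<lambda>x s. - integral {0..s} (f x)"])
    have "decaying t f" unfolding f_def[abs_def]
      by (intro decaying_cmult decaying_diff decaying_mult decaying_cnj halfline_classD(8-9)[OF class_q] t)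
    then show "decaying t (\<lambda>x s. - integral {0..s} (f x))"
      using t cf by (intro decaying_minus decaying_integral) (simp_all add: split_beta)
  qed (use t d in \<open>auto intro!: has_vector_derivative_minus potentials_decaying continuous_on_space_slice densities_cont\<close>)
  also have "integral {0..t} (f 0) = integral {0..t} (\<lambda>s. \<i> * (cnj (g s) * px q 0 s - cnj (px q 0 s) * g s))"
    by (rule integral_cong) (auto simp: f_def q_boundary)
  finally show ?thesis by simp
qed

text \<open>The \<open>x\<close>-derivative of \<open>k * Z1\<close> contains
  \<open>- k * dn3\<close>; subtracting \<open>\<i> * dn3\<close> cancels it and leaves
  \<open>px p\<close> tested against the phase. This is an integration by parts in space, whose
  boundary term is the one with \<open>g3\<close>.\<close>

lemma global_relation:
  assumes t: "t \<ge> 0"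
  shows "halfline_integral (\<lambda>v. of_real lam * of_real k * (dn k v t * B1 k v t) + \<i> * px p v t * phase k v t) =
    of_real k * Z1 k 0 t - \<i> * g3 t * phase k 0 t"
proof -
  define F where "F x s = of_real k * Z1 k x s - \<i> * dn3 k x s" for x s
  define f where "f x s = of_real lam * of_real k * (dn k x s * B1 k x s) + \<i> * px p x s * phase k x s" for x s
  have "halfline_integral (\<lambda>v. f (0 + v) t) = F 0 t"
  proof (rule decaying_halfline_FTC)
    show "((\<lambda>x. F x t) has_vector_derivative - f x t) (at x within {0..})" if "x \<ge> 0" for x
      unfolding F_def
      by (rule has_vector_derivative_eq_rhs[OF has_vector_derivative_diff[OF
            has_vector_derivative_mult[OF has_vector_derivative_const Z1_x[OF that t]]
            has_vector_derivative_mult[OF has_vector_derivative_const dn3_x[OF that t]]]])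
        (simp add: f_def dn3_def algebra_simps)
    show "decaying t f" unfolding f_def mult.assoc
      by (intro decaying_add decaying_cmult decaying_mult potentials_decaying t decaying_mult_bounded(1)[where K=1]
          halfline_classD(9)[OF class_p]) auto
    show "decaying t F" unfolding F_def
      by (intro decaying_diff decaying_cmult potentials_decaying t)
    show "continuous_on {0..} (\<lambda>x. f x t)"
      unfolding f_def by (rule continuous_on_space_slice[OF _ t], intro continuous_intros densities_cont B1_cont pq_cont)
  qed (use t in auto)
  then show ?thesis by (simp add: f_def F_def dn3_def p_boundary t)
qed

section \<open>Potentials at \<open>x = 0\<close> and their parity in \<open>k\<close>\<close>

definition "h = px q 0"

lemma gh_cont: "continuous_on {0..} g" "continuous_on {0..} (vd 1 g)" "continuous_on {0..} h"
   "continuous_on {0..} g3" "continuous_on {0..} (vd 1 g3)"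
  using flat_smoothD(2,3)[OF g] flat_smoothD(2,3)[OF g3] continuous_on_time_slice[of "px q" 0] pq_cont
  by (auto simp: h_def)

lemma cnj_cont: "continuous_on {0..} (\<lambda>s. cnj (g s))" "continuous_on {0..} (\<lambda>s. cnj (h s))"
  by (intro continuous_intros gh_cont)+

lemma A1_boundary:
  assumes "s \<ge> 0"
  shows "A1 k 0 s = - (of_real k * osc_int g k s + \<i> * osc_int h k s)"
proof -
  have "integral {0..s} (fl k 0) = integral {0..s} (\<lambda>r. of_real k * (g r * phase k 0 r) + \<i> * (h r * phase k 0 r))"
    by (rule integral_cong) (auto simp: fl_def q_boundary h_def algebra_simps)
  also have "\<dots> = of_real k * osc_int g k s + \<i> * osc_int h k s"
    unfolding osc_int_def
    by (subst integral_add) (auto intro!: integrable_time continuous_intros gh_cont)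
  finally show ?thesis by (simp add: A1_def)
qed

definition "Beven k s = \<i> * osc_int2 (\<lambda>s. cnj (g s)) (vd 1 g) k s + osc_int2 (\<lambda>s. cnj (h s)) h k s"
definition "Bodd k s = \<i> * osc_int2 (\<lambda>s. cnj (g s)) h k s - \<i> * osc_int2 (\<lambda>s. cnj (h s)) g k s"

text \<open>The product of \<open>k * cnj g\<close> with the part \<open>k * osc_int g\<close> of
  \<open>A1\<close> carries \<open>k^2\<close>. Integrating by parts replaces \<open>g\<close> by
  its derivative, and the boundary term cancels \<open>\<i> * md\<close> exactly because the two
  opposite phases multiply to one. The remainder splits into an even part and \<open>k\<close> times
  an even function.\<close>

lemma B1_boundary:
  assumes "s \<ge> 0"
  shows "B1 k 0 s = Beven k s + of_real k * Bodd k s"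
proof -
  define X where "X b c r = cnj (b r) * (cnj (phase k 0 r) * osc_int c k r)" for b c r
  have X: "X b c integrable_on {0..s}" if "continuous_on {0..} b" "continuous_on {0..} c" for b c
    unfolding X_def by (intro integrable_time continuous_intros osc_cont that)
  have "flB k 0 r = (\<i> * X g (vd 1 g) r + X h h r) + of_real k * (\<i> * X g h r - \<i> * X h g r)" if "r \<ge> 0" for r
  proof -
    have "flB k 0 r = \<i> * (g r * cnj (g r)) + cnj (phase k 0 r) * (cnj (g r) * ((of_real k)^2 * osc_int g k r)
       + \<i> * of_real k * (cnj (g r) * osc_int h k r - cnj (h r) * osc_int g k r) + cnj (h r) * osc_int h k r)"
      using that by (simp add: flB_def fl_def md_def q_boundary A1_boundary h_def[symmetric] algebra_simps power2_eq_square)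
    also have "\<dots> = \<i> * (g r * cnj (g r)) * (1 - phase k 0 r * cnj (phase k 0 r)) + (\<i> * X g (vd 1 g) r + X h h r) + of_real k * (\<i> * X g h r - \<i> * X h g r)"
      unfolding osc_int_by_parts[OF g that] X_def by (simp add: algebra_simps)
    finally show ?thesis by (simp add: phase_cnj)
  qed
  then have "B1 k 0 s = integral {0..s} (\<lambda>r. (\<i> * X g (vd 1 g) r + X h h r) + of_real k * (\<i> * X g h r - \<i> * X h g r))"
    unfolding B1_def by (intro integral_cong) auto
  also have "\<dots> = (\<i> * integral {0..s} (X g (vd 1 g)) + integral {0..s} (X h h))
      + of_real k * (\<i> * integral {0..s} (X g h) - \<i> * integral {0..s} (X h g))"
    by (simp add: integral_add integral_diff integrable_add integrable_diff integrable_on_cmult_left X gh_cont)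
  finally show ?thesis by (simp add: Beven_def Bodd_def osc_int2_def X_def[abs_def])
qed

text \<open>At \<open>x = 0\<close> the term \<open>\<i> * px p\<close> of \<open>fl3\<close> is
  multiplied by an even phase and disappears from the difference. In the product of
  \<open>k * g + \<i> * h\<close> with \<open>Beven + k * Bodd\<close> the odd terms pair
  \<open>g\<close> with \<open>Beven\<close> and \<open>h\<close> with \<open>Bodd\<close>, which
  gives the four triple integrals.\<close>

lemma Z1_odd_part:
  assumes t: "t \<ge> 0"
  shows "Z1 k 0 t - Z1 (- k) 0 t = - 2 * of_real k * (osc_int g3 k t + of_real lam *
     (\<i> * osc_int3 g (\<lambda>s. cnj (g s)) (vd 1 g) k t + osc_int3 g (\<lambda>s. cnj (h s)) h k t
      - osc_int3 h (\<lambda>s. cnj (g s)) h k t + osc_int3 h (\<lambda>s. cnj (h s)) g k t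
      - \<i> * integral {0..t} (\<lambda>s. g s * cnj (g s) * osc_int g k s)))"
proof -
  define Y where "Y a b c r = a r * (phase k 0 r * osc_int2 (\<lambda>s. cnj (b s)) c k r)" for a b c r
  have Y: "Y a b c integrable_on {0..t}" if "continuous_on {0..} a" "continuous_on {0..} b" "continuous_on {0..} c" for a b c
    unfolding Y_def by (intro integrable_time continuous_intros osc_cont that)
  have I: "flZ k 0 integrable_on {0..t}" for k
    by (intro integrable_time continuous_on_time_slice flZ_cont) auto
  have "Z1 k 0 t - Z1 (- k) 0 t = - integral {0..t} (\<lambda>s. flZ k 0 s - flZ (- k) 0 s)"
    unfolding Z1_def by (subst integral_diff) (auto intro: I)
  also have "integral {0..t} (\<lambda>s. flZ k 0 s - flZ (- k) 0 s) =
     integral {0..t} (\<lambda>s. 2 * of_real k * (g3 s * phase k 0 s + of_real lam *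
      (\<i> * Y g g (vd 1 g) s + Y g h h s - Y h g h s + Y h h g s - \<i> * (g s * cnj (g s) * osc_int g k s))))"
  proof (rule integral_cong)
    fix s assume "s \<in> {0..t}"
    then have s: "s \<ge> 0" by simp
    show "flZ k 0 s - flZ (- k) 0 s = 2 * of_real k * (g3 s * phase k 0 s + of_real lam *
      (\<i> * Y g g (vd 1 g) s + Y g h h s - Y h g h s + Y h h g s - \<i> * (g s * cnj (g s) * osc_int g k s)))"
      using s by (simp add: flZ_def fl3_def fl_def md_def q_boundary p_boundary A1_boundary B1_boundary
          phase_even osc_int_even osc_int2_even h_def[symmetric] Beven_def Bodd_def Y_def algebra_simps)
  qed
  also have "\<dots> = 2 * of_real k * (osc_int g3 k t + of_real lam *
      (\<i> * integral {0..t} (Y g g (vd 1 g)) + integral {0..t} (Y g h h) - integral {0..t} (Y h g h) + integral {0..t} (Y h h g)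
       - \<i> * integral {0..t} (\<lambda>s. g s * cnj (g s) * osc_int g k s)))"
  proof -
    have 1: "(\<lambda>s. g3 s * phase k 0 s) integrable_on {0..t}" "(\<lambda>s. g s * cnj (g s) * osc_int g k s) integrable_on {0..t}"
      by (intro integrable_time continuous_intros osc_cont gh_cont)+
    show ?thesis unfolding osc_int_def[of g3]
      by (simp add: integral_add integral_diff integrable_add integrable_diff integrable_on_cmult_left Y gh_cont 1)
  qed
  finally show ?thesis by (simp add: osc_int3_def Y_def[abs_def])
qed

text \<open>\<open>X\<close> carries a factor \<open>k\<close> on \<open>Z1\<close>, so its even
  part sees the odd part of \<open>Z1\<close>. The resulting \<open>k^2\<close> is integrated by
  parts against \<open>g3\<close>, where the boundary term cancels the explicit \<open>g3 t\<close>,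
  and in the \<open>md\<close> term. On the triple integrals it is kept and becomes part of the
  kernel.\<close>

lemma even_part:
  assumes t: "t \<ge> 0"
  defines "X \<equiv> \<lambda>k. - \<i> * (of_real k * Z1 k 0 t - \<i> * g3 t * phase k 0 t)"
  shows "X k + X (- k) = 2 * (- osc_int (vd 1 g3) k t + \<i> * of_real lam *
     ((of_real k)^2 * (\<i> * osc_int3 g (\<lambda>s. cnj (g s)) (vd 1 g) k t + osc_int3 g (\<lambda>s. cnj (h s)) h k t
      - osc_int3 h (\<lambda>s. cnj (g s)) h k t + osc_int3 h (\<lambda>s. cnj (h s)) g k t)
      - osc_int (\<lambda>s. g s * cnj (g s) * g s) k t + integral {0..t} (\<lambda>s. g s * cnj (g s) * osc_int (vd 1 g) k s)))"
proof -
  have P: "(of_real k)^2 * integral {0..t} (\<lambda>s. g s * cnj (g s) * osc_int g k s) =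
     - \<i> * (osc_int (\<lambda>s. g s * cnj (g s) * g s) k t - integral {0..t} (\<lambda>s. g s * cnj (g s) * osc_int (vd 1 g) k s))"
  proof -
    have "(of_real k)^2 * integral {0..t} (\<lambda>s. g s * cnj (g s) * osc_int g k s) =
      integral {0..t} (\<lambda>s. (of_real k)^2 * (g s * cnj (g s) * osc_int g k s))" by simp
    also have "\<dots> = integral {0..t} (\<lambda>s. - \<i> * (g s * cnj (g s) * g s * phase k 0 s - g s * cnj (g s) * osc_int (vd 1 g) k s))"
    proof (rule integral_cong)
      fix s assume "s \<in> {0..t}"
      then have "(of_real k)^2 * osc_int g k s = - \<i> * (g s * phase k 0 s - osc_int (vd 1 g) k s)"
        by (intro osc_int_by_parts g) auto
      then have "g s * cnj (g s) * ((of_real k)^2 * osc_int g k s) = g s * cnj (g s) * (- \<i> * (g s * phase k 0 s - osc_int (vd 1 g) k s))"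
        by simp
      then show "(of_real k)^2 * (g s * cnj (g s) * osc_int g k s) =
        - \<i> * (g s * cnj (g s) * g s * phase k 0 s - g s * cnj (g s) * osc_int (vd 1 g) k s)"
        by (simp only: mult_ac right_diff_distrib left_diff_distrib)
    qed
    also have "\<dots> = - \<i> * (osc_int (\<lambda>s. g s * cnj (g s) * g s) k t - integral {0..t} (\<lambda>s. g s * cnj (g s) * osc_int (vd 1 g) k s))"
      unfolding osc_int_def[of "\<lambda>s. g s * cnj (g s) * g s"]
      by (subst integral_diff[symmetric])
        (auto intro!: integrable_time continuous_intros gh_cont osc_cont)
    finally show ?thesis .
  qed
  have "X k + X (- k) = - \<i> * of_real k * (Z1 k 0 t - Z1 (- k) 0 t) - 2 * g3 t * phase k 0 t"
    by (simp add: X_def phase_even algebra_simps)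
  also have "\<dots> = 2 * \<i> * ((of_real k)^2 * osc_int g3 k t) + 2 * \<i> * of_real lam *
     ((of_real k)^2 * (\<i> * osc_int3 g (\<lambda>s. cnj (g s)) (vd 1 g) k t + osc_int3 g (\<lambda>s. cnj (h s)) h k t
      - osc_int3 h (\<lambda>s. cnj (g s)) h k t + osc_int3 h (\<lambda>s. cnj (h s)) g k t)
      - \<i> * ((of_real k)^2 * integral {0..t} (\<lambda>s. g s * cnj (g s) * osc_int g k s))) - 2 * g3 t * phase k 0 t"
    unfolding Z1_odd_part[OF t] by (simp add: algebra_simps power2_eq_square)
  finally show ?thesis
    unfolding P osc_int_by_parts[OF g3 t] by (simp add: algebra_simps)
qed

end

subsection \<open>Time kernels\<close>

lemma phase_shift: "phase k 0 s * cnj (phase k 0 t) = cnj (phase k 0 (t - s))"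
  "cnj (phase k 0 s) * cnj (phase k 0 t) = cnj (phase k 0 (t + s))"
  by (simp_all add: phase_def exp_cnj algebra_simps flip: exp_add)

lemma continuous_bound_upto:
  fixes f :: "real \<Rightarrow> complex"
  assumes "continuous_on {0..} f"
  obtains C where "C \<ge> 0" "\<And>s. s \<in> {0..T} \<Longrightarrow> norm (f s) \<le> C"
proof -
  have "compact (f ` {0..T})"
    by (intro compact_continuous_image continuous_on_subset[OF assms]) auto
  then obtain C where "\<forall>y\<in>f ` {0..T}. norm y \<le> C"
    by (meson compact_imp_bounded bounded_iff)
  then show ?thesis by (intro that[of "max C 0"]) (auto simp: le_max_iff_disj)
qed

lemma norm_integral_upto_le:
  fixes f :: "real \<Rightarrow> complex"
  assumes "continuous_on {0..} f" "\<And>r. r \<in> {0..s} \<Longrightarrow> norm (f r) \<le> C" "0 \<le> s" "s \<le> T" "0 \<le> C"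
  shows "norm (integral {0..s} f) \<le> C * T"
proof -
  have "norm (integral {0..s} f) \<le> C * (s - 0)"
    using assms by (intro integral_bound) (auto intro: continuous_on_subset)
  also have "\<dots> \<le> C * T" using assms by (intro mult_left_mono) auto
  finally show ?thesis .
qed

lemma osc_int_bound:
  assumes "continuous_on {0..} f"
  obtains C where "C \<ge> 0" "\<And>k s. s \<in> {0..T} \<Longrightarrow> norm (osc_int f k s) \<le> C"
proof -
  obtain C where C: "C \<ge> 0" "\<And>s. s \<in> {0..T} \<Longrightarrow> norm (f s) \<le> C"
    using continuous_bound_upto[OF assms] by blast
  have "norm (osc_int f k s) \<le> C * T" if "s \<in> {0..T}" for k s
    unfolding osc_int_def
    by (rule norm_integral_upto_le) (use C that in \<open>auto simp: norm_mult intro!: continuous_intros assms\<close>)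
  then show ?thesis by (intro that[of "max (C * T) 0"]) (auto simp: le_max_iff_disj)
qed

lemma osc_int2_bound:
  assumes "continuous_on {0..} b" "continuous_on {0..} c"
  obtains C where "C \<ge> 0" "\<And>k s. s \<in> {0..T} \<Longrightarrow> norm (osc_int2 b c k s) \<le> C"
proof -
  obtain C where C: "C \<ge> 0" "\<And>s. s \<in> {0..T} \<Longrightarrow> norm (b s) \<le> C"
    using continuous_bound_upto[OF assms(1)] by blast
  obtain D where D: "D \<ge> 0" "\<And>k s. s \<in> {0..T} \<Longrightarrow> norm (osc_int c k s) \<le> D"
    using osc_int_bound[OF assms(2)] by blast
  have "norm (osc_int2 b c k s) \<le> C * D * T" if "s \<in> {0..T}" for k s
    unfolding osc_int2_def
    by (rule norm_integral_upto_le)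
      (use C D that in \<open>auto simp: norm_mult intro!: mult_mono continuous_intros assms osc_cont\<close>)
  then show ?thesis by (intro that[of "max (C * D * T) 0"]) (auto simp: le_max_iff_disj)
qed

lemma integral_mult_left':
  "c * integral S f = integral S (\<lambda>x. c * f x :: complex)" by simp

text \<open>\<open>W\<close> is a frequency weight and \<open>K\<close> its transform in the lag.
  One Fubini argument thus covers the plain Gaussian and the Gaussian times
  \<open>k^2\<close>.\<close>

locale time_kernel =
  fixes W K :: "real \<Rightarrow> complex"
  assumes W: "integrable lborel W" "continuous_on UNIV W"
    and K: "\<And>\<sigma>. \<sigma> \<ge> 0 \<Longrightarrow> (LINT k|lborel. W k * cnj (phase k 0 \<sigma>)) = K \<sigma>"
begin

text \<open>Peels off one layer of an iterated time integral: the \<open>k\<close>-integral passes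
  inside, and the inner factor \<open>F\<close>, which is only bounded, is dealt with by the
  preceding layer.\<close>

lemma swap:
  fixes F :: "real \<Rightarrow> real \<Rightarrow> complex"
  assumes a: "continuous_on {0..} a" and F: "continuous_on (UNIV \<times> {0..}) (\<lambda>z. F (fst z) (snd z))"
    and C: "\<And>k s. s \<in> {0..T} \<Longrightarrow> norm (F k s) \<le> C" and T: "T \<ge> 0"
  shows "(LINT k|lborel. W k * integral {0..T} (\<lambda>s. a s * F k s)) = integral {0..T} (\<lambda>s. a s * (LINT k|lborel. W k * F k s))"
    and "integrable lborel (\<lambda>k. W k * integral {0..T} (\<lambda>s. a s * F k s))"
proof -
  obtain A where A: "A \<ge> 0" "\<And>s. s \<in> {0..T} \<Longrightarrow> norm (a s) \<le> A"
    using continuous_bound_upto[OF a] by blast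
  have c: "continuous_on (UNIV \<times> {0..}) (\<lambda>(k,s). W k * (a s * F k s))"
    unfolding split_beta
    by (intro continuous_intros F continuous_on_snd_time a continuous_on_compose2[OF W(2)]) auto
  have i: "integrable lborel (\<lambda>k. norm (W k) * (A * C))" using W by simp
  have b: "norm (W k * (a s * F k s)) \<le> norm (W k) * (A * C)" if "s \<in> {0..T}" for k s
    using A C that by (auto simp: norm_mult intro!: mult_mono)
  show "(LINT k|lborel. W k * integral {0..T} (\<lambda>s. a s * F k s)) = integral {0..T} (\<lambda>s. a s * (LINT k|lborel. W k * F k s))"
  proof -
    have "(LINT k|lborel. W k * (a s * F k s)) = a s * (LINT k|lborel. W k * F k s)" for s
      by (subst mult.left_commute) (rule integral_mult_right_zero)
    then show ?thesis using lborel_time_integral_swap(1)[OF c i T b] by simp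
  qed
  show "integrable lborel (\<lambda>k. W k * integral {0..T} (\<lambda>s. a s * F k s))"
    using lborel_time_integral_swap(3)[OF c i T b] by simp
qed

lemma kernel1:
  assumes c: "continuous_on {0..} c" and "0 \<le> s" "s \<le> \<tau>"
  shows "(LINT k|lborel. W k * (cnj (phase k 0 \<tau>) * osc_int c k s)) = integral {0..s} (\<lambda>r. c r * K (\<tau> - r))"
    and "integrable lborel (\<lambda>k. W k * (cnj (phase k 0 \<tau>) * osc_int c k s))"
proof -
  have eq: "cnj (phase k 0 \<tau>) * osc_int c k s = integral {0..s} (\<lambda>r. c r * cnj (phase k 0 (\<tau> - r)))" for k
    unfolding osc_int_def integral_mult_left' by (simp add: phase_shift[symmetric] mult_ac)
  have F: "continuous_on (UNIV \<times> {0..}) (\<lambda>z. cnj (phase (fst z) 0 (\<tau> - snd z)))"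
    by (intro continuous_intros)
  show "(LINT k|lborel. W k * (cnj (phase k 0 \<tau>) * osc_int c k s)) = integral {0..s} (\<lambda>r. c r * K (\<tau> - r))"
    unfolding eq using assms
    by (subst swap(1)[OF c F, of s 1]) (auto simp: K intro!: integral_cong)
  show "integrable lborel (\<lambda>k. W k * (cnj (phase k 0 \<tau>) * osc_int c k s))"
    unfolding eq by (rule swap(2)[OF c F, of s 1]) (use assms in auto)
qed

text \<open>The outer variable carries no phase of its own, hence the lag \<open>t - r\<close> is
  the same for all \<open>s\<close>. This is the shape of the term with
  \<open>g * cnj g\<close>.\<close>

lemma kernel2:
  assumes a: "continuous_on {0..} a" and c: "continuous_on {0..} c" and t: "0 \<le> t"
  shows "(LINT k|lborel. W k * (cnj (phase k 0 t) * integral {0..t} (\<lambda>s. a s * osc_int c k s))) =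
     integral {0..t} (\<lambda>s. a s * integral {0..s} (\<lambda>r. c r * K (t - r)))"
    and "integrable lborel (\<lambda>k. W k * (cnj (phase k 0 t) * integral {0..t} (\<lambda>s. a s * osc_int c k s)))"
proof -
  have eq: "cnj (phase k 0 t) * integral {0..t} (\<lambda>s. a s * osc_int c k s) =
      integral {0..t} (\<lambda>s. a s * (cnj (phase k 0 t) * osc_int c k s))" for k
    unfolding integral_mult_left' by (simp add: mult_ac)
  have F: "continuous_on (UNIV \<times> {0..}) (\<lambda>z. cnj (phase (fst z) 0 t) * osc_int c (fst z) (snd z))"
    by (intro continuous_intros continuous_on_osc_int c)
  obtain D where D: "D \<ge> 0" "\<And>k s. s \<in> {0..t} \<Longrightarrow> norm (osc_int c k s) \<le> D"
    using osc_int_bound[OF c] by blast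
  show "(LINT k|lborel. W k * (cnj (phase k 0 t) * integral {0..t} (\<lambda>s. a s * osc_int c k s))) =
     integral {0..t} (\<lambda>s. a s * integral {0..s} (\<lambda>r. c r * K (t - r)))"
    unfolding eq using t D
    by (subst swap(1)[OF a F, of t D]) (auto simp: norm_mult kernel1 c intro!: integral_cong)
  show "integrable lborel (\<lambda>k. W k * (cnj (phase k 0 t) * integral {0..t} (\<lambda>s. a s * osc_int c k s)))"
    unfolding eq by (rule swap(2)[OF a F, of t D]) (use t D in \<open>auto simp: norm_mult\<close>)
qed

lemma kernel2':
  assumes b: "continuous_on {0..} b" and c: "continuous_on {0..} c" and "0 \<le> s" "0 \<le> \<rho>"
  shows "(LINT k|lborel. W k * (cnj (phase k 0 \<rho>) * osc_int2 b c k s)) =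
     integral {0..s} (\<lambda>r. b r * integral {0..r} (\<lambda>v. c v * K (\<rho> + r - v)))"
proof -
  have eq: "cnj (phase k 0 \<rho>) * osc_int2 b c k s =
      integral {0..s} (\<lambda>r. b r * (cnj (phase k 0 (\<rho> + r)) * osc_int c k r))" for k
    unfolding osc_int2_def integral_mult_left' by (simp add: phase_shift(2)[symmetric] mult_ac)
  have F: "continuous_on (UNIV \<times> {0..}) (\<lambda>z. cnj (phase (fst z) 0 (\<rho> + snd z)) * osc_int c (fst z) (snd z))"
    by (intro continuous_intros continuous_on_osc_int c)
  obtain D where D: "D \<ge> 0" "\<And>k r. r \<in> {0..s} \<Longrightarrow> norm (osc_int c k r) \<le> D"
    using osc_int_bound[OF c] by blast
  show ?thesis
    unfolding eq using assms D
    by (subst swap(1)[OF b F, of s D]) (auto simp: norm_mult kernel1 c intro!: integral_cong)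
qed

text \<open>The outer phase subtracts \<open>s\<close> from the lag, the conjugate middle phase adds
  \<open>r\<close>, and the inner one subtracts \<open>v\<close>. The orderings
  \<open>s \<le> t\<close> and \<open>v \<le> r\<close> keep the lag nonnegative, which is where
  \<open>K\<close> is known.\<close>

lemma kernel3:
  assumes a: "continuous_on {0..} a" and b: "continuous_on {0..} b" and c: "continuous_on {0..} c" and t: "0 \<le> t"
  shows "(LINT k|lborel. W k * (cnj (phase k 0 t) * osc_int3 a b c k t)) =
     integral {0..t} (\<lambda>s. a s * integral {0..s} (\<lambda>r. b r * integral {0..r} (\<lambda>v. c v * K (t - s + r - v))))"
    and "integrable lborel (\<lambda>k. W k * (cnj (phase k 0 t) * osc_int3 a b c k t))"
proof -
  have eq: "cnj (phase k 0 t) * osc_int3 a b c k t =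
      integral {0..t} (\<lambda>s. a s * (cnj (phase k 0 (t - s)) * osc_int2 b c k s))" for k
    unfolding osc_int3_def integral_mult_left' by (simp add: phase_shift(1)[symmetric] mult_ac)
  have F: "continuous_on (UNIV \<times> {0..}) (\<lambda>z. cnj (phase (fst z) 0 (t - snd z)) * osc_int2 b c (fst z) (snd z))"
    by (intro continuous_intros continuous_on_osc_int2 b c)
  obtain D where D: "D \<ge> 0" "\<And>k r. r \<in> {0..t} \<Longrightarrow> norm (osc_int2 b c k r) \<le> D"
    using osc_int2_bound[OF b c] by blast
  show "(LINT k|lborel. W k * (cnj (phase k 0 t) * osc_int3 a b c k t)) =
     integral {0..t} (\<lambda>s. a s * integral {0..s} (\<lambda>r. b r * integral {0..r} (\<lambda>v. c v * K (t - s + r - v))))"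
    unfolding eq using t D
    by (subst swap(1)[OF a F, of t D]) (auto simp: norm_mult kernel2' b c intro!: integral_cong)
  show "integrable lborel (\<lambda>k. W k * (cnj (phase k 0 t) * osc_int3 a b c k t))"
    unfolding eq by (rule swap(2)[OF a F, of t D]) (use t D in \<open>auto simp: norm_mult\<close>)
qed

end

section \<open>Gaussian-regularised kernels in the time lag\<close>

definition K0 :: "real \<Rightarrow> real \<Rightarrow> complex" where
  "K0 d \<sigma> = of_real (1 / (2 * sqrt pi)) / csqrt (of_real (d^2) + \<i> * of_real \<sigma>)"

text \<open>With \<open>z = d^2 + \<i> * \<sigma>\<close>, the constant of \<open>K0\<close> is
  \<open>1 / (2 * pi)\<close> times the \<open>sqrt pi\<close> of the complex Gaussian integral;
  \<open>K2\<close> has the additional factor \<open>1 / (2 * z)\<close> of the second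
  moment.\<close>

definition K2 :: "real \<Rightarrow> real \<Rightarrow> complex" where
  "K2 d \<sigma> = of_real (1 / (4 * sqrt pi)) /
     ((of_real (d^2) + \<i> * of_real \<sigma>) * csqrt (of_real (d^2) + \<i> * of_real \<sigma>))"

text \<open>The Gaussian cut-off together with the \<open>1 / (2 * pi)\<close> of Fourier inversion.
  With \<open>d^2\<close> in the exponent, \<open>d\<close> is a length in the
  \<open>x\<close>-variable.\<close>

definition gw :: "real \<Rightarrow> real \<Rightarrow> complex" where
  "gw d k = of_real (exp (- (d^2) * k^2) / (2 * pi))"

lemma gw_phase: "gw d k * cnj (phase k 0 \<sigma>) =
    of_real (1 / (2 * pi)) * exp (- ((of_real (d^2) + \<i> * of_real \<sigma>) * (of_real k)^2))"
proof -
  have "exp (- ((of_real (d^2) + \<i> * of_real \<sigma>) * (of_real k)^2)) =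
      exp (of_real (- (d^2) * k^2)) * cnj (phase k 0 \<sigma>)"
    by (simp add: phase_def exp_cnj algebra_simps flip: exp_add)
  then show ?thesis by (simp add: gw_def exp_of_real[symmetric])
qed

lemma gw_cont: "continuous_on UNIV (gw d)"
  unfolding gw_def[abs_def] by (intro continuous_intros) auto

lemma gw_integrable:
  assumes "d > 0" shows "integrable lborel (\<lambda>k. (of_real k)^n * gw d k)"
proof -
  have d: "d^2 > 0" using assms by simp
  have "integrable lborel (\<lambda>k. \<bar>k\<bar>^n * exp (- (d^2) * k^2) / (2 * pi))"
    using integrable_gauss_moment[OF d, of n] by simp
  then show ?thesis
    by (rule Bochner_Integration.integrable_bound)
      (auto simp: gw_def norm_mult norm_power norm_divide intro!: borel_measurable_continuous_onI continuous_intros)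
qed

lemma time_kernel_K0:
  assumes "d > 0" shows "time_kernel (gw d) (K0 d)"
proof
  have d: "d^2 > 0" using assms by simp
  show "integrable lborel (gw d)" using gw_integrable[OF assms, of 0] by simp
  show "continuous_on UNIV (gw d)" by (rule gw_cont)
  show "(LINT k|lborel. gw d k * cnj (phase k 0 \<sigma>)) = K0 d \<sigma>" if "\<sigma> \<ge> 0" for \<sigma>
  proof -
    have "complex_of_real (1 / (2 * pi)) * of_real (sqrt pi) = of_real (1 / (2 * sqrt pi))"
      by (simp add: divide_simps flip: of_real_mult)
    then show ?thesis
      unfolding gw_phase K0_def integral_mult_right_zero gauss_integral_complex[OF d that] by simp
  qed
qed

lemma time_kernel_K2:
  assumes "d > 0" shows "time_kernel (\<lambda>k. (of_real k)^2 * gw d k) (K2 d)"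
proof
  have d: "d^2 > 0" using assms by simp
  show "integrable lborel (\<lambda>k. (of_real k)^2 * gw d k)" using gw_integrable[OF assms, of 2] by simp
  show "continuous_on UNIV (\<lambda>k. (of_real k)^2 * gw d k)" by (intro continuous_intros gw_cont)
  show "(LINT k|lborel. (of_real k)^2 * gw d k * cnj (phase k 0 \<sigma>)) = K2 d \<sigma>" if "\<sigma> \<ge> 0" for \<sigma>
  proof -
    define z where "z = of_real (d^2) + \<i> * of_real \<sigma>"
    have Re: "Re z > 0" using d by (simp add: z_def)
    have "(LINT k|lborel. (of_real k)^2 * gw d k * cnj (phase k 0 \<sigma>)) =
        of_real (1 / (2 * pi)) * (LINT k|lborel. (of_real k)^2 * exp (- (z * (of_real k)^2)))"
      unfolding mult.assoc gw_phase z_def[symmetric]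
      by (subst mult.left_commute) (rule integral_mult_right_zero)
    also have "\<dots> = of_real (1 / (2 * pi)) * (of_real (sqrt pi) / csqrt z / (2 * z))"
      unfolding gauss_second_moment[OF Re] unfolding z_def gauss_integral_complex[OF d that] ..
    also have "\<dots> = of_real (1 / (2 * pi) * sqrt pi / 2) / (z * csqrt z)"
      by simp
    also have "1 / (2 * pi) * sqrt pi / 2 = 1 / (4 * sqrt pi)"
      by (simp add: divide_simps)
    finally show ?thesis by (simp add: K2_def z_def)
  qed
qed

subsection \<open>Removing the Gaussian regularisation in time\<close>

lemma has_integral_inverse_sqrt_diff:
  fixes t :: real
  assumes "t \<ge> 0"
  shows "((\<lambda>s. 1 / sqrt (t - s)) has_integral 2 * sqrt t) {0..t}"
proof -
  have "((\<lambda>s. 1 / sqrt (t - s)) has_integral (- 2 * sqrt (t - t) - (- 2 * sqrt (t - 0)))) {0..t}"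
  \<comment> \<open>The antiderivative is not differentiable at \<open>s = t\<close>; interior
    derivatives and continuity up to the endpoint are used instead.\<close>
  proof (rule fundamental_theorem_of_calculus_interior[OF assms])
    show "continuous_on {0..t} (\<lambda>s. - 2 * sqrt (t - s))" by (intro continuous_intros)
    show "((\<lambda>s. - 2 * sqrt (t - s)) has_vector_derivative 1 / sqrt (t - s)) (at s)" if "s \<in> {0<..<t}" for s
      unfolding has_real_derivative_iff_has_vector_derivative[symmetric]
      using that by (auto intro!: derivative_eq_intros simp: divide_simps)
  qed
  then show ?thesis by simp
qed

text \<open>At \<open>s = t\<close> the majorant takes the default value
  \<open>C / sqrt 0 = 0\<close> and cannot dominate. The bound is therefore asked only for
  \<open>s < t\<close>, and the convergence theorem is applied on the open interval, which changes
  no integral.\<close>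

lemma integral_limit_sqrt_dominated:
  fixes F :: "nat \<Rightarrow> real \<Rightarrow> complex"
  assumes t: "t \<ge> 0" and c: "\<And>n. continuous_on {0..t} (F n)"
    and b: "\<And>n s. 0 \<le> s \<Longrightarrow> s < t \<Longrightarrow> norm (F n s) \<le> C / sqrt (t - s)"
    and l: "\<And>s. 0 \<le> s \<Longrightarrow> s < t \<Longrightarrow> (\<lambda>n. F n s) \<longlonglongrightarrow> G s"
  shows "(\<lambda>n. integral {0..t} (F n)) \<longlonglongrightarrow> integral {0..t} G"
proof -
  have "(\<lambda>n. integral {0<..<t} (F n)) \<longlonglongrightarrow> integral {0<..<t} G"
  proof (rule dominated_convergence(2)[where h="\<lambda>s. C * (1 / sqrt (t - s))"])
    show "F n integrable_on {0<..<t}" for n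
      using integrable_continuous_real[OF c] by (simp add: integrable_on_open_interval_real)
    have "(\<lambda>s. C * (1 / sqrt (t - s))) integrable_on {0..t}"
      using has_integral_mult_right[OF has_integral_inverse_sqrt_diff[OF t], of C] by blast
    then show "(\<lambda>s. C * (1 / sqrt (t - s))) integrable_on {0<..<t}"
      by (simp add: integrable_on_open_interval_real)
  qed (use b l in auto)
  then show ?thesis by (simp add: integral_open_interval_real)
qed

lemma integral_limit_bounded:
  fixes F :: "nat \<Rightarrow> real \<Rightarrow> complex"
  assumes c: "\<And>n. continuous_on {0..t} (F n)"
    and b: "\<And>n s. s \<in> {0..t} \<Longrightarrow> norm (F n s) \<le> C"
    and l: "\<And>s. s \<in> {0..t} \<Longrightarrow> (\<lambda>n. F n s) \<longlonglongrightarrow> G s"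
  shows "(\<lambda>n. integral {0..t} (F n)) \<longlonglongrightarrow> integral {0..t} G"
  by (rule dominated_convergence(2)[where h="\<lambda>s. C"])
    (use b l integrable_continuous_real[OF c] in auto)

lemma continuous_on_nested1:
  fixes K :: "real \<Rightarrow> complex"
  assumes c: "continuous_on {0..} c" and K: "continuous_on UNIV K"
  shows "continuous_on {0..} (\<lambda>s. integral {0..s} (\<lambda>r. c r * K (\<tau> - r)))"
proof -
  have "continuous_on (UNIV \<times> {0..}) (\<lambda>(x::real,r). c r * K (\<tau> - r))"
    unfolding split_beta
    by (intro continuous_intros continuous_on_snd_time c continuous_on_compose2[OF K]) auto
  from continuous_on_slice[OF continuous_on_integral_upto[OF this], of 0] show ?thesis by simp
qed

lemma continuous_on_nested2:
  fixes K :: "real \<Rightarrow> complex"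
  assumes b: "continuous_on {0..} b" and c: "continuous_on {0..} c" and K: "continuous_on UNIV K"
  shows "continuous_on {0..} (\<lambda>r. integral {0..r} (\<lambda>v. c v * K (\<rho> + r - v)))"
    and "continuous_on {0..} (\<lambda>s. integral {0..s} (\<lambda>r. b r * integral {0..r} (\<lambda>v. c v * K (\<tau> - s + r - v))))"
proof -
  have "continuous_on ((UNIV \<times> {0..}) \<times> {0..}) (\<lambda>(z::real \<times> real,v). c v * K (\<tau> - fst z + snd z - v))" for \<tau>
    unfolding split_beta
    by (intro continuous_intros continuous_on_snd_time c continuous_on_compose2[OF K]) auto
  note * = continuous_on_integral_upto[OF this]
  have 2: "continuous_on (UNIV \<times> {0..}) (\<lambda>z. integral {0..snd z} (\<lambda>v. c v * K (\<tau> - fst z + snd z - v)))" for \<tau>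
    by (rule continuous_on_compose2[OF *, of _ "\<lambda>z. (z, snd z)", simplified])
      (auto intro!: continuous_intros)
  show "continuous_on {0..} (\<lambda>r. integral {0..r} (\<lambda>v. c v * K (\<rho> + r - v)))"
    using time_slice[OF 2[of \<rho>], of 0] by simp
  have "continuous_on (UNIV \<times> {0..}) (\<lambda>(s,r). b r * integral {0..r} (\<lambda>v. c v * K (\<tau> - s + r - v)))"
    unfolding split_beta by (intro continuous_intros continuous_on_snd_time b 2)
  note 3 = continuous_on_integral_upto[OF this]
  show "continuous_on {0..} (\<lambda>s. integral {0..s} (\<lambda>r. b r * integral {0..r} (\<lambda>v. c v * K (\<tau> - s + r - v))))"
    \<comment> \<open>The outer variable is both a parameter of the integrand and the upper limit.
      Continuity is proved for two independent variables and then restricted to the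
      diagonal.\<close>
    by (rule continuous_on_compose2[OF 3, of _ "\<lambda>s. (s, s)", simplified])
      (auto intro!: continuous_intros)
qed

lemma kernel_limit1:
  fixes K :: "nat \<Rightarrow> real \<Rightarrow> complex"
  assumes K: "\<And>n. continuous_on UNIV (K n)"
    and b: "\<And>n \<sigma>. \<sigma> > 0 \<Longrightarrow> norm (K n \<sigma>) \<le> M / sqrt \<sigma>"
    and l: "\<And>\<sigma>. \<sigma> > 0 \<Longrightarrow> (\<lambda>n. K n \<sigma>) \<longlonglongrightarrow> L \<sigma>"
    and f: "continuous_on {0..} f" and t: "t \<ge> 0"
  shows "(\<lambda>n. integral {0..t} (\<lambda>s. f s * K n (t - s))) \<longlonglongrightarrow> integral {0..t} (\<lambda>s. f s * L (t - s))"
proof -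
  obtain C where C: "C \<ge> 0" "\<And>s. s \<in> {0..t} \<Longrightarrow> norm (f s) \<le> C"
    using continuous_bound_upto[OF f] by blast
  show ?thesis
  proof (rule integral_limit_sqrt_dominated[OF t])
    show "continuous_on {0..t} (\<lambda>s. f s * K n (t - s))" for n
      by (intro continuous_intros continuous_on_subset[OF f] continuous_on_compose2[OF K]) auto
    show "norm (f s * K n (t - s)) \<le> (C * M) / sqrt (t - s)" if "0 \<le> s" "s < t" for n s
    proof -
      have "norm (f s * K n (t - s)) \<le> C * (M / sqrt (t - s))"
        unfolding norm_mult using that C b[of "t - s" n] by (intro mult_mono) auto
      then show ?thesis by simp
    qed
  qed (auto intro!: tendsto_intros l)
qed

text \<open>For \<open>r \<le> s\<close> the lag \<open>t - r\<close> is at least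
  \<open>t - s\<close>, so the inner integral is at most a multiple of
  \<open>1 / sqrt (t - s)\<close>. That bound serves both to dominate the inner limit at fixed
  \<open>s\<close> and to dominate in \<open>s\<close>.\<close>

lemma kernel_limit2:
  fixes K :: "nat \<Rightarrow> real \<Rightarrow> complex"
  assumes K: "\<And>n. continuous_on UNIV (K n)"
    and b: "\<And>n \<sigma>. \<sigma> > 0 \<Longrightarrow> norm (K n \<sigma>) \<le> M / sqrt \<sigma>" and M: "M \<ge> 0"
    and l: "\<And>\<sigma>. \<sigma> > 0 \<Longrightarrow> (\<lambda>n. K n \<sigma>) \<longlonglongrightarrow> L \<sigma>"
    and a: "continuous_on {0..} a" and f: "continuous_on {0..} f" and t: "t \<ge> 0"
  shows "(\<lambda>n. integral {0..t} (\<lambda>s. a s * integral {0..s} (\<lambda>r. f r * K n (t - r)))) \<longlonglongrightarrow>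
    integral {0..t} (\<lambda>s. a s * integral {0..s} (\<lambda>r. f r * L (t - r)))"
proof -
  obtain C where C: "C \<ge> 0" "\<And>s. s \<in> {0..t} \<Longrightarrow> norm (f s) \<le> C"
    using continuous_bound_upto[OF f] by blast
  obtain A where A: "A \<ge> 0" "\<And>s. s \<in> {0..t} \<Longrightarrow> norm (a s) \<le> A"
    using continuous_bound_upto[OF a] by blast
  have bd: "norm (f r * K n (t - r)) \<le> C * (M / sqrt (t - s))" if "0 \<le> s" "s < t" "r \<in> {0..s}" for n s r
  proof -
    have "M / sqrt (t - r) \<le> M / sqrt (t - s)"
      using that M by (intro divide_left_mono) auto
    then have "norm (K n (t - r)) \<le> M / sqrt (t - s)"
      using b[of "t - r" n] that by auto
    then show ?thesis
      unfolding norm_mult using that C by (intro mult_mono) auto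
  qed
  have cf: "continuous_on {0..} (\<lambda>r. f r * K n (t - r))" for n
    by (intro continuous_intros f continuous_on_compose2[OF K]) auto
  show ?thesis
  proof (rule integral_limit_sqrt_dominated[OF t])
    show "continuous_on {0..t} (\<lambda>s. a s * integral {0..s} (\<lambda>r. f r * K n (t - r)))" for n
      by (rule continuous_on_subset[of "{0..}"], intro continuous_intros a continuous_on_nested1 f K) auto
    show "norm (a s * integral {0..s} (\<lambda>r. f r * K n (t - r))) \<le> (A * (C * M * t)) / sqrt (t - s)"
      if "0 \<le> s" "s < t" for n s
    proof -
      have "norm (integral {0..s} (\<lambda>r. f r * K n (t - r))) \<le> C * (M / sqrt (t - s)) * t"
        by (rule norm_integral_upto_le[OF cf bd]) (use that C M in auto)
      then have "norm (a s * integral {0..s} (\<lambda>r. f r * K n (t - r))) \<le> A * (C * (M / sqrt (t - s)) * t)"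
        unfolding norm_mult using that A by (intro mult_mono) auto
      then show ?thesis by simp
    qed
    show "(\<lambda>n. a s * integral {0..s} (\<lambda>r. f r * K n (t - r))) \<longlonglongrightarrow> a s * integral {0..s} (\<lambda>r. f r * L (t - r))"
      if "0 \<le> s" "s < t" for s
      by (intro tendsto_mult_left integral_limit_bounded[where C="C * (M / sqrt (t - s))"])
        (use that bd in \<open>auto intro!: continuous_on_subset[OF cf] tendsto_mult_left l\<close>)
  qed
qed

text \<open>The nonintegrable power -3/2 loses one order on integration in \<open>v\<close>, and the
  result is bounded by \<open>2 / sqrt \<rho>\<close> uniformly in \<open>r\<close>. With
  \<open>\<rho> = t - s\<close> this is integrable in the outermost variable.\<close>

lemma integral_inverse_three_halves_le:
  fixes \<rho> r :: real
  assumes "\<rho> > 0" "r \<ge> 0"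
  shows "(\<lambda>v. 1 / (\<rho> + r - v) powr (3/2)) integrable_on {0..r}"
    and "integral {0..r} (\<lambda>v. 1 / (\<rho> + r - v) powr (3/2)) \<le> 2 / sqrt \<rho>"
proof -
  have "((\<lambda>v. 1 / (\<rho> + r - v) powr (3/2)) has_integral
      2 * (\<rho> + r - r) powr (-1/2) - 2 * (\<rho> + r - 0) powr (-1/2)) {0..r}"
  proof (rule fundamental_theorem_of_calculus[OF assms(2)])
    show "((\<lambda>v. 2 * (\<rho> + r - v) powr (-1/2)) has_vector_derivative 1 / (\<rho> + r - v) powr (3/2)) (at v within {0..r})"
      if "v \<in> {0..r}" for v
      unfolding has_real_derivative_iff_has_vector_derivative[symmetric]
      using that assms by (auto intro!: derivative_eq_intros simp: powr_minus_divide[symmetric] minus_divide_left[symmetric])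
  qed
  then have I: "((\<lambda>v. 1 / (\<rho> + r - v) powr (3/2)) has_integral 2 * \<rho> powr (-1/2) - 2 * (\<rho> + r) powr (-1/2)) {0..r}"
    by simp
  then show "(\<lambda>v. 1 / (\<rho> + r - v) powr (3/2)) integrable_on {0..r}" by blast
  have "\<rho> powr (-1/2) = 1 / sqrt \<rho>"
    using assms by (simp add: powr_minus_divide powr_half_sqrt minus_divide_left[symmetric])
  then show "integral {0..r} (\<lambda>v. 1 / (\<rho> + r - v) powr (3/2)) \<le> 2 / sqrt \<rho>"
    using integral_unique[OF I] by simp
qed

text \<open>For \<open>s < t\<close> the lag is at least \<open>\<rho> = t - s > 0\<close>, so the
  inner limits are taken under bounds that are constant for fixed \<open>\<rho>\<close>
  (\<open>bd1'\<close>, \<open>bd3\<close>). Integrating \<open>bd1'\<close> would leave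
  \<open>\<rho>\<close> to the power -3/2, too singular for the outer integral; the sharper
  \<open>bd2\<close> gives \<open>1 / sqrt \<rho>\<close>.\<close>

lemma kernel_limit3:
  fixes K :: "nat \<Rightarrow> real \<Rightarrow> complex"
  assumes K: "\<And>n. continuous_on UNIV (K n)"
    and bK: "\<And>n \<sigma>. \<sigma> > 0 \<Longrightarrow> norm (K n \<sigma>) \<le> M / \<sigma> powr (3/2)" and M: "M \<ge> 0"
    and l: "\<And>\<sigma>. \<sigma> > 0 \<Longrightarrow> (\<lambda>n. K n \<sigma>) \<longlonglongrightarrow> L \<sigma>"
    and a: "continuous_on {0..} a" and b: "continuous_on {0..} b" and c: "continuous_on {0..} c" and t: "t \<ge> 0"
  shows "(\<lambda>n. integral {0..t} (\<lambda>s. a s * integral {0..s} (\<lambda>r. b r * integral {0..r} (\<lambda>v. c v * K n (t - s + r - v))))) \<longlonglongrightarrow>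
    integral {0..t} (\<lambda>s. a s * integral {0..s} (\<lambda>r. b r * integral {0..r} (\<lambda>v. c v * L (t - s + r - v))))"
proof -
  obtain A where A: "A \<ge> 0" "\<And>s. s \<in> {0..t} \<Longrightarrow> norm (a s) \<le> A"
    using continuous_bound_upto[OF a] by blast
  obtain B where B: "B \<ge> 0" "\<And>s. s \<in> {0..t} \<Longrightarrow> norm (b s) \<le> B"
    using continuous_bound_upto[OF b] by blast
  obtain C where C: "C \<ge> 0" "\<And>s. s \<in> {0..t} \<Longrightarrow> norm (c s) \<le> C"
    using continuous_bound_upto[OF c] by blast
  have cc: "continuous_on {0..} (\<lambda>v. c v * K n (\<rho> - v))" for n \<rho>
    by (intro continuous_intros c continuous_on_compose2[OF K]) auto
  have bd1: "norm (c v * K n (\<rho> + r - v)) \<le> C * M * (1 / (\<rho> + r - v) powr (3/2))"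
    if "\<rho> > 0" "r \<in> {0..t}" "v \<in> {0..r}" for n \<rho> r v
  proof -
    have "norm (c v * K n (\<rho> + r - v)) \<le> C * (M / (\<rho> + r - v) powr (3/2))"
      unfolding norm_mult using that C bK[of "\<rho> + r - v" n] by (intro mult_mono) auto
    then show ?thesis by simp
  qed
  have bd1': "norm (c v * K n (\<rho> + r - v)) \<le> C * M * (1 / \<rho> powr (3/2))"
    if "\<rho> > 0" "r \<in> {0..t}" "v \<in> {0..r}" for n \<rho> r v
    by (rule order_trans[OF bd1[OF that]], intro mult_left_mono divide_left_mono powr_mono2)
      (use that C M in auto)
  have bd2: "norm (integral {0..r} (\<lambda>v. c v * K n (\<rho> + r - v))) \<le> C * M * 2 / sqrt \<rho>"
    if "\<rho> > 0" "r \<in> {0..t}" for n \<rho> r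
  proof -
    have r: "r \<ge> 0" using that by simp
    have "(\<lambda>v. C * M * (1 / (\<rho> + r - v) powr (3/2))) integrable_on {0..r}"
      using has_integral_mult_right[OF integrable_integral[OF integral_inverse_three_halves_le(1)[OF that(1) r]]] by blast
    moreover have "(\<lambda>v. c v * K n (\<rho> + r - v)) integrable_on {0..r}"
      by (intro integrable_continuous_real continuous_on_subset[OF cc]) auto
    ultimately have "norm (integral {0..r} (\<lambda>v. c v * K n (\<rho> + r - v))) \<le> integral {0..r} (\<lambda>v. C * M * (1 / (\<rho> + r - v) powr (3/2)))"
      using that bd1 by (intro integral_norm_bound_integral) auto
    also have "\<dots> = C * M * integral {0..r} (\<lambda>v. 1 / (\<rho> + r - v) powr (3/2))"
      by (rule integral_mult_right)
    also have "\<dots> \<le> C * M * (2 / sqrt \<rho>)"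
      using C M by (intro mult_left_mono integral_inverse_three_halves_le(2)[OF that(1) r]) auto
    finally show ?thesis by simp
  qed
  have lim1: "(\<lambda>n. integral {0..r} (\<lambda>v. c v * K n (\<rho> + r - v))) \<longlonglongrightarrow> integral {0..r} (\<lambda>v. c v * L (\<rho> + r - v))"
    if "\<rho> > 0" "r \<in> {0..t}" for \<rho> r
    by (rule integral_limit_bounded[where C="C * M * (1 / \<rho> powr (3/2))"])
      (use that bd1' in \<open>auto intro!: continuous_on_subset[OF cc] tendsto_mult_left l\<close>)
  have cb: "continuous_on {0..} (\<lambda>r. b r * integral {0..r} (\<lambda>v. c v * K n (\<rho> + r - v)))" for n \<rho>
    by (intro continuous_intros b continuous_on_nested2(1)[OF b c K])
  have bd3: "norm (b r * integral {0..r} (\<lambda>v. c v * K n (\<rho> + r - v))) \<le> B * (C * M * 2 / sqrt \<rho>)"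
    if "\<rho> > 0" "r \<in> {0..t}" for n \<rho> r
    unfolding norm_mult using that B bd2 by (intro mult_mono) auto
  show ?thesis
  proof (rule integral_limit_sqrt_dominated[OF t])
    show "continuous_on {0..t} (\<lambda>s. a s * integral {0..s} (\<lambda>r. b r * integral {0..r} (\<lambda>v. c v * K n (t - s + r - v))))" for n
      by (rule continuous_on_subset[of "{0..}"], intro continuous_intros a continuous_on_nested2(2)[OF b c K]) auto
    show "norm (a s * integral {0..s} (\<lambda>r. b r * integral {0..r} (\<lambda>v. c v * K n (t - s + r - v))))
        \<le> (A * (B * (C * M * 2) * t)) / sqrt (t - s)"
      if "0 \<le> s" "s < t" for n s
    proof -
      have "norm (integral {0..s} (\<lambda>r. b r * integral {0..r} (\<lambda>v. c v * K n (t - s + r - v)))) \<le> B * (C * M * 2 / sqrt (t - s)) * t"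
        by (rule norm_integral_upto_le[OF cb bd3]) (use that B C M in auto)
      then have "norm (a s * integral {0..s} (\<lambda>r. b r * integral {0..r} (\<lambda>v. c v * K n (t - s + r - v))))
          \<le> A * (B * (C * M * 2 / sqrt (t - s)) * t)"
        unfolding norm_mult using that A by (intro mult_mono) auto
      then show ?thesis by simp
    qed
    show "(\<lambda>n. a s * integral {0..s} (\<lambda>r. b r * integral {0..r} (\<lambda>v. c v * K n (t - s + r - v)))) \<longlonglongrightarrow>
        a s * integral {0..s} (\<lambda>r. b r * integral {0..r} (\<lambda>v. c v * L (t - s + r - v)))"
      if "0 \<le> s" "s < t" for s
      by (rule tendsto_mult_left, rule integral_limit_bounded[where C="B * (C * M * 2 / sqrt (t - s))"])
        (use that bd3 lim1 in \<open>auto intro!: continuous_on_subset[OF cb] tendsto_mult_left\<close>)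
  qed
qed

definition rot :: complex where "rot = exp (- (\<i> * of_real (pi / 4)))"

lemma rot_cis: "rot = cis (- (pi / 4))"
  by (simp add: rot_def cis_conv_exp)

lemma rot_square: "rot^2 = - \<i>"
  unfolding rot_cis Complex.DeMoivre by (simp add: complex_eq_iff)

text \<open>\<open>rot\<close> is the reciprocal of the principal square root of
  \<open>\<i>\<close>. This is the origin of the factor \<open>exp (- \<i> pi / 4)\<close> in all
  three formulas.\<close>

lemma csqrt_imaginary:
  assumes "\<sigma> > 0" shows "csqrt (\<i> * of_real \<sigma>) = of_real (sqrt \<sigma>) / rot"
proof (rule csqrt_unique)
  show "(of_real (sqrt \<sigma>) / rot)^2 = \<i> * of_real \<sigma>"
    using assms by (simp add: power_divide rot_square divide_simps flip: of_real_power)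
  have "of_real (sqrt \<sigma>) / rot = of_real (sqrt \<sigma>) * cis (pi / 4)"
    unfolding rot_cis divide_inverse cis_inverse by simp
  then show "0 < Re (of_real (sqrt \<sigma>) / rot) \<or>
      Re (of_real (sqrt \<sigma>) / rot) = 0 \<and> 0 \<le> Im (of_real (sqrt \<sigma>) / rot)"
    using assms by (simp add: cos_45)
qed

lemma norm_csqrt_eq: "norm (csqrt z) = sqrt (norm z)"
  by (metis norm_power power2_csqrt norm_ge_zero real_sqrt_unique)

text \<open>The modulus of \<open>d^2 + \<i> * \<sigma>\<close> is at least its imaginary part
  \<open>\<sigma>\<close>, whence bounds uniform in \<open>d\<close>.\<close>

lemma K_bounds:
  assumes "\<sigma> > 0"
  shows "norm (K0 d \<sigma>) \<le> 1 / (2 * sqrt pi) / sqrt \<sigma>"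
    and "norm (K2 d \<sigma>) \<le> 1 / (4 * sqrt pi) / \<sigma> powr (3/2)"
proof -
  define z where "z = of_real (d^2) + \<i> * of_real \<sigma>"
  have z: "norm z \<ge> \<sigma>" using abs_Im_le_cmod[of z] assms by (simp add: z_def)
  then have s: "sqrt (norm z) \<ge> sqrt \<sigma>" by simp
  have "norm (K0 d \<sigma>) = 1 / (2 * sqrt pi) / sqrt (norm z)"
    by (simp add: K0_def norm_divide norm_mult norm_csqrt_eq z_def)
  also have "\<dots> \<le> 1 / (2 * sqrt pi) / sqrt \<sigma>"
    using s z assms by (intro divide_left_mono mult_pos_pos) auto
  finally show "norm (K0 d \<sigma>) \<le> 1 / (2 * sqrt pi) / sqrt \<sigma>" .
  have "norm (K2 d \<sigma>) = 1 / (4 * sqrt pi) / (norm z * sqrt (norm z))"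
    by (simp add: K2_def norm_divide norm_mult norm_csqrt_eq z_def)
  also have "\<dots> \<le> 1 / (4 * sqrt pi) / (\<sigma> * sqrt \<sigma>)"
    using s z assms by (intro divide_left_mono mult_pos_pos mult_mono) auto
  also have "\<sigma> * sqrt \<sigma> = \<sigma> powr (3/2)"
    using assms powr_add[of \<sigma> 1 "1/2"] by (simp add: powr_half_sqrt)
  finally show "norm (K2 d \<sigma>) \<le> 1 / (4 * sqrt pi) / \<sigma> powr (3/2)" .
qed

lemma K_cont:
  assumes "d > 0"
  shows "continuous_on UNIV (K0 d)" "continuous_on UNIV (K2 d)"
proof -
  have z: "of_real (d^2) + \<i> * of_real \<sigma> \<notin> \<real>\<^sub>\<le>\<^sub>0" "of_real (d^2) + \<i> * of_real \<sigma> \<noteq> 0" for \<sigma>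
    using assms by (auto simp: complex_nonpos_Reals_iff complex_eq_iff)
  have "continuous_on UNIV (\<lambda>\<sigma>. csqrt (of_real (d^2) + \<i> * of_real \<sigma>))"
    by (rule continuous_on_compose2[OF continuous_on_csqrt])
      (use z in \<open>auto intro!: continuous_intros\<close>)
  then show "continuous_on UNIV (K0 d)" "continuous_on UNIV (K2 d)"
    unfolding K0_def[abs_def] K2_def[abs_def]
    using z by (auto intro!: continuous_intros)
qed

lemma K_limits:
  assumes d: "d \<longlonglongrightarrow> 0" and \<sigma>: "\<sigma> > 0"
  shows "(\<lambda>n. K0 (d n) \<sigma>) \<longlonglongrightarrow> rot / of_real (2 * sqrt pi) / of_real (sqrt \<sigma>)"
    and "(\<lambda>n. K2 (d n) \<sigma>) \<longlonglongrightarrow> - \<i> * rot / of_real (4 * sqrt pi) / of_real (\<sigma> powr (3/2))"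
proof -
  have r: "rot \<noteq> 0" by (simp add: rot_def)
  have z: "(\<lambda>n. complex_of_real ((d n)^2) + \<i> * of_real \<sigma>) \<longlonglongrightarrow> of_real (0^2) + \<i> * of_real \<sigma>"
    by (intro tendsto_intros d)
  have "isCont csqrt (\<i> * of_real \<sigma>)"
    by (rule continuous_at_csqrt) (use \<sigma> in \<open>auto simp: complex_nonpos_Reals_iff\<close>)
  with z have s: "(\<lambda>n. csqrt (complex_of_real ((d n)^2) + \<i> * of_real \<sigma>)) \<longlonglongrightarrow> csqrt (\<i> * of_real \<sigma>)"
    by (intro isCont_tendsto_compose[of _ csqrt]) auto
  have ne: "\<i> * of_real \<sigma> \<noteq> 0" "csqrt (\<i> * of_real \<sigma>) \<noteq> 0" using \<sigma> by auto
  have "(\<lambda>n. K0 (d n) \<sigma>) \<longlonglongrightarrow> of_real (1 / (2 * sqrt pi)) / csqrt (\<i> * of_real \<sigma>)"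
    unfolding K0_def by (intro tendsto_intros s ne)
  then show "(\<lambda>n. K0 (d n) \<sigma>) \<longlonglongrightarrow> rot / of_real (2 * sqrt pi) / of_real (sqrt \<sigma>)"
    using r by (simp add: csqrt_imaginary[OF \<sigma>])
  have "(\<lambda>n. K2 (d n) \<sigma>) \<longlonglongrightarrow> of_real (1 / (4 * sqrt pi)) / ((of_real (0^2) + \<i> * of_real \<sigma>) * csqrt (\<i> * of_real \<sigma>))"
    unfolding K2_def by (intro tendsto_divide tendsto_mult tendsto_const s z) (use ne in simp)
  also have "of_real (1 / (4 * sqrt pi)) / ((of_real (0^2) + \<i> * of_real \<sigma>) * csqrt (\<i> * of_real \<sigma>)) =
      - \<i> * rot / of_real (4 * sqrt pi) / of_real (\<sigma> * sqrt \<sigma>)"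
    using r \<sigma> by (simp add: csqrt_imaginary[OF \<sigma>] divide_simps)
  also have "\<sigma> * sqrt \<sigma> = \<sigma> powr (3/2)"
    using \<sigma> powr_add[of \<sigma> 1 "1/2"] by (simp add: powr_half_sqrt)
  finally show "(\<lambda>n. K2 (d n) \<sigma>) \<longlonglongrightarrow> - \<i> * rot / of_real (4 * sqrt pi) / of_real (\<sigma> powr (3/2))" .
qed

subsection \<open>Removing the Gaussian regularisation in space\<close>

text \<open>The weight is zero on the negative axis, so a bound by a multiple of \<open>wt\<close>
  also says that a function is extended by zero.\<close>

definition wt :: "real \<Rightarrow> real" where "wt x = indicator {0..} x * (1 / (1 + x)^2)"

lemma wt_integrable: "integrable lborel wt"
  using integrable_inverse_square_tail by (simp add: wt_def[abs_def])

lemma wt_nonneg: "wt x \<ge> 0" and wt_le_1: "wt x \<le> 1"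
  by (auto simp: wt_def indicator_def divide_le_eq one_le_power)

lemma wt_antimono: "0 \<le> x \<Longrightarrow> x \<le> y \<Longrightarrow> wt y \<le> wt x"
  by (auto simp: wt_def indicator_def intro!: divide_left_mono power_mono)

text \<open>The heat kernel at time one, of total mass one: the Fourier transform of
  \<open>gw\<close> in the variable \<open>\<xi> / d\<close>. Its companion \<open>xgauss\<close> is
  \<open>- 2\<close> times its derivative and comes from the extra factor \<open>k\<close>.\<close>

definition gauss :: "real \<Rightarrow> real" where "gauss z = exp (- (z^2) / 4) / (2 * sqrt pi)"
definition xgauss :: "real \<Rightarrow> real" where "xgauss z = z * gauss z"

lemma gw_phase_x: "gw d k * phase k \<xi> 0 =
    of_real (1 / (2 * pi)) * exp (\<i> * of_real (k * \<xi>) - of_real (d^2) * (of_real k)^2)"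
proof -
  have "exp (\<i> * of_real (k * \<xi>) - of_real (d^2) * (of_real k)^2) =
      exp (of_real (- (d^2) * k^2)) * phase k \<xi> 0"
    by (simp add: phase_def algebra_simps flip: exp_add)
  then show ?thesis by (simp add: gw_def exp_of_real[symmetric])
qed

lemma gw_fourier0:
  assumes "d > 0"
  shows "(LINT k|lborel. gw d k * phase k \<xi> 0) = of_real (1 / d * gauss (\<xi> / d))"
proof -
  have "1 / (2 * pi) * (sqrt pi / d * exp (- ((\<xi> / d)^2) / 4)) = 1 / d * gauss (\<xi> / d)"
    by (simp add: gauss_def divide_simps)
  then show ?thesis
    unfolding gw_phase_x integral_mult_right_zero gauss_fourier[OF assms]
    by (simp only: flip: of_real_mult)
qed

lemma gw_fourier1:
  assumes "d > 0"
  shows "(LINT k|lborel. of_real k * gw d k * phase k \<xi> 0) = \<i> * of_real (1 / (2 * d^2) * xgauss (\<xi> / d))"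
proof -
  have "(LINT k|lborel. of_real k * gw d k * phase k \<xi> 0) = of_real (1 / (2 * pi)) *
     (LINT k|lborel. of_real k * exp (\<i> * of_real (k * \<xi>) - of_real (d^2) * (of_real k)^2))"
    unfolding mult.assoc gw_phase_x by (subst mult.left_commute) (rule integral_mult_right_zero)
  also have "\<dots> = of_real (1 / (2 * pi)) * (\<i> * of_real \<xi> / (2 * of_real (d^2)) * of_real (sqrt pi / d * exp (- ((\<xi> / d)^2) / 4)))"
    by (subst gauss_first_moment) (use assms gauss_fourier[OF assms, of \<xi>] in auto)
  also have "\<dots> = \<i> * of_real (1 / (2 * pi) * (\<xi> / (2 * d^2) * (sqrt pi / d * exp (- ((\<xi> / d)^2) / 4))))"
    by simp
  also have "1 / (2 * pi) * (\<xi> / (2 * d^2) * (sqrt pi / d * exp (- ((\<xi> / d)^2) / 4))) = 1 / (2 * d^2) * xgauss (\<xi> / d)"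
    by (simp add: gauss_def xgauss_def divide_simps)
  finally show ?thesis .
qed

lemma gauss_nonneg: "gauss z \<ge> 0" and xgauss_nonneg: "z \<ge> 0 \<Longrightarrow> xgauss z \<ge> 0"
  by (simp_all add: gauss_def xgauss_def)

lemma gauss_measurable [measurable]: "gauss \<in> borel_measurable borel" "xgauss \<in> borel_measurable borel"
  by (simp_all add: gauss_def[abs_def] xgauss_def[abs_def])

text \<open>Only half of the unit mass lies on the half-line. This is the source of the factor 1/2
  in front of the Neumann value.\<close>

lemma gauss_half_integral: "has_bochner_integral lborel (\<lambda>x. indicator {0..} x * gauss x) (1/2)"
proof -
  have "has_bochner_integral lborel (\<lambda>x::real. indicator {0..} x *\<^sub>R exp (- (x^2))) (sqrt pi / 2)"
    by (rule gaussian_moment_0)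
  from lborel_has_bochner_integral_real_affine_iff[THEN iffD1, OF _ this, of "1/2" 0]
  have "has_bochner_integral lborel (\<lambda>x::real. indicator {0..} (x/2) * exp (- ((x/2)^2))) (sqrt pi)"
    by (simp add: mult.commute)
  then have "has_bochner_integral lborel (\<lambda>x::real. (1 / (2 * sqrt pi)) * (indicator {0..} (x/2) * exp (- ((x/2)^2)))) (1 / (2 * sqrt pi) * sqrt pi)"
    by (rule has_bochner_integral_mult_right)
  moreover have "(1 / (2 * sqrt pi)) * (indicator {0..} (x/2) * exp (- ((x/2)^2))) = indicator {0..} x * gauss x" for x
    by (simp add: gauss_def indicator_def power_divide)
  ultimately show ?thesis by simp
qed

text \<open>A bound that factors in \<open>a\<close> and \<open>b\<close>, so that dominated
  convergence can be applied to the two rescaled variables one after the other.\<close>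

lemma xgauss_le:
  assumes "a \<ge> 0" "b \<ge> 0"
  shows "xgauss (a + b) \<le> exp 4 * exp (- a) * exp (- b)"
proof -
  define z where "z = a + b"
  have z: "z \<ge> 0" using assms by (simp add: z_def)
  \<comment> \<open>Completing the square in \<open>2 * z - z^2 / 4\<close>: one \<open>z\<close>
    absorbs the linear prefactor through \<open>z \<le> exp z\<close>, the other is left as decay.
    Hence the constant \<open>exp 4\<close>.\<close>
  have "0 \<le> (z/2 - 2)^2" by simp
  then have "2 * z - z^2/4 \<le> 4" by (simp add: power2_eq_square algebra_simps)
  then have "exp (z + (- (z^2) / 4)) \<le> exp (4 + - z)" by simp
  then have "exp z * exp (- (z^2) / 4) \<le> exp 4 * exp (- z)" by (simp only: exp_add)
  moreover have "z * exp (- (z^2) / 4) \<le> exp z * exp (- (z^2) / 4)"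
  proof (intro mult_right_mono)
    show "z \<le> exp z" using exp_ge_add_one_self[of z] by linarith
  qed simp
  moreover have "xgauss z \<le> z * exp (- (z^2) / 4)"
  proof -
    have "1 \<le> 2 * sqrt pi" using pi_ge_two real_sqrt_ge_one[of pi] by linarith
    then have "exp (- (z^2) / 4) / (2 * sqrt pi) \<le> exp (- (z^2) / 4) / 1"
      by (intro divide_left_mono) auto
    then show ?thesis unfolding xgauss_def gauss_def using z by (intro mult_left_mono) auto
  qed
  ultimately have "xgauss z \<le> exp 4 * exp (- z)" by linarith
  moreover have "exp (- z) = exp (- a) * exp (- b)" by (simp add: z_def flip: exp_add)
  ultimately show ?thesis by (simp add: z_def mult.assoc)
qed

lemma exp_minus_le_inverse_square:
  fixes x :: real
  assumes "x \<ge> 0"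
  shows "exp (- x) \<le> 2 / (1 + x)^2"
proof -
  have "(1 + x)^2 / 2 \<le> 1 + x + x^2/2" by (simp add: power2_eq_square field_simps)
  also have "\<dots> \<le> exp x" by (rule exp_lower_Taylor_quadratic[OF assms])
  finally show ?thesis using assms by (simp add: exp_minus divide_simps)
qed

lemma exp_half_integrable: "integrable lborel (\<lambda>x::real. indicator {0..} x * exp (- x))"
proof (rule Bochner_Integration.integrable_bound[OF integrable_mult_right[OF wt_integrable, of 2]])
  show "AE x in lborel. norm (indicator {0..} x * exp (- x)) \<le> norm (2 * wt x)"
    using exp_minus_le_inverse_square by (auto simp: wt_def indicator_def)
qed auto

lemma xgauss_halfline_integral:
  assumes "a \<ge> 0"
  shows "(LINT b|lborel. indicator {0..} b *\<^sub>R complex_of_real (xgauss (a + b))) = of_real (2 * gauss a)"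
proof (rule integral_halfline_FTC[where C="exp 4 * 2"])
  show "((\<lambda>x. complex_of_real (2 * gauss x)) has_vector_derivative - of_real (xgauss x)) (at x within {0..})" for x
  proof -
    have "((\<lambda>x. 2 * gauss x) has_real_derivative - xgauss x) (at x within {0..})"
      unfolding gauss_def xgauss_def
      by (auto intro!: derivative_eq_intros simp: divide_simps)
    from has_vector_derivative_of_real[OF this] show ?thesis by simp
  qed
  show "continuous_on {0..} (\<lambda>x. complex_of_real (xgauss x))"
    unfolding xgauss_def gauss_def by (intro continuous_intros) auto
  show "norm (complex_of_real (xgauss x)) \<le> exp 4 * 2 / (1 + x)^2" if "x \<ge> 0" for x
  proof -
    have "exp 4 * exp (- x) \<le> exp 4 * (2 / (1 + x)^2)"
      using exp_minus_le_inverse_square[OF that] by (intro mult_left_mono) auto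
    then show ?thesis using xgauss_le[of x 0] xgauss_nonneg[OF that] that by simp
  qed
  show "((\<lambda>x. complex_of_real (2 * gauss x)) \<longlongrightarrow> 0) at_top"
  proof -
    have "((\<lambda>x. 2 * gauss x) \<longlongrightarrow> 0) at_top" unfolding gauss_def by real_asymp
    from tendsto_of_real[OF this] show ?thesis by simp
  qed
qed (use assms in auto)

lemma halfline_swap:
  fixes V m :: "real \<Rightarrow> complex" and F :: "real \<Rightarrow> real \<Rightarrow> complex"
  assumes V: "integrable lborel V" and [measurable]: "m \<in> borel_measurable borel"
    and [measurable]: "(\<lambda>(k,u). F k u) \<in> borel_measurable (borel \<Otimes>\<^sub>M borel)"
    and m: "\<And>u. norm (m u) \<le> C * wt u" and F: "\<And>k u. norm (F k u) \<le> D"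
  shows "(LINT k|lborel. V k * (LINT u|lborel. m u * F k u)) = (LINT u|lborel. m u * (LINT k|lborel. V k * F k u))"
    and "integrable lborel (\<lambda>k. V k * (LINT u|lborel. m u * F k u))"
proof -
  have [measurable]: "V \<in> borel_measurable borel" using borel_measurable_integrable[OF V] by simp
  define f where "f k u = V k * (m u * F k u)" for k u
  have f: "(\<lambda>(k,u). f k u) \<in> borel_measurable (borel \<Otimes>\<^sub>M borel)" unfolding f_def by measurable
  have D: "D \<ge> 0" using order_trans[OF norm_ge_zero F] by blast
  have w: "integrable lborel (\<lambda>u. C * D * wt u)" by (intro integrable_mult_right wt_integrable)
  have b: "norm (f k u) \<le> norm (V k) * (C * D * wt u)" for k u
  proof -
    have "norm (m u) * norm (F k u) \<le> C * wt u * D"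
      by (intro mult_mono m F order_trans[OF norm_ge_zero m]) auto
    then show ?thesis unfolding f_def norm_mult by (intro mult_left_mono) (auto simp: mult_ac)
  qed
  note * = lborel_swap_dominated[OF f integrable_norm[OF V] w b]
  have 1: "(LINT u|lborel. f k u) = V k * (LINT u|lborel. m u * F k u)" for k
    unfolding f_def by (rule integral_mult_right_zero)
  have 2: "(LINT k|lborel. f k u) = m u * (LINT k|lborel. V k * F k u)" for u
    unfolding f_def by (subst mult.left_commute) (rule integral_mult_right_zero)
  show "(LINT k|lborel. V k * (LINT u|lborel. m u * F k u)) = (LINT u|lborel. m u * (LINT k|lborel. V k * F k u))"
    using *(1) by (simp only: 1 2)
  show "integrable lborel (\<lambda>k. V k * (LINT u|lborel. m u * F k u))"
    using *(2) by (simp only: 1)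
qed

lemma cnj_measurable [measurable (raw)]:
  "f \<in> borel_measurable M \<Longrightarrow> (\<lambda>x. cnj (f x)) \<in> borel_measurable M"
  by (rule borel_measurable_continuous_on[of cnj]) (auto intro!: continuous_intros)

lemma phase_measurable [measurable (raw)]:
  assumes [measurable]: "f \<in> borel_measurable M" "h \<in> borel_measurable M" "r \<in> borel_measurable M"
  shows "(\<lambda>x. phase (f x) (h x) (r x)) \<in> borel_measurable M"
  unfolding phase_def by measurable

lemma norm_integral_le_wt:
  fixes m F :: "real \<Rightarrow> complex"
  assumes "\<And>v. norm (m v) \<le> C * wt v" "\<And>v. norm (F v) \<le> D"
  shows "norm (LINT v|lborel. m v * F v) \<le> C * D * (LINT v|lborel. wt v)"
proof -
  have "norm (LINT v|lborel. m v * F v) \<le> (LINT v|lborel. C * D * wt v)"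
  proof (rule order_trans[OF integral_norm_bound], rule integral_mono')
    show "integrable lborel (\<lambda>v. C * D * wt v)" by (intro integrable_mult_right wt_integrable)
    have "norm (m v) * norm (F v) \<le> C * wt v * D" for v
      by (intro mult_mono assms order_trans[OF norm_ge_zero assms(1)]) auto
    then show le: "norm (m v * F v) \<le> C * D * wt v" for v
      by (auto simp: norm_mult mult_ac)
    show "0 \<le> C * D * wt v" for v using order_trans[OF norm_ge_zero le] .
  qed
  then show ?thesis by simp
qed

lemma phase_add: "phase k u 0 * phase k v 0 = phase k (u + v) 0"
  by (simp add: phase_def algebra_simps flip: exp_add)

text \<open>Models a time slice extended by zero. Continuity is on the closed half-line only, since
  the extension may jump at the origin; limits at 0 are one-sided.\<close>

locale profile =
  fixes Q :: "real \<Rightarrow> complex" and C :: real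
  assumes Qm [measurable]: "Q \<in> borel_measurable borel"
    and Qb: "\<And>x. norm (Q x) \<le> C * wt x"
    and Qc: "continuous_on {0..} Q"
begin

lemma C0: "C \<ge> 0"
proof -
  have "norm (Q 0) \<le> C" using Qb[of 0] by (simp add: wt_def)
  then show ?thesis using norm_ge_zero order_trans by blast
qed

lemma Qb': "norm (Q x) \<le> C"
  using mult_left_mono[OF wt_le_1[of x] C0] Qb[of x] by simp

lemma Q_tendsto:
  assumes "\<And>n. xs n \<ge> 0" "xs \<longlonglongrightarrow> x" "x \<ge> 0"
  shows "(\<lambda>n. Q (xs n)) \<longlonglongrightarrow> Q x"
  using Qc assms by (auto simp: continuous_on_sequentially o_def)

lemma linear_fourier:
  assumes "d > 0"
  shows "(LINT k|lborel. gw d k * (LINT u|lborel. Q u * phase k u 0)) = (LINT a|lborel. Q (d * a) * of_real (gauss a))"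
    and "integrable lborel (\<lambda>k. gw d k * (LINT u|lborel. Q u * phase k u 0))"
proof -
  have V: "integrable lborel (gw d)" using gw_integrable[OF assms, of 0] by simp
  have F: "(\<lambda>(k,u). phase k u 0) \<in> borel_measurable (borel \<Otimes>\<^sub>M borel)"
    unfolding phase_def by measurable
  note * = halfline_swap[OF V Qm F Qb, of 1]
  show "integrable lborel (\<lambda>k. gw d k * (LINT u|lborel. Q u * phase k u 0))"
    by (rule *) simp
  have "(LINT k|lborel. gw d k * (LINT u|lborel. Q u * phase k u 0)) = (LINT u|lborel. Q u * of_real (1 / d * gauss (u / d)))"
    by (subst *(1)) (simp_all add: gw_fourier0[OF assms])
  also have "\<dots> = \<bar>d\<bar> *\<^sub>R (LINT a|lborel. Q (0 + d * a) * of_real (1 / d * gauss ((0 + d * a) / d)))"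
    by (rule lborel_integral_real_affine) (use assms in simp)
  also have "\<dots> = (LINT a|lborel. d *\<^sub>R (Q (d * a) * of_real (1 / d * gauss a)))"
    using assms by simp
  also have "\<dots> = (LINT a|lborel. Q (d * a) * of_real (gauss a))"
    using assms by (simp add: scaleR_conv_of_real mult.left_commute)
  finally show "(LINT k|lborel. gw d k * (LINT u|lborel. Q u * phase k u 0)) = (LINT a|lborel. Q (d * a) * of_real (gauss a))" .
qed

text \<open>In the variable \<open>a = u / d\<close> the weight is an approximate identity centred
  at the endpoint of the half-line, and therefore returns half of the one-sided value at 0.\<close>

lemma linear_limit:
  assumes d: "\<And>n. d n > 0" "d \<longlonglongrightarrow> 0"
  shows "(\<lambda>n. LINT k|lborel. gw (d n) k * (LINT u|lborel. Q u * phase k u 0)) \<longlonglongrightarrow> Q 0 / 2"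
proof -
  note G = gauss_half_integral
  have "(\<lambda>n. LINT a|lborel. Q (d n * a) * of_real (gauss a)) \<longlonglongrightarrow>
      (LINT a|lborel. Q 0 * of_real (indicator {0..} a * gauss a))"
  proof (rule integral_dominated_convergence[where w="\<lambda>a. C * (indicator {0..} a * gauss a)"])
    show "integrable lborel (\<lambda>a. C * (indicator {0..} a * gauss a))"
      using G by (intro integrable_mult_right) (auto simp: has_bochner_integral_iff)
    have z: "Q (d n * a) = 0" if "a < 0" for n a
      using Qb[of "d n * a"] that d(1)[of n] by (simp add: wt_def indicator_def zero_le_mult_iff)
    show "AE a in lborel. (\<lambda>n. Q (d n * a) * of_real (gauss a)) \<longlonglongrightarrow> Q 0 * of_real (indicator {0..} a * gauss a)"
    proof (rule AE_I2)
      fix a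
      show "(\<lambda>n. Q (d n * a) * of_real (gauss a)) \<longlonglongrightarrow> Q 0 * of_real (indicator {0..} a * gauss a)"
      proof (cases "a \<ge> 0")
        case True
        have "(\<lambda>n. Q (d n * a)) \<longlonglongrightarrow> Q 0"
          by (rule Q_tendsto) (use True d(2) less_imp_le[OF d(1)] in \<open>auto intro!: tendsto_eq_intros\<close>)
        then show ?thesis using True by (auto intro!: tendsto_intros)
      qed (use z in auto)
    qed
    show "AE a in lborel. norm (Q (d n * a) * of_real (gauss a)) \<le> C * (indicator {0..} a * gauss a)" for n
    proof (rule AE_I2)
      fix a
      show "norm (Q (d n * a) * of_real (gauss a)) \<le> C * (indicator {0..} a * gauss a)"
      proof (cases "a \<ge> 0")
        case True
        then show ?thesis using Qb'[of "d n * a"] gauss_nonneg[of a]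
          by (simp add: norm_mult mult_right_mono)
      qed (use z in auto)
    qed
  qed auto
  also have "(LINT a|lborel. Q 0 * of_real (indicator {0..} a * gauss a)) = Q 0 * of_real (1/2)"
    using has_bochner_integral_integral_eq[OF G] by (simp only: integral_mult_right_zero integral_complex_of_real)
  finally show ?thesis by (simp add: linear_fourier(1)[OF d(1)])
qed

text \<open>The tails are parametrised by gaps: \<open>u\<close>, \<open>u + p\<close> and
  \<open>u + p + v\<close> are the positions of \<open>Q\<close>, \<open>cnj Q\<close> and
  \<open>Q\<close>. Their alternating phases add up to \<open>k * (u + v)\<close>, so
  \<open>p\<close> drops out of the exponent and \<open>inner1\<close> needs no phase in
  \<open>p\<close>.\<close>

definition inner2 :: "real \<Rightarrow> real \<Rightarrow> real \<Rightarrow> complex" where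
  "inner2 k u p = (LINT v|lborel. indicator {0..} v *\<^sub>R Q (u + p + v) * phase k v 0)"

definition inner1 :: "real \<Rightarrow> real \<Rightarrow> complex" where
  "inner1 k u = (LINT p|lborel. indicator {0..} p *\<^sub>R cnj (Q (u + p)) * inner2 k u p)"

lemma shifted_bound:
  assumes "x \<ge> 0" shows "norm (indicator {0..} v *\<^sub>R Q (x + v)) \<le> C * wt v"
proof (cases "v \<ge> 0")
  case True
  then have "C * wt (x + v) \<le> C * wt v"
    using assms C0 by (intro mult_left_mono wt_antimono) auto
  then show ?thesis using True Qb[of "x + v"] by simp
qed (use C0 in \<open>simp add: wt_def\<close>)

lemma inner2_measurable [measurable (raw)]:
  assumes [measurable]: "f \<in> borel_measurable M" "h \<in> borel_measurable M" "r \<in> borel_measurable M"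
  shows "(\<lambda>x. inner2 (f x) (h x) (r x)) \<in> borel_measurable M"
  unfolding inner2_def by measurable

lemma inner1_measurable [measurable (raw)]:
  assumes [measurable]: "f \<in> borel_measurable M" "h \<in> borel_measurable M"
  shows "(\<lambda>x. inner1 (f x) (h x)) \<in> borel_measurable M"
  unfolding inner1_def by measurable

lemma Q_neg: "x < 0 \<Longrightarrow> Q x = 0"
  using Qb[of x] by (simp add: wt_def)

lemma cnj_shifted_bound: "x \<ge> 0 \<Longrightarrow> norm (indicator {0..} v *\<^sub>R cnj (Q (x + v))) \<le> C * wt v"
  using shifted_bound[of x v] by simp

lemma inner2_bound:
  assumes "u \<ge> 0" "p \<ge> 0"
  shows "norm (inner2 k u p) \<le> C * 1 * (LINT v|lborel. wt v)"
  unfolding inner2_def by (rule norm_integral_le_wt[OF shifted_bound]) (use assms in auto)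

text \<open>The indicator is repeated on the second factor because the bound on
  \<open>inner2\<close> holds for nonnegative \<open>p\<close>, while the domination lemmas ask for
  a bound on the whole line.\<close>

lemma inner1_alt:
  "inner1 k u = (LINT p|lborel. (indicator {0..} p *\<^sub>R cnj (Q (u + p))) * (indicator {0..} p *\<^sub>R inner2 k u p))"
  unfolding inner1_def by (rule Bochner_Integration.integral_cong) (auto simp: indicator_def)

lemma inner1_bound:
  assumes "u \<ge> 0"
  shows "norm (inner1 k u) \<le> C * (C * 1 * (LINT v|lborel. wt v)) * (LINT v|lborel. wt v)"
  unfolding inner1_alt
proof (rule norm_integral_le_wt)
  show "norm (indicator {0..} p *\<^sub>R inner2 k u p) \<le> C * 1 * (LINT v|lborel. wt v)" for p
    using inner2_bound[OF assms, of p k] C0 by (auto simp: indicator_def wt_nonneg)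
qed (use cnj_shifted_bound[OF assms] in auto)

context
  fixes V N :: "real \<Rightarrow> complex"
  assumes V: "integrable lborel V" and N: "\<And>\<xi>. (LINT k|lborel. V k * phase k \<xi> 0) = N \<xi>"
begin

text \<open>Innermost of three exchanges, one for each of \<open>v\<close>, \<open>p\<close>,
  \<open>u\<close>. Here the two remaining phases merge, so that the transform \<open>N\<close> of
  the weight is evaluated at \<open>u + v\<close>.\<close>

lemma gauss_swap3:
  assumes "u \<ge> 0" "p \<ge> 0"
  shows "(LINT k|lborel. V k * (phase k u 0 * inner2 k u p)) =
    (LINT v|lborel. indicator {0..} v *\<^sub>R Q (u + p + v) * N (u + v))"
proof -
  have eq: "phase k u 0 * inner2 k u p = (LINT v|lborel. indicator {0..} v *\<^sub>R Q (u + p + v) * phase k (u + v) 0)" for k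
    unfolding inner2_def phase_add[symmetric]
    by (subst integral_mult_right_zero[symmetric]) (simp add: mult_ac)
  have "(LINT k|lborel. V k * (phase k u 0 * inner2 k u p)) =
    (LINT v|lborel. indicator {0..} v *\<^sub>R Q (u + p + v) * (LINT k|lborel. V k * phase k (u + v) 0))"
    unfolding eq
    by (rule halfline_swap(1)[OF V, where D=1 and C=C]) (use shifted_bound[of "u + p"] assms in auto)
  then show ?thesis by (simp add: N)
qed

lemma gauss_swap2:
  assumes "u \<ge> 0"
  shows "(LINT k|lborel. V k * (phase k u 0 * inner1 k u)) =
    (LINT p|lborel. indicator {0..} p *\<^sub>R cnj (Q (u + p)) *
      (LINT v|lborel. indicator {0..} v *\<^sub>R Q (u + p + v) * N (u + v)))"
proof -
  have eq: "phase k u 0 * inner1 k u = (LINT p|lborel. (indicator {0..} p *\<^sub>R cnj (Q (u + p))) *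
      (indicator {0..} p *\<^sub>R (phase k u 0 * inner2 k u p)))" for k
    unfolding inner1_alt by (subst integral_mult_right_zero[symmetric]) (simp add: mult_ac)
  have "(LINT k|lborel. V k * (phase k u 0 * inner1 k u)) =
    (LINT p|lborel. (indicator {0..} p *\<^sub>R cnj (Q (u + p))) *
      (LINT k|lborel. V k * (indicator {0..} p *\<^sub>R (phase k u 0 * inner2 k u p))))"
    unfolding eq
  proof (rule halfline_swap(1)[OF V])
    show "norm (indicator {0..} p *\<^sub>R (phase k u 0 * inner2 k u p)) \<le> C * 1 * (LINT v|lborel. wt v)" for k p
      using inner2_bound[OF assms, of p k] C0 by (auto simp: indicator_def norm_mult wt_nonneg)
  qed (use cnj_shifted_bound[OF assms] in measurable)
  also have "\<dots> = (LINT p|lborel. indicator {0..} p *\<^sub>R cnj (Q (u + p)) *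
      (LINT v|lborel. indicator {0..} v *\<^sub>R Q (u + p + v) * N (u + v)))"
    by (rule Bochner_Integration.integral_cong) (auto simp: indicator_def gauss_swap3[OF assms, simplified])
  finally show ?thesis .
qed

lemma gauss_swap1:
  shows "(LINT k|lborel. V k * (LINT u|lborel. Q u * (phase k u 0 * inner1 k u))) =
    (LINT u|lborel. Q u * (LINT p|lborel. indicator {0..} p *\<^sub>R cnj (Q (u + p)) *
      (LINT v|lborel. indicator {0..} v *\<^sub>R Q (u + p + v) * N (u + v))))"
    and "integrable lborel (\<lambda>k. V k * (LINT u|lborel. Q u * (phase k u 0 * inner1 k u)))"
proof -
  have eq: "Q u * (phase k u 0 * inner1 k u) = Q u * (indicator {0..} u *\<^sub>R (phase k u 0 * inner1 k u))" for u k
    by (cases "u \<ge> 0") (auto simp: Q_neg)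
  have b: "norm (indicator {0..} u *\<^sub>R (phase k u 0 * inner1 k u)) \<le>
       C * (C * 1 * (LINT v|lborel. wt v)) * (LINT v|lborel. wt v)" for k u
    using inner1_bound[of u k] C0 by (auto simp: indicator_def norm_mult wt_nonneg)
  have m: "(\<lambda>(k,u). indicator {0..} u *\<^sub>R (phase k u 0 * inner1 k u)) \<in> borel_measurable (borel \<Otimes>\<^sub>M borel)"
    by measurable
  note * = halfline_swap[OF V Qm m Qb b]
  show "integrable lborel (\<lambda>k. V k * (LINT u|lborel. Q u * (phase k u 0 * inner1 k u)))"
    unfolding eq by (rule *(2))
  have "Q u * (LINT k|lborel. V k * (indicator {0..} u *\<^sub>R (phase k u 0 * inner1 k u))) =
     Q u * (LINT p|lborel. indicator {0..} p *\<^sub>R cnj (Q (u + p)) *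
      (LINT v|lborel. indicator {0..} v *\<^sub>R Q (u + p + v) * N (u + v)))" for u
    by (cases "u \<ge> 0") (auto simp: Q_neg gauss_swap2)
  then show "(LINT k|lborel. V k * (LINT u|lborel. Q u * (phase k u 0 * inner1 k u))) =
    (LINT u|lborel. Q u * (LINT p|lborel. indicator {0..} p *\<^sub>R cnj (Q (u + p)) *
      (LINT v|lborel. indicator {0..} v *\<^sub>R Q (u + p + v) * N (u + v))))"
    unfolding eq *(1) by simp
qed

end

text \<open>The variables carrying phase are measured in units of \<open>d\<close>, as
  \<open>u = d * a\<close> and \<open>v = d * b\<close>; the gap \<open>p\<close> keeps its
  size.\<close>

definition scaled3 :: "real \<Rightarrow> real \<Rightarrow> real \<Rightarrow> complex" where
  "scaled3 d a p = (LINT b|lborel. indicator {0..} b *\<^sub>R Q (d * a + p + d * b) * of_real (xgauss (a + b)))"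

definition scaled2 :: "real \<Rightarrow> real \<Rightarrow> complex" where
  "scaled2 d a = (LINT p|lborel. indicator {0..} p *\<^sub>R cnj (Q (d * a + p)) * scaled3 d a p)"

lemma scaled3_measurable [measurable (raw)]:
  assumes [measurable]: "f \<in> borel_measurable M" "h \<in> borel_measurable M"
  shows "(\<lambda>x. scaled3 d (f x) (h x)) \<in> borel_measurable M"
  unfolding scaled3_def by measurable

lemma scaled2_measurable [measurable (raw)]:
  assumes [measurable]: "f \<in> borel_measurable M"
  shows "(\<lambda>x. scaled2 d (f x)) \<in> borel_measurable M"
  unfolding scaled2_def by measurable

text \<open>The Jacobians of the two rescalings give \<open>d * d\<close> and cancel the
  \<open>1 / d^2\<close> of \<open>gw_fourier1\<close>, leaving \<open>\<i> / 2\<close> and an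
  expression with a finite limit.\<close>

lemma triple_fourier:
  assumes d: "d > 0"
  shows "(LINT k|lborel. of_real k * gw d k * (LINT u|lborel. Q u * (phase k u 0 * inner1 k u))) =
    \<i> / 2 * (LINT a|lborel. Q (d * a) * scaled2 d a)"
    and "integrable lborel (\<lambda>k. of_real k * gw d k * (LINT u|lborel. Q u * (phase k u 0 * inner1 k u)))"
proof -
  have V: "integrable lborel (\<lambda>k. of_real k * gw d k)" using gw_integrable[OF d, of 1] by simp
  note N = gw_fourier1[OF d]
  show "integrable lborel (\<lambda>k. of_real k * gw d k * (LINT u|lborel. Q u * (phase k u 0 * inner1 k u)))"
    by (rule gauss_swap1(2)[OF V N])
  have 3: "(LINT v|lborel. indicator {0..} v *\<^sub>R Q (d * a + p + v) * (\<i> * of_real (1 / (2 * d^2) * xgauss ((d * a + v) / d)))) =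
      \<i> / of_real (2 * d) * scaled3 d a p" for a p
  proof -
    have "(LINT v|lborel. indicator {0..} v *\<^sub>R Q (d * a + p + v) * (\<i> * of_real (1 / (2 * d^2) * xgauss ((d * a + v) / d)))) =
      \<bar>d\<bar> *\<^sub>R (LINT b|lborel. indicator {0..} (0 + d * b) *\<^sub>R Q (d * a + p + (0 + d * b)) *
        (\<i> * of_real (1 / (2 * d^2) * xgauss ((d * a + (0 + d * b)) / d))))"
      by (rule lborel_integral_real_affine) (use d in simp)
    also have "\<dots> = of_real d * (LINT b|lborel. \<i> * of_real (1 / (2 * d^2)) * (indicator {0..} b *\<^sub>R Q (d * a + p + d * b) * of_real (xgauss (a + b))))"
    proof -
      have "indicator {0..} (0 + d * b) *\<^sub>R Q (d * a + p + (0 + d * b)) *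
        (\<i> * of_real (1 / (2 * d^2) * xgauss ((d * a + (0 + d * b)) / d))) =
        \<i> * of_real (1 / (2 * d^2)) * (indicator {0..} b *\<^sub>R Q (d * a + p + d * b) * of_real (xgauss (a + b)))" for b
      proof -
        have "indicator {0..} (0 + d * b) = (indicator {0..} b :: real)"
          using d by (auto simp: indicator_def zero_le_mult_iff)
        moreover have "(d * a + (0 + d * b)) / d = a + b" using d by (simp add: field_simps)
        ultimately show ?thesis by (simp add: scaleR_conv_of_real mult_ac)
      qed
      then show ?thesis using d by (simp only: scaleR_conv_of_real abs_of_pos)
    qed
    also have "\<dots> = of_real d * (\<i> * of_real (1 / (2 * d^2))) * scaled3 d a p"
      unfolding integral_mult_right_zero scaled3_def by (simp add: mult.assoc)
    also have "of_real d * (\<i> * complex_of_real (1 / (2 * d^2))) = \<i> / of_real (2 * d)"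
      using d by (simp add: divide_simps power2_eq_square)
    finally show ?thesis .
  qed
  have 2: "(LINT p|lborel. indicator {0..} p *\<^sub>R cnj (Q (d * a + p)) * (LINT v|lborel. indicator {0..} v *\<^sub>R Q (d * a + p + v) *
       (\<i> * of_real (1 / (2 * d^2) * xgauss ((d * a + v) / d))))) = \<i> / of_real (2 * d) * scaled2 d a" for a
    unfolding 3 scaled2_def by (subst mult.left_commute) (rule integral_mult_right_zero)
  have "(LINT k|lborel. of_real k * gw d k * (LINT u|lborel. Q u * (phase k u 0 * inner1 k u))) =
     (LINT u|lborel. Q u * (LINT p|lborel. indicator {0..} p *\<^sub>R cnj (Q (u + p)) *
      (LINT v|lborel. indicator {0..} v *\<^sub>R Q (u + p + v) * (\<i> * of_real (1 / (2 * d^2) * xgauss ((u + v) / d))))))"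
    by (rule gauss_swap1(1)[OF V N])
  also have "\<dots> = \<bar>d\<bar> *\<^sub>R (LINT a|lborel. Q (0 + d * a) * (LINT p|lborel. indicator {0..} p *\<^sub>R cnj (Q (0 + d * a + p)) *
      (LINT v|lborel. indicator {0..} v *\<^sub>R Q (0 + d * a + p + v) * (\<i> * of_real (1 / (2 * d^2) * xgauss ((0 + d * a + v) / d))))))"
    by (rule lborel_integral_real_affine) (use d in simp)
  also have "\<dots> = of_real d * (LINT a|lborel. \<i> / of_real (2 * d) * (Q (d * a) * scaled2 d a))"
    unfolding add_0 2 using d by (simp add: scaleR_conv_of_real mult.left_commute)
  also have "\<dots> = \<i> / 2 * (LINT a|lborel. Q (d * a) * scaled2 d a)"
    unfolding integral_mult_right_zero using d by simp
  finally show "(LINT k|lborel. of_real k * gw d k * (LINT u|lborel. Q u * (phase k u 0 * inner1 k u))) =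
    \<i> / 2 * (LINT a|lborel. Q (d * a) * scaled2 d a)" .
qed

lemma xgauss_dominated:
  fixes c :: complex
  assumes "a \<ge> 0" "norm c \<le> C"
  shows "norm (indicator {0..} b *\<^sub>R c * of_real (xgauss (a + b))) \<le> C * exp 4 * exp (- a) * (indicator {0..} b * exp (- b))"
proof (cases "b \<ge> 0")
  case True
  have "norm c * xgauss (a + b) \<le> C * (exp 4 * exp (- a) * exp (- b))"
    using assms True xgauss_nonneg[of "a + b"] C0 by (intro mult_mono xgauss_le) auto
  then show ?thesis using True assms xgauss_nonneg[of "a + b"] by (simp add: norm_mult mult_ac)
qed simp

lemma scaled3_bound:
  assumes "a \<ge> 0"
  shows "norm (scaled3 d a p) \<le> C * exp 4 * exp (- a) * (LINT b|lborel. indicator {0..} b * exp (- b))"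
proof -
  have "norm (scaled3 d a p) \<le> (LINT b|lborel. C * exp 4 * exp (- a) * (indicator {0..} b * exp (- b)))"
    unfolding scaled3_def
  proof (rule order_trans[OF integral_norm_bound], rule integral_mono')
    show "integrable lborel (\<lambda>b. C * exp 4 * exp (- a) * (indicator {0..} b * exp (- b)))"
      by (intro integrable_mult_right exp_half_integrable)
    show "0 \<le> C * exp 4 * exp (- a) * (indicator {0..} b * exp (- b))" for b
      using C0 by simp
  qed (rule xgauss_dominated[OF assms Qb'])
  then show ?thesis by simp
qed

definition scaled_const :: real where
  "scaled_const = C * exp 4 * (LINT b|lborel. indicator {0..} b * exp (- b))"

lemma scaled3_bound': "a \<ge> 0 \<Longrightarrow> norm (scaled3 d a p) \<le> scaled_const * exp (- a)"
  using scaled3_bound[of a d p] by (simp add: scaled_const_def mult_ac)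

lemma scaled2_bound:
  assumes "a \<ge> 0" "d > 0"
  shows "norm (scaled2 d a) \<le> C * (scaled_const * exp (- a)) * (LINT v|lborel. wt v)"
  unfolding scaled2_def by (rule norm_integral_le_wt[OF cnj_shifted_bound scaled3_bound']) (use assms in auto)

context
  fixes d :: "nat \<Rightarrow> real"
  assumes d: "\<And>n. d n > 0" "d \<longlonglongrightarrow> 0"
begin

lemma scaled3_limit:
  assumes "a \<ge> 0" "p \<ge> 0"
  shows "(\<lambda>n. scaled3 (d n) a p) \<longlonglongrightarrow> Q p * of_real (2 * gauss a)"
proof -
  have "(\<lambda>n. scaled3 (d n) a p) \<longlonglongrightarrow> (LINT b|lborel. indicator {0..} b *\<^sub>R Q p * of_real (xgauss (a + b)))"
    unfolding scaled3_def
  proof (rule integral_dominated_convergence[where w="\<lambda>b. C * exp 4 * exp (- a) * (indicator {0..} b * exp (- b))"])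
    show "integrable lborel (\<lambda>b. C * exp 4 * exp (- a) * (indicator {0..} b * exp (- b)))"
      by (intro integrable_mult_right exp_half_integrable)
    show "AE b in lborel. norm (indicator {0..} b *\<^sub>R Q (d n * a + p + d n * b) * of_real (xgauss (a + b))) \<le>
       C * exp 4 * exp (- a) * (indicator {0..} b * exp (- b))" for n
      by (intro AE_I2 xgauss_dominated assms Qb')
    show "AE b in lborel. (\<lambda>n. indicator {0..} b *\<^sub>R Q (d n * a + p + d n * b) * of_real (xgauss (a + b))) \<longlonglongrightarrow>
        indicator {0..} b *\<^sub>R Q p * of_real (xgauss (a + b))"
    proof (rule AE_I2)
      fix b
      have "(\<lambda>n. Q (d n * a + p + d n * b)) \<longlonglongrightarrow> Q p" if "b \<ge> 0"
        by (rule Q_tendsto) (use that assms d(2) less_imp_le[OF d(1)] in \<open>auto intro!: tendsto_eq_intros\<close>)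
      then show "(\<lambda>n. indicator {0..} b *\<^sub>R Q (d n * a + p + d n * b) * of_real (xgauss (a + b))) \<longlonglongrightarrow>
          indicator {0..} b *\<^sub>R Q p * of_real (xgauss (a + b))"
        by (cases "b \<ge> 0") (auto intro!: tendsto_intros)
    qed
  qed measurable
  also have "(LINT b|lborel. indicator {0..} b *\<^sub>R Q p * of_real (xgauss (a + b))) =
      (LINT b|lborel. Q p * (indicator {0..} b *\<^sub>R of_real (xgauss (a + b))))"
    by (rule Bochner_Integration.integral_cong) auto
  finally show ?thesis unfolding integral_mult_right_zero xgauss_halfline_integral[OF assms(1)] .
qed

lemma scaled2_limit:
  assumes "a \<ge> 0"
  shows "(\<lambda>n. scaled2 (d n) a) \<longlonglongrightarrow>
    (LINT p|lborel. indicator {0..} p *\<^sub>R (Q p * cnj (Q p))) * of_real (2 * gauss a)"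
proof -
  have "(\<lambda>n. scaled2 (d n) a) \<longlonglongrightarrow> (LINT p|lborel. indicator {0..} p *\<^sub>R cnj (Q p) * (Q p * of_real (2 * gauss a)))"
    unfolding scaled2_def
  proof (rule integral_dominated_convergence[where w="\<lambda>p. C * (scaled_const * exp (- a)) * wt p"])
    show "integrable lborel (\<lambda>p. C * (scaled_const * exp (- a)) * wt p)"
      by (intro integrable_mult_right wt_integrable)
    show "AE p in lborel. norm (indicator {0..} p *\<^sub>R cnj (Q (d n * a + p)) * scaled3 (d n) a p) \<le> C * (scaled_const * exp (- a)) * wt p" for n
    proof (rule AE_I2)
      fix p
      have "d n * a \<ge> 0" using assms less_imp_le[OF d(1)] by simp
      then have "norm (indicator {0..} p *\<^sub>R cnj (Q (d n * a + p))) * norm (scaled3 (d n) a p) \<le> C * wt p * (scaled_const * exp (- a))"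
        using C0 wt_nonneg[of p] by (intro mult_mono cnj_shifted_bound scaled3_bound' assms) auto
      then show "norm (indicator {0..} p *\<^sub>R cnj (Q (d n * a + p)) * scaled3 (d n) a p) \<le> C * (scaled_const * exp (- a)) * wt p"
        unfolding norm_mult by (simp add: mult_ac)
    qed
    show "AE p in lborel. (\<lambda>n. indicator {0..} p *\<^sub>R cnj (Q (d n * a + p)) * scaled3 (d n) a p) \<longlonglongrightarrow>
        indicator {0..} p *\<^sub>R cnj (Q p) * (Q p * of_real (2 * gauss a))"
    proof (rule AE_I2)
      fix p
      have "(\<lambda>n. Q (d n * a + p)) \<longlonglongrightarrow> Q p" if "p \<ge> 0"
        by (rule Q_tendsto) (use that assms d(2) less_imp_le[OF d(1)] in \<open>auto intro!: tendsto_eq_intros\<close>)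
      then show "(\<lambda>n. indicator {0..} p *\<^sub>R cnj (Q (d n * a + p)) * scaled3 (d n) a p) \<longlonglongrightarrow>
          indicator {0..} p *\<^sub>R cnj (Q p) * (Q p * of_real (2 * gauss a))"
        by (cases "p \<ge> 0") (auto intro!: tendsto_intros scaled3_limit[simplified] assms)
    qed
  qed measurable
  also have "(LINT p|lborel. indicator {0..} p *\<^sub>R cnj (Q p) * (Q p * of_real (2 * gauss a))) =
      (LINT p|lborel. (indicator {0..} p *\<^sub>R (Q p * cnj (Q p))) * of_real (2 * gauss a))"
    by (rule Bochner_Integration.integral_cong) (auto simp: mult_ac)
  finally show ?thesis unfolding integral_mult_left_zero .
qed

text \<open>As \<open>d\<close> tends to 0 the outer and inner copies of \<open>Q\<close> collapse
  to \<open>Q 0\<close> and \<open>Q p\<close>, and the gap integral becomes the mass. The integral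
  of \<open>xgauss (a + b)\<close> over the quadrant is 1: integration in \<open>b\<close> gives
  \<open>2 * gauss a\<close>, and \<open>gauss\<close> has half mass.\<close>

lemma triple_limit:
  "(\<lambda>n. LINT k|lborel. of_real k * gw (d n) k * (LINT u|lborel. Q u * (phase k u 0 * inner1 k u))) \<longlonglongrightarrow>
    \<i> / 2 * (Q 0 * (LINT p|lborel. indicator {0..} p *\<^sub>R (Q p * cnj (Q p))))"
proof -
  define J where "J = (LINT p|lborel. indicator {0..} p *\<^sub>R (Q p * cnj (Q p)))"
  define D where "D = C * (C * scaled_const * (LINT v|lborel. wt v))"
  have "(\<lambda>n. LINT a|lborel. Q (d n * a) * scaled2 (d n) a) \<longlonglongrightarrow>
      (LINT a|lborel. (2 * Q 0 * J) * of_real (indicator {0..} a * gauss a))"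
  proof (rule integral_dominated_convergence[where w="\<lambda>a. D * (indicator {0..} a * exp (- a))"])
    show "integrable lborel (\<lambda>a. D * (indicator {0..} a * exp (- a)))"
      by (intro integrable_mult_right exp_half_integrable)
    have z: "Q (d n * a) = 0" if "a < 0" for n a
      using Q_neg[of "d n * a"] that d(1)[of n] by (simp add: mult_pos_neg)
    show "AE a in lborel. norm (Q (d n * a) * scaled2 (d n) a) \<le> D * (indicator {0..} a * exp (- a))" for n
    proof (rule AE_I2)
      fix a
      show "norm (Q (d n * a) * scaled2 (d n) a) \<le> D * (indicator {0..} a * exp (- a))"
      proof (cases "a \<ge> 0")
        case True
        have "norm (Q (d n * a)) * norm (scaled2 (d n) a) \<le> C * (C * (scaled_const * exp (- a)) * (LINT v|lborel. wt v))"
          using C0 by (intro mult_mono Qb' scaled2_bound True d) auto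
        then show ?thesis using True by (simp add: norm_mult D_def mult_ac)
      qed (use z in auto)
    qed
    show "AE a in lborel. (\<lambda>n. Q (d n * a) * scaled2 (d n) a) \<longlonglongrightarrow> (2 * Q 0 * J) * of_real (indicator {0..} a * gauss a)"
    proof (rule AE_I2)
      fix a
      show "(\<lambda>n. Q (d n * a) * scaled2 (d n) a) \<longlonglongrightarrow> (2 * Q 0 * J) * of_real (indicator {0..} a * gauss a)"
      proof (cases "a \<ge> 0")
        case True
        have "(\<lambda>n. Q (d n * a)) \<longlonglongrightarrow> Q 0"
          by (rule Q_tendsto) (use True d(2) less_imp_le[OF d(1)] in \<open>auto intro!: tendsto_eq_intros\<close>)
        from tendsto_mult[OF this scaled2_limit[OF True]] show ?thesis
          using True by (simp add: J_def mult_ac)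
      qed (use z in auto)
    qed
  qed measurable
  also have "(LINT a|lborel. (2 * Q 0 * J) * of_real (indicator {0..} a * gauss a)) = (2 * Q 0 * J) * of_real (1/2)"
    using has_bochner_integral_integral_eq[OF gauss_half_integral]
    by (simp only: integral_mult_right_zero integral_complex_of_real)
  finally have "(\<lambda>n. LINT a|lborel. Q (d n * a) * scaled2 (d n) a) \<longlonglongrightarrow> Q 0 * J" by simp
  then show ?thesis
    unfolding triple_fourier(1)[OF d(1)] J_def[symmetric] by (rule tendsto_mult_left)
qed

end

end

subsection \<open>The Neumann value\<close>

lemma integral_kernel_const:
  fixes f :: "real \<Rightarrow> complex"
  shows "integral S (\<lambda>s. f s * (e / w s)) = e * integral S (\<lambda>s. f s / w s)"
proof -
  have "integral S (\<lambda>s. f s * (e / w s)) = integral S (\<lambda>s. e * (f s / w s))" by (simp add: mult.commute)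
  then show ?thesis by (simp only: integral_mult_right)
qed

lemma integral_pull_const:
  fixes f :: "real \<Rightarrow> complex"
  shows "integral S (\<lambda>s. a s * (e * f s)) = e * integral S (\<lambda>s. a s * f s)"
proof -
  have "integral S (\<lambda>s. a s * (e * f s)) = integral S (\<lambda>s. e * (a s * f s))" by (simp add: mult.left_commute)
  then show ?thesis by (simp only: integral_mult_right)
qed

lemma (in profile) integrable_mult_bounded:
  assumes [measurable]: "F \<in> borel_measurable borel" and F: "\<And>u. u \<ge> 0 \<Longrightarrow> norm (F u) \<le> D"
  shows "integrable lborel (\<lambda>u. Q u * F u :: complex)"
proof (rule Bochner_Integration.integrable_bound[OF integrable_mult_right[OF wt_integrable, of "C * D"]])
  show "AE u in lborel. norm (Q u * F u) \<le> norm (C * D * wt u)"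
  proof (rule AE_I2)
    fix u
    show "norm (Q u * F u) \<le> norm (C * D * wt u)"
    proof (cases "u \<ge> 0")
      case True
      have "norm (Q u) * norm (F u) \<le> C * wt u * D"
        using C0 by (intro mult_mono Qb F True mult_nonneg_nonneg wt_nonneg) auto
      then show ?thesis by (auto simp: norm_mult mult_ac intro: order_trans[OF _ abs_ge_self])
    qed (simp add: Q_neg)
  qed
qed measurable

lemma profile_slice:
  assumes "decaying t f" "continuous_on ({0..} \<times> {0..}) (\<lambda>z. f (fst z) (snd z))" "t \<ge> 0"
  obtains C where "profile (\<lambda>v. indicator {0..} v *\<^sub>R f v t) C"
proof -
  from assms(1,3) obtain M where M: "M \<ge> 0" "\<And>x s. x \<ge> 0 \<Longrightarrow> s \<in> {0..t} \<Longrightarrow> norm (f x s) \<le> M / (1 + x)^2"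
    by (rule decayingE) blast
  have c: "continuous_on {0..} (\<lambda>x. f x t)" by (rule continuous_on_space_slice[OF assms(2,3)])
  have "profile (\<lambda>v. indicator {0..} v *\<^sub>R f v t) M"
  proof
    show "(\<lambda>v. indicator {0..} v *\<^sub>R f v t) \<in> borel_measurable borel"
      by (intro borel_measurable_continuous_on_indicator c) auto
    show "norm (indicator {0..} x *\<^sub>R f x t) \<le> M * wt x" for x
      using M(2)[of x t] assms(3) by (auto simp: indicator_def wt_def)
    show "continuous_on {0..} (\<lambda>v. indicator {0..} v *\<^sub>R f v t)"
      using c by (rule continuous_on_eq) auto
  qed
  then show ?thesis using that by blast
qed

lemma phase_split: "phase k (y + v) t = phase k y t * phase k v 0"
  by (simp add: phase_def algebra_simps flip: exp_add)

lemma phase_split': "phase k y t = phase k 0 t * phase k y 0"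
  by (simp add: phase_def algebra_simps flip: exp_add)

section \<open>Limit kernels and comparison of the two sides\<close>

definition "nest3 K t a b c =
  integral {0..t} (\<lambda>s. a s * integral {0..s} (\<lambda>r. b r * integral {0..r} (\<lambda>v. c v * K (t - s + r - v))))"

definition "L0 \<sigma> = rot / of_real (2 * sqrt pi) / of_real (sqrt \<sigma>)"
definition "L2 \<sigma> = - \<i> * rot / of_real (4 * sqrt pi) / of_real (\<sigma> powr (3/2))"

context schroedinger_pair
begin

definition "Qs t v = indicator {0..} v *\<^sub>R q v t"
definition "Ps t v = indicator {0..} v *\<^sub>R px p v t"

text \<open>The time side of the global relation, multiplied by \<open>- \<i>\<close> so that
  \<open>px p\<close> has coefficient one on the spatial side.\<close>

definition "bulk t k = - \<i> * (of_real k * Z1 k 0 t - \<i> * g3 t * phase k 0 t)"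

text \<open>The time phases of \<open>q\<close>, \<open>cnj q\<close>, \<open>q\<close> multiply to
  a single \<open>phase k 0 t\<close>, the same as for \<open>px p\<close>. Its conjugate removes
  it, and purely spatial transforms of the two profiles remain.\<close>

lemma bulk_eq:
  assumes t: "t \<ge> 0" and Q: "profile (Qs t) C" and P: "profile (Ps t) C'"
  shows "cnj (phase k 0 t) * bulk t k = (LINT u|lborel. Ps t u * phase k u 0) -
    \<i> * of_real lam * of_real k * (LINT u|lborel. Qs t u * (phase k u 0 * profile.inner1 (Qs t) k u))"
proof -
  interpret Q: profile "Qs t" C by (rule Q)
  interpret P: profile "Ps t" C' by (rule P)
  have A: "A1 k y t = phase k y t * (LINT v|lborel. indicator {0..} v *\<^sub>R Qs t (y + v) * phase k v 0)" if "y \<ge> 0" for y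
  proof -
    have "A1 k y t = (LINT v|lborel. phase k y t * (indicator {0..} v *\<^sub>R Qs t (y + v) * phase k v 0))"
      unfolding A1_halfline[OF t that]
      by (rule Bochner_Integration.integral_cong) (use that in \<open>auto simp: Qs_def dn_def phase_split indicator_def\<close>)
    then show ?thesis by (simp only: integral_mult_right_zero)
  qed
  have B: "B1 k u t = Q.inner1 k u" if "u \<ge> 0" for u
    unfolding B1_halfline[OF t that] Q.inner1_def Q.inner2_def
  proof (rule Bochner_Integration.integral_cong)
    fix p
    show "indicator {0..} p *\<^sub>R (cnj (dn k (u + p) t) * A1 k (u + p) t) =
        indicator {0..} p *\<^sub>R cnj (Qs t (u + p)) * (LINT v|lborel. indicator {0..} v *\<^sub>R Qs t (u + p + v) * phase k v 0)"
    proof (cases "p \<ge> 0")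
      case True
      have "cnj (dn k (u + p) t) * A1 k (u + p) t = cnj (q (u + p) t) * (cnj (phase k (u + p) t) * phase k (u + p) t) *
          (LINT v|lborel. indicator {0..} v *\<^sub>R Qs t (u + p + v) * phase k v 0)"
        using True that by (simp add: A dn_def)
      then show ?thesis using True that by (simp add: phase_cnj Qs_def)
    qed simp
  qed simp
  have "of_real k * Z1 k 0 t - \<i> * g3 t * phase k 0 t =
     (LINT u|lborel. of_real lam * of_real k * phase k 0 t * (Qs t u * (phase k u 0 * Q.inner1 k u))
       + \<i> * phase k 0 t * (Ps t u * phase k u 0))"
    unfolding global_relation[OF t, symmetric]
  proof (rule Bochner_Integration.integral_cong)
    fix u
    show "indicator {0..} u *\<^sub>R (of_real lam * of_real k * (dn k u t * B1 k u t) + \<i> * px p u t * phase k u t) =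
      of_real lam * of_real k * phase k 0 t * (Qs t u * (phase k u 0 * Q.inner1 k u)) + \<i> * phase k 0 t * (Ps t u * phase k u 0)"
      by (cases "u \<ge> 0") (auto simp: B dn_def Qs_def Ps_def phase_split'[of k u t])
  qed simp
  also have "\<dots> = of_real lam * of_real k * phase k 0 t * (LINT u|lborel. Qs t u * (phase k u 0 * Q.inner1 k u))
       + \<i> * phase k 0 t * (LINT u|lborel. Ps t u * phase k u 0)"
  proof (subst Bochner_Integration.integral_add)
    show "integrable lborel (\<lambda>u. of_real lam * of_real k * phase k 0 t * (Qs t u * (phase k u 0 * Q.inner1 k u)))"
      by (intro integrable_mult_right Q.integrable_mult_bounded[where D="C * (C * 1 * (LINT v|lborel. wt v)) * (LINT v|lborel. wt v)"])
        (use Q.inner1_bound in \<open>auto simp: norm_mult intro!: phase_measurable Q.inner1_measurable borel_measurable_times\<close>)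
    show "integrable lborel (\<lambda>u. \<i> * phase k 0 t * (Ps t u * phase k u 0))"
      by (intro integrable_mult_right P.integrable_mult_bounded[where D=1]) (auto intro!: phase_measurable)
  qed (simp only: integral_mult_right_zero)
  finally have "cnj (phase k 0 t) * bulk t k = (cnj (phase k 0 t) * phase k 0 t) * ((LINT u|lborel. Ps t u * phase k u 0) -
    \<i> * of_real lam * of_real k * (LINT u|lborel. Qs t u * (phase k u 0 * Q.inner1 k u)))"
    unfolding bulk_def by (simp add: algebra_simps)
  then show ?thesis by (simp add: phase_cnj)
qed

lemma bulk_limit:
  assumes t: "t \<ge> 0" and d: "\<And>n. d n > 0" "d \<longlonglongrightarrow> 0"
  shows "(\<lambda>n. LINT k|lborel. gw (d n) k * (cnj (phase k 0 t) * bulk t k)) \<longlonglongrightarrow>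
      px p 0 t / 2 + of_real lam / 2 * (g t * halfline_integral (\<lambda>v. md v t))"
    and "integrable lborel (\<lambda>k. gw (d n) k * (cnj (phase k 0 t) * bulk t k))"
proof -
  obtain C where "profile (Qs t) C"
    using profile_slice[OF halfline_classD(8)[OF class_q] pq_cont(1) t] by (auto simp: Qs_def[abs_def])
  then interpret Q: profile "Qs t" C .
  obtain C' where "profile (Ps t) C'"
    using profile_slice[OF halfline_classD(9)[OF class_p] pq_cont(4) t] by (auto simp: Ps_def[abs_def])
  then interpret P: profile "Ps t" C' .
  have eq: "gw (d n) k * (cnj (phase k 0 t) * bulk t k) = gw (d n) k * (LINT u|lborel. Ps t u * phase k u 0) -
     \<i> * of_real lam * (of_real k * gw (d n) k * (LINT u|lborel. Qs t u * (phase k u 0 * Q.inner1 k u)))" for n k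
    unfolding bulk_eq[OF t Q.profile_axioms P.profile_axioms] by (simp add: algebra_simps)
  note i = P.linear_fourier(2)[OF d(1)] Q.triple_fourier(2)[OF d(1)]
  show "integrable lborel (\<lambda>k. gw (d n) k * (cnj (phase k 0 t) * bulk t k))"
    unfolding eq by (intro Bochner_Integration.integrable_diff integrable_mult_right i)
  have "(LINT k|lborel. gw (d n) k * (cnj (phase k 0 t) * bulk t k)) =
     (LINT k|lborel. gw (d n) k * (LINT u|lborel. Ps t u * phase k u 0)) -
     \<i> * of_real lam * (LINT k|lborel. of_real k * gw (d n) k * (LINT u|lborel. Qs t u * (phase k u 0 * Q.inner1 k u)))" for n
    unfolding eq
    by (subst Bochner_Integration.integral_diff) (auto intro!: integrable_mult_right i simp only: integral_mult_right_zero)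
  moreover have "(\<lambda>n. (LINT k|lborel. gw (d n) k * (LINT u|lborel. Ps t u * phase k u 0)) -
     \<i> * of_real lam * (LINT k|lborel. of_real k * gw (d n) k * (LINT u|lborel. Qs t u * (phase k u 0 * Q.inner1 k u)))) \<longlonglongrightarrow>
     Ps t 0 / 2 - \<i> * of_real lam * (\<i> / 2 * (Qs t 0 * (LINT p|lborel. indicator {0..} p *\<^sub>R (Qs t p * cnj (Qs t p)))))"
    by (intro tendsto_diff tendsto_mult_left P.linear_limit Q.triple_limit d)
  moreover have "(LINT p|lborel. indicator {0..} p *\<^sub>R (Qs t p * cnj (Qs t p))) = halfline_integral (\<lambda>v. md v t)"
    by (rule Bochner_Integration.integral_cong) (auto simp: Qs_def md_def indicator_def)
  \<comment> \<open>The sign of the mass term: \<open>- \<i> * lam\<close> from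
    \<open>bulk_eq\<close> times \<open>\<i> / 2\<close> from \<open>triple_limit\<close> is
    \<open>lam / 2\<close>.\<close>
  moreover have alg: "a / 2 - \<i> * of_real lam * (\<i> / 2 * b) = a / 2 + of_real lam / 2 * b" for a b :: complex
    by (simp add: field_simps)
  moreover have "Ps t 0 = px p 0 t" "Qs t 0 = g t" using t by (auto simp: Ps_def Qs_def q_boundary)
  ultimately show "(\<lambda>n. LINT k|lborel. gw (d n) k * (cnj (phase k 0 t) * bulk t k)) \<longlonglongrightarrow>
      px p 0 t / 2 + of_real lam / 2 * (g t * halfline_integral (\<lambda>v. md v t))"
    by (simp only: alg)
qed

text \<open>The kernels are parameters, so that one expression describes the regularised identity,
  with \<open>K0\<close> and \<open>K2\<close>, and its limit, with \<open>L0\<close> and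
  \<open>L2\<close>.\<close>

definition "boundary_terms KA KB t = - integral {0..t} (\<lambda>s. vd 1 g3 s * KA (t - s)) + \<i> * of_real lam *
    ((\<i> * nest3 KB t g (\<lambda>s. cnj (g s)) (vd 1 g) + nest3 KB t g (\<lambda>s. cnj (h s)) h
      - nest3 KB t h (\<lambda>s. cnj (g s)) h + nest3 KB t h (\<lambda>s. cnj (h s)) g)
      - integral {0..t} (\<lambda>s. g s * cnj (g s) * g s * KA (t - s))
      + integral {0..t} (\<lambda>s. g s * cnj (g s) * integral {0..s} (\<lambda>r. vd 1 g r * KA (t - r))))"

text \<open>Reflection \<open>k\<close> to \<open>- k\<close> preserves both the measure and
  \<open>gw\<close>, hence the integral equals that of the even part, in which the unknown
  \<open>px p\<close> no longer occurs. The integrability assumption, supplied by the spatial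
  representation, justifies the averaging.\<close>

lemma bulk_boundary:
  assumes t: "t \<ge> 0" and d: "d > 0"
    and I: "integrable lborel (\<lambda>k. gw d k * (cnj (phase k 0 t) * bulk t k))"
  shows "(LINT k|lborel. gw d k * (cnj (phase k 0 t) * bulk t k)) = boundary_terms (K0 d) (K2 d) t"
proof -
  interpret K0: time_kernel "gw d" "K0 d" by (rule time_kernel_K0[OF d])
  interpret K2: time_kernel "\<lambda>k. (of_real k)^2 * gw d k" "K2 d" by (rule time_kernel_K2[OF d])
  define f where "f k = gw d k * (cnj (phase k 0 t) * bulk t k)" for k
  have I: "integrable lborel f" "integrable lborel (\<lambda>k. f (- k))"
    using I lborel_integrable_real_affine[OF I, of "-1" 0] by (auto simp: f_def[abs_def])
  have "(LINT k|lborel. f k) = (LINT k|lborel. f (- k))"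
    using lborel_integral_real_affine[of "-1" f 0] by simp
  then have "(LINT k|lborel. f k) = (LINT k|lborel. f k + f (- k)) / 2"
    using I by simp
  also have "\<dots> = (LINT k|lborel. (f k + f (- k)) / 2)"
    by simp
  also have "(\<lambda>k. (f k + f (- k)) / 2) = (\<lambda>k. - (gw d k * (cnj (phase k 0 t) * osc_int (vd 1 g3) k t)) + \<i> * of_real lam *
     ((\<i> * ((of_real k)^2 * gw d k * (cnj (phase k 0 t) * osc_int3 g (\<lambda>s. cnj (g s)) (vd 1 g) k t))
        + (of_real k)^2 * gw d k * (cnj (phase k 0 t) * osc_int3 g (\<lambda>s. cnj (h s)) h k t)
      - (of_real k)^2 * gw d k * (cnj (phase k 0 t) * osc_int3 h (\<lambda>s. cnj (g s)) h k t)
      + (of_real k)^2 * gw d k * (cnj (phase k 0 t) * osc_int3 h (\<lambda>s. cnj (h s)) g k t))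
      - gw d k * (cnj (phase k 0 t) * osc_int (\<lambda>s. g s * cnj (g s) * g s) k t)
      + gw d k * (cnj (phase k 0 t) * integral {0..t} (\<lambda>s. g s * cnj (g s) * osc_int (vd 1 g) k s))))"
  proof
    fix k
    have "(f k + f (- k)) / 2 = gw d k * (cnj (phase k 0 t) * ((bulk t k + bulk t (- k)) / 2))"
      by (simp add: f_def gw_def phase_even add_divide_distrib distrib_left)
    also have "(bulk t k + bulk t (- k)) / 2 = - osc_int (vd 1 g3) k t + \<i> * of_real lam *
     ((of_real k)^2 * (\<i> * osc_int3 g (\<lambda>s. cnj (g s)) (vd 1 g) k t + osc_int3 g (\<lambda>s. cnj (h s)) h k t
      - osc_int3 h (\<lambda>s. cnj (g s)) h k t + osc_int3 h (\<lambda>s. cnj (h s)) g k t)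
      - osc_int (\<lambda>s. g s * cnj (g s) * g s) k t + integral {0..t} (\<lambda>s. g s * cnj (g s) * osc_int (vd 1 g) k s))"
      unfolding bulk_def even_part[OF t] by simp
    finally show "(f k + f (- k)) / 2 = - (gw d k * (cnj (phase k 0 t) * osc_int (vd 1 g3) k t)) + \<i> * of_real lam *
     ((\<i> * ((of_real k)^2 * gw d k * (cnj (phase k 0 t) * osc_int3 g (\<lambda>s. cnj (g s)) (vd 1 g) k t))
        + (of_real k)^2 * gw d k * (cnj (phase k 0 t) * osc_int3 g (\<lambda>s. cnj (h s)) h k t)
      - (of_real k)^2 * gw d k * (cnj (phase k 0 t) * osc_int3 h (\<lambda>s. cnj (g s)) h k t)
      + (of_real k)^2 * gw d k * (cnj (phase k 0 t) * osc_int3 h (\<lambda>s. cnj (h s)) g k t))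
      - gw d k * (cnj (phase k 0 t) * osc_int (\<lambda>s. g s * cnj (g s) * g s) k t)
      + gw d k * (cnj (phase k 0 t) * integral {0..t} (\<lambda>s. g s * cnj (g s) * osc_int (vd 1 g) k s)))"
      by (simp add: algebra_simps)
  qed
  also have "(LINT k|lborel. \<dots> k) = boundary_terms (K0 d) (K2 d) t"
  proof -
    have c: "continuous_on {0..} (\<lambda>s. g s * cnj (g s) * g s)" "continuous_on {0..} (\<lambda>s. g s * cnj (g s))"
      by (intro continuous_intros gh_cont)+
    note [simp] = K0.kernel1[OF gh_cont(5) t order_refl] K0.kernel1[OF c(1) t order_refl]
      K0.kernel2[OF c(2) gh_cont(2) t]
      K2.kernel3[OF gh_cont(1) cnj_cont(1) gh_cont(2) t] K2.kernel3[OF gh_cont(1) cnj_cont(2) gh_cont(3) t]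
      K2.kernel3[OF gh_cont(3) cnj_cont(1) gh_cont(3) t] K2.kernel3[OF gh_cont(3) cnj_cont(2) gh_cont(1) t]
    show ?thesis
      unfolding boundary_terms_def nest3_def
      by (simp del: of_real_power One_nat_def)
  qed
  finally show ?thesis by (simp add: f_def)
qed

lemma boundary_limit:
  assumes t: "t \<ge> 0" and d: "\<And>n. d n > 0" "d \<longlonglongrightarrow> 0"
  shows "(\<lambda>n. boundary_terms (K0 (d n)) (K2 (d n)) t) \<longlonglongrightarrow> boundary_terms L0 L2 t"
proof -
  have c: "continuous_on {0..} (\<lambda>s. g s * cnj (g s) * g s)" "continuous_on {0..} (\<lambda>s. g s * cnj (g s))"
    by (intro continuous_intros gh_cont)+
  have l: "(\<lambda>n. K0 (d n) \<sigma>) \<longlonglongrightarrow> L0 \<sigma>" "(\<lambda>n. K2 (d n) \<sigma>) \<longlonglongrightarrow> L2 \<sigma>" if "\<sigma> > 0" for \<sigma>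
    using K_limits[OF d(2) that] by (simp_all add: L0_def L2_def)
  note kl1 = kernel_limit1[of "\<lambda>n. K0 (d n)", OF K_cont(1)[OF d(1)] K_bounds(1) l(1) _ t]
  note kl2 = kernel_limit2[of "\<lambda>n. K0 (d n)", OF K_cont(1)[OF d(1)] K_bounds(1) _ l(1) _ _ t]
  note kl3 = kernel_limit3[of "\<lambda>n. K2 (d n)", OF K_cont(2)[OF d(1)] K_bounds(2) _ l(2) _ _ _ t]
  show ?thesis
    unfolding boundary_terms_def nest3_def
    by (intro tendsto_add tendsto_diff tendsto_minus tendsto_mult_left kl1 kl2 kl3 gh_cont cnj_cont c) simp_all
qed

lemma neumann_value:
  assumes t: "t \<ge> 0"
  shows "px p 0 t = 2 * boundary_terms L0 L2 t + \<i> * of_real lam * g t *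
     integral {0..t} (\<lambda>s. cnj (g s) * h s - cnj (h s) * g s)"
proof -
  \<comment> \<open>Any positive null sequence serves: along it the spatial and the boundary
    evaluation of the same \<open>k\<close>-integral converge, and the two limits must
    agree.\<close>
  define d where "d n = 1 / real (Suc n)" for n
  have d: "\<And>n. d n > 0" "d \<longlonglongrightarrow> 0"
    using LIMSEQ_Suc[OF lim_1_over_n] by (simp_all add: d_def[abs_def])
  have "(\<lambda>n. boundary_terms (K0 (d n)) (K2 (d n)) t) \<longlonglongrightarrow>
      px p 0 t / 2 + of_real lam / 2 * (g t * halfline_integral (\<lambda>v. md v t))"
    using bulk_limit(1)[OF t d] bulk_boundary[OF t d(1) bulk_limit(2)[OF t d]] by simp
  from LIMSEQ_unique[OF this boundary_limit[OF t d]]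
  have "px p 0 t / 2 + of_real lam / 2 * (g t * halfline_integral (\<lambda>v. md v t)) = boundary_terms L0 L2 t" .
  then show ?thesis unfolding mass_identity[OF t] h_def by (simp add: field_simps)
qed

lemma neumann_formula:
  assumes t: "t \<ge> 0"
  defines "c \<equiv> of_real (sqrt pi / 2) * exp (- (\<i> * of_real (pi / 4)))"
  shows "px p 0 t =
          2 * of_real lam * c / (of_real pi * \<i>) *
            integral {0..t} (\<lambda>t1. of_real ((cmod (g t1))^2) * g t1 / of_real (sqrt (t - t1)))
        - 2 * of_real lam * c / (of_real pi * \<i>) *
            integral {0..t} (\<lambda>t1. of_real ((cmod (g t1))^2) *
              integral {0..t1} (\<lambda>t2. vd 1 g t2 / of_real (sqrt (t - t2))))
        - 2 * c / of_real pi *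
            integral {0..t} (\<lambda>t1. vd 1 g3 t1 / of_real (sqrt (t - t1)))
        - of_real lam * c / (of_real pi * \<i>) *
            integral {0..t} (\<lambda>t1. g t1 *
              integral {0..t1} (\<lambda>t2. cnj (g t2) *
                integral {0..t2} (\<lambda>t3. vd 1 g t3 / of_real ((t - t1 + t2 - t3) powr (3/2)))))
        + of_real lam * c / of_real pi *
            integral {0..t} (\<lambda>t1. g t1 *
              integral {0..t1} (\<lambda>t2. cnj (px q 0 t2) *
                integral {0..t2} (\<lambda>t3. px q 0 t3 / of_real ((t - t1 + t2 - t3) powr (3/2)))))
        - of_real lam * c / of_real pi *
            integral {0..t} (\<lambda>t1. px q 0 t1 *
              integral {0..t1} (\<lambda>t2. cnj (g t2) *
                integral {0..t2} (\<lambda>t3. px q 0 t3 / of_real ((t - t1 + t2 - t3) powr (3/2)))))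
        + of_real lam * c / of_real pi *
            integral {0..t} (\<lambda>t1. px q 0 t1 *
              integral {0..t1} (\<lambda>t2. cnj (px q 0 t2) *
                integral {0..t2} (\<lambda>t3. g t3 / of_real ((t - t1 + t2 - t3) powr (3/2)))))
        + \<i> * of_real lam * g t *
            integral {0..t} (\<lambda>t1. cnj (g t1) * px q 0 t1 - cnj (px q 0 t1) * g t1)"
proof -
  define e where "e = rot / of_real (2 * sqrt pi)"
  define N where "N a b f = integral {0..t} (\<lambda>t1. a t1 * integral {0..t1} (\<lambda>t2. b t2 *
      integral {0..t2} (\<lambda>t3. f t3 / of_real ((t - t1 + t2 - t3) powr (3/2)))))" for a b f :: "real \<Rightarrow> complex"
  have pi: "complex_of_real pi = of_real (sqrt pi) * of_real (sqrt pi)"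
    by (simp flip: of_real_mult)
  \<comment> \<open>The constant \<open>c\<close> of the theorem is \<open>pi\<close> times the
    coefficient \<open>e\<close> of the limit kernel \<open>L0\<close>; this is why every
    coefficient in the formula reads \<open>c / pi\<close>.\<close>
  have c: "c = e * of_real pi"
    unfolding c_def e_def rot_def[symmetric] pi by simp
  \<comment> \<open>The coefficient of \<open>L2\<close> is \<open>- \<i> / 2\<close> times that of
    \<open>L0\<close>; with the prefactor \<open>2 * \<i> * lam\<close> the triple integrals get
    \<open>lam * e\<close>.\<close>
  have e2: "- \<i> * rot / of_real (4 * sqrt pi) = - \<i> / 2 * e" by (simp add: e_def)
  have nest: "nest3 L2 t a b f = - \<i> / 2 * e * N a b f" for a b f
    unfolding nest3_def N_def L2_def e2 integral_kernel_const integral_pull_const ..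
  have "px p 0 t = 2 * (- (e * integral {0..t} (\<lambda>s. vd 1 g3 s / of_real (sqrt (t - s)))) + \<i> * of_real lam *
    (- \<i> / 2 * e * (\<i> * N g (\<lambda>s. cnj (g s)) (vd 1 g) + N g (\<lambda>s. cnj (h s)) h - N h (\<lambda>s. cnj (g s)) h + N h (\<lambda>s. cnj (h s)) g)
      - e * integral {0..t} (\<lambda>s. g s * cnj (g s) * g s / of_real (sqrt (t - s)))
      + e * integral {0..t} (\<lambda>s. g s * cnj (g s) * integral {0..s} (\<lambda>r. vd 1 g r / of_real (sqrt (t - r))))))
     + \<i> * of_real lam * g t * integral {0..t} (\<lambda>s. cnj (g s) * h s - cnj (h s) * g s)"
    unfolding neumann_value[OF t] boundary_terms_def nest L0_def e_def[symmetric] integral_kernel_const integral_pull_const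
    by (simp only: distrib_left right_diff_distrib mult_ac)
  then show ?thesis
    unfolding c N_def complex_norm_square h_def
    by (simp add: algebra_simps)
qed

end

theorem theorem5p1:
  fixes lam :: real
    and g01 g02 g03 :: "real \<Rightarrow> complex"
    and q1 q2 q3 :: "real \<Rightarrow> real \<Rightarrow> complex"
    and t :: real
  assumes lam: "lam \<in> {1, -1}"
    and g01: "flat_smooth g01" and g02: "flat_smooth g02" and g03: "flat_smooth g03"
    and ord1: "lin_schr_bvp q1 (\<lambda>x s. 0) g01"
    and ord2: "lin_schr_bvp q2 (\<lambda>x s. 0) g02"
    and ord3: "lin_schr_bvp q3
                 (\<lambda>x s. 2 * of_real lam * (of_real ((cmod (q1 x s))^2) * q1 x s)) g03"
    and t: "t \<ge> 0"
  shows
    "let c = of_real (sqrt pi / 2) * exp (- (\<i> * of_real (pi / 4)));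
         e = exp (- (\<i> * of_real (pi / 4))) / of_real (sqrt pi);
         g11 = (\<lambda>s. px q1 0 s)
     in px q1 0 t = - e * integral {0..t} (\<lambda>s. vd 1 g01 s / of_real (sqrt (t - s)))
      \<and> px q2 0 t = - e * integral {0..t} (\<lambda>s. vd 1 g02 s / of_real (sqrt (t - s)))
      \<and> px q3 0 t =
          2 * of_real lam * c / (of_real pi * \<i>) *
            integral {0..t} (\<lambda>t1. of_real ((cmod (g01 t1))^2) * g01 t1 / of_real (sqrt (t - t1)))
        - 2 * of_real lam * c / (of_real pi * \<i>) *
            integral {0..t} (\<lambda>t1. of_real ((cmod (g01 t1))^2) *
              integral {0..t1} (\<lambda>t2. vd 1 g01 t2 / of_real (sqrt (t - t2))))
        - 2 * c / of_real pi *
            integral {0..t} (\<lambda>t1. vd 1 g03 t1 / of_real (sqrt (t - t1)))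
        - of_real lam * c / (of_real pi * \<i>) *
            integral {0..t} (\<lambda>t1. g01 t1 *
              integral {0..t1} (\<lambda>t2. cnj (g01 t2) *
                integral {0..t2} (\<lambda>t3. vd 1 g01 t3 / of_real ((t - t1 + t2 - t3) powr (3/2)))))
        + of_real lam * c / of_real pi *
            integral {0..t} (\<lambda>t1. g01 t1 *
              integral {0..t1} (\<lambda>t2. cnj (g11 t2) *
                integral {0..t2} (\<lambda>t3. g11 t3 / of_real ((t - t1 + t2 - t3) powr (3/2)))))
        - of_real lam * c / of_real pi *
            integral {0..t} (\<lambda>t1. g11 t1 *
              integral {0..t1} (\<lambda>t2. cnj (g01 t2) *
                integral {0..t2} (\<lambda>t3. g11 t3 / of_real ((t - t1 + t2 - t3) powr (3/2)))))
        + of_real lam * c / of_real pi *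
            integral {0..t} (\<lambda>t1. g11 t1 *
              integral {0..t1} (\<lambda>t2. cnj (g11 t2) *
                integral {0..t2} (\<lambda>t3. g01 t3 / of_real ((t - t1 + t2 - t3) powr (3/2)))))
        + \<i> * of_real lam * g01 t *
            integral {0..t} (\<lambda>t1. cnj (g01 t1) * g11 t1 - cnj (g11 t1) * g01 t1)"
proof -
  have z: "lin_schr_bvp q (\<lambda>x s. 2 * of_real 0 * (of_real ((cmod (q1 x s))^2) * q1 x s)) h \<longleftrightarrow>
      lin_schr_bvp q (\<lambda>x s. 0) h" for q h by simp
  \<comment> \<open>At \<open>lam = 0\<close> the forcing vanishes, so \<open>q1\<close> also
    qualifies as the second component \<open>p\<close>, with its own datum.\<close>
  interpret one: schroedinger_pair 0 q1 q1 g01 g01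
    by unfold_locales (use g01 ord1 in \<open>simp_all only: z\<close>)
  \<comment> \<open>The second order is again free: \<open>q2\<close> takes the place of
    \<open>p\<close>, and \<open>q1\<close> enters only through terms multiplied by zero.\<close>
  interpret two: schroedinger_pair 0 q1 q2 g01 g02
    by unfold_locales (use g01 g02 ord1 ord2 in \<open>simp_all only: z\<close>)
  interpret three: schroedinger_pair lam q1 q3 g01 g03
    by unfold_locales (use g01 g03 ord1 ord3 in simp_all)
  \<comment> \<open>Converts the coefficient \<open>2 * c / pi\<close> of the linear term into the
    normalisation \<open>exp (- \<i> pi / 4) / sqrt pi\<close> of the first two formulas.\<close>
  have c: "2 * (of_real (sqrt pi / 2) * w) / of_real pi = w / of_real (sqrt pi)" for w :: complex
  proof -
    have "complex_of_real pi = of_real (sqrt pi) * of_real (sqrt pi)" by (simp flip: of_real_mult)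
    then show ?thesis by (simp add: divide_simps)
  qed
  show ?thesis
    unfolding Let_def
    using one.neumann_formula[OF t] two.neumann_formula[OF t] three.neumann_formula[OF t]
    by (simp only: c of_real_0 mult_zero_left mult_zero_right div_0 diff_zero add_0 add_0_right diff_0 minus_mult_left)
qed

end
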